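(* There is an absolute constant $C$ such that the following holds. Consider the Sherrington-Kirkpatrick model at inverse temperature $\beta\ge0$. Take any $N\ge2$ and $p\in(0,1]$ with $pN^2$ an integer. Suppose a randomly chosen fraction $p$ of the couplings $(g_{ij})_{1\le i,j\le N}$ (that is, the couplings indexed by a uniformly random subset of size $pN^2$ of $\{(i,j):1\le i,j\le N\}$) are replaced by independent copies to give a perturbed Gibbs measure. Let $\sigma^1$ be chosen from the original Gibbs measure and $\sigma^2$ from the perturbed measure. Then $$\mathbb{E}(R_{1,2}^2)\le\frac{C(1+\beta)}{p\log N},$$ where the expectation is taken over all randomness.
   Context: The Sherrington-Kirkpatrick (S-K) model: $(g_{ij})_{1\le i,j\le N}$ are i.i.d. standard Gaussian random variables (the couplings), the Hamiltonian is $H_N(\sigma)=-\frac1{\sqrt{2N}}\sum_{1\le i,j\le N}g_{ij}\sigma_i\sigma_j$ for $\sigma\in\{-1,1\}^N$, and the Gibbs measure at inverse temperature $\beta$ is the probability measure on $\{-1,1\}^N$ giving mass proportional to $e^{-\beta H_N(\sigma)}$ to $\sigma$. The perturbed Gibbs measure is the Gibbs measure at the same $\beta$ of the Hamiltonian with the perturbed couplings. The random subset is independent of the couplings and their copies. Given both sets of couplings, $\sigma^1$ and $\sigma^2$ are drawn independently. The overlap is $R_{1,2}:=\frac1N\sum_{i=1}^N\sigma^1_i\sigma^2_i$. *)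

theory Defs
  imports "HOL-Probability.Probability"
begin

definition pairs :: "nat \<Rightarrow> (nat \<times> nat) set" where
  "pairs N = {1..N} \<times> {1..N}"

definition configs :: "nat \<Rightarrow> (nat \<Rightarrow> real) set" where
  "configs N = {1..N} \<rightarrow>\<^sub>E {-1, 1}"

definition hamiltonian :: "nat \<Rightarrow> (nat \<times> nat \<Rightarrow> real) \<Rightarrow> (nat \<Rightarrow> real) \<Rightarrow> real" where
  "hamiltonian N g \<sigma> =
     - (1 / sqrt (2 * real N)) * (\<Sum>i=1..N. \<Sum>j=1..N. g (i, j) * \<sigma> i * \<sigma> j)"

definition partition_function :: "nat \<Rightarrow> real \<Rightarrow> (nat \<times> nat \<Rightarrow> real) \<Rightarrow> real" where
  "partition_function N \<beta> g = (\<Sum>\<sigma>\<in>configs N. exp (- \<beta> * hamiltonian N g \<sigma>))"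

definition gibbs :: "nat \<Rightarrow> real \<Rightarrow> (nat \<times> nat \<Rightarrow> real) \<Rightarrow> (nat \<Rightarrow> real) measure" where
  "gibbs N \<beta> g = point_measure (configs N)
     (\<lambda>\<sigma>. ennreal (exp (- \<beta> * hamiltonian N g \<sigma>) / partition_function N \<beta> g))"

definition overlap :: "nat \<Rightarrow> (nat \<Rightarrow> real) \<Rightarrow> (nat \<Rightarrow> real) \<Rightarrow> real" where
  "overlap N \<sigma> \<tau> = (1 / real N) * (\<Sum>i=1..N. \<sigma> i * \<tau> i)"

definition couplings :: "nat \<Rightarrow> (nat \<times> nat \<Rightarrow> real) measure" where
  "couplings N = (\<Pi>\<^sub>M e\<in>pairs N. density lborel (\<lambda>x. ennreal (std_normal_density x)))"

text \<open>The admissible index sets have exactly \<open>p N\<^sup>2\<close> elements; there are none unless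
  \<open>p N\<^sup>2\<close> is an integer between \<open>0\<close> and \<open>N\<^sup>2\<close>.\<close>

definition perturbation_sets :: "nat \<Rightarrow> real \<Rightarrow> (nat \<times> nat) set set" where
  "perturbation_sets N p = {S. S \<subseteq> pairs N \<and> real (card S) = p * (real N)\<^sup>2}"

definition disorder :: "nat \<Rightarrow> real \<Rightarrow>
    ((nat \<times> nat \<Rightarrow> real) \<times> (nat \<times> nat \<Rightarrow> real) \<times> (nat \<times> nat) set) measure" where
  "disorder N p =
     couplings N \<Otimes>\<^sub>M couplings N \<Otimes>\<^sub>M uniform_count_measure (perturbation_sets N p)"

definition perturb ::
    "(nat \<times> nat) set \<Rightarrow> (nat \<times> nat \<Rightarrow> real) \<Rightarrow> (nat \<times> nat \<Rightarrow> real) \<Rightarrow> nat \<times> nat \<Rightarrow> real" where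
  "perturb S g g' = (\<lambda>e. if e \<in> S then g' e else g e)"

text \<open>Joint law of \<open>(\<sigma>\<^sup>1, \<sigma>\<^sup>2)\<close> with the disorder averaged out: draw the couplings, their copies
  and the random subset, and then, given these, the two configurations independently.\<close>

definition replica_law ::
    "nat \<Rightarrow> real \<Rightarrow> real \<Rightarrow> ((nat \<Rightarrow> real) \<times> (nat \<Rightarrow> real)) measure" where
  "replica_law N \<beta> p = disorder N p \<bind>
     (\<lambda>(g, g', S). gibbs N \<beta> g \<Otimes>\<^sub>M gibbs N \<beta> (perturb S g g'))"

text \<open>The constructions of measures above are total, also when a kernel is not measurable. The
  following facts show that here they produce genuine probability measures.\<close>

lemma finite_pairs [simp]: "finite (pairs N)"
  by (simp add: pairs_def)

lemma finite_configs [simp]: "finite (configs N)"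
  by (simp add: configs_def finite_PiE)

lemma configs_nonempty [simp]: "configs N \<noteq> {}"
  by (simp add: configs_def PiE_eq_empty_iff)

lemma partition_function_pos: "0 < partition_function N \<beta> g"
  unfolding partition_function_def by (intro sum_pos) auto

lemma space_gibbs [simp]: "space (gibbs N \<beta> g) = configs N"
  by (simp add: gibbs_def space_point_measure)

lemma sets_gibbs [simp, measurable_cong]: "sets (gibbs N \<beta> g) = sets (count_space (configs N))"
  by (simp add: gibbs_def sets_point_measure)

lemma prob_space_gibbs: "prob_space (gibbs N \<beta> g)"
proof (rule prob_spaceI)
  have "emeasure (gibbs N \<beta> g) (space (gibbs N \<beta> g)) =
      (\<Sum>\<sigma>\<in>configs N. ennreal (exp (- \<beta> * hamiltonian N g \<sigma>) / partition_function N \<beta> g))"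
    by (simp add: gibbs_def space_point_measure emeasure_point_measure_finite)
  also have "\<dots> = ennreal (\<Sum>\<sigma>\<in>configs N. exp (- \<beta> * hamiltonian N g \<sigma>) / partition_function N \<beta> g)"
    using partition_function_pos[of N \<beta> g] by (intro sum_ennreal) (simp add: less_imp_le)
  also have "(\<Sum>\<sigma>\<in>configs N. exp (- \<beta> * hamiltonian N g \<sigma>) / partition_function N \<beta> g) = 1"
    using partition_function_pos[of N \<beta> g]
    by (subst sum_divide_distrib[symmetric], subst partition_function_def[symmetric]) simp
  finally show "emeasure (gibbs N \<beta> g) (space (gibbs N \<beta> g)) = 1" by simp
qed

lemma prob_space_couplings: "prob_space (couplings N)"
  unfolding couplings_def by (intro prob_space_PiM prob_space_normal_density) simp

lemma finite_perturbation_sets [simp]: "finite (perturbation_sets N p)"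
  by (rule finite_subset[of _ "Pow (pairs N)"]) (auto simp: perturbation_sets_def)

lemma perturbation_sets_nonempty:
  assumes "0 \<le> p" "p \<le> 1" "p * (real N)\<^sup>2 \<in> \<int>"
  shows "perturbation_sets N p \<noteq> {}"
proof -
  have "p * (real N)\<^sup>2 \<in> \<nat>"
    using assms by (simp add: Nats_altdef2)
  then obtain k where k: "p * (real N)\<^sup>2 = real k"
    by (auto elim: Nats_cases)
  have "real k \<le> real (N\<^sup>2)"
    using mult_right_mono[OF assms(2), of "(real N)\<^sup>2"] k by simp
  then have "k \<le> card (pairs N)"
    by (simp add: pairs_def power2_eq_square del: of_nat_power of_nat_mult)
  then obtain S where "S \<subseteq> pairs N" "card S = k"
    by (rule obtain_subset_with_card_n)
  then show ?thesis
    using k by (auto simp: perturbation_sets_def)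
qed

lemma prob_space_disorder:
  assumes "0 \<le> p" "p \<le> 1" "p * (real N)\<^sup>2 \<in> \<int>"
  shows "prob_space (disorder N p)"
proof -
  interpret c: prob_space "couplings N" by (rule prob_space_couplings)
  interpret u: prob_space "uniform_count_measure (perturbation_sets N p)"
    by (intro prob_space_uniform_count_measure perturbation_sets_nonempty assms) simp
  interpret cu: pair_prob_space "couplings N" "uniform_count_measure (perturbation_sets N p)" ..
  interpret ccu: pair_prob_space "couplings N"
    "couplings N \<Otimes>\<^sub>M uniform_count_measure (perturbation_sets N p)" ..
  show ?thesis unfolding disorder_def by (rule ccu.prob_space_axioms)
qed

lemma measurable_gibbs:
  assumes [measurable]: "\<And>e. e \<in> pairs N \<Longrightarrow> (\<lambda>x. f x e) \<in> borel_measurable M"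
  shows "(\<lambda>x. gibbs N \<beta> (f x)) \<in> measurable M (subprob_algebra (count_space (configs N)))"
proof (rule measurable_subprob_algebra)
  have H [measurable]: "(\<lambda>x. hamiltonian N (f x) \<sigma>) \<in> borel_measurable M" for \<sigma>
    unfolding hamiltonian_def by (intro borel_measurable_times borel_measurable_const
      borel_measurable_sum assms) (auto simp: pairs_def)
  fix A assume "A \<in> sets (count_space (configs N))"
  then have A: "A \<subseteq> configs N" by simp
  then show "(\<lambda>x. emeasure (gibbs N \<beta> (f x)) A) \<in> borel_measurable M"
    by (simp add: gibbs_def emeasure_point_measure_finite partition_function_def)
qed (auto intro: prob_space_imp_subprob_space prob_space_gibbs)

lemma measurable_gibbs_pair:
  "(\<lambda>(g, g', S). gibbs N \<beta> g \<Otimes>\<^sub>M gibbs N \<beta> (perturb S g g')) \<in> measurable (disorder N p)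
     (subprob_algebra (count_space (configs N) \<Otimes>\<^sub>M count_space (configs N)))"
proof -
  have c: "(\<lambda>g. g e) \<in> borel_measurable (couplings N)" if "e \<in> pairs N" for e
    using measurable_component_singleton[OF that, of "\<lambda>_. density lborel (\<lambda>x. ennreal (std_normal_density x))"]
    by (simp add: couplings_def)
  have u: "sets (uniform_count_measure (perturbation_sets N p)) = sets (count_space (perturbation_sets N p))"
    by (simp add: sets_uniform_count_measure)
  have 1: "(\<lambda>x. fst x e) \<in> borel_measurable (disorder N p)" if "e \<in> pairs N" for e
    unfolding disorder_def using c[OF that] by measurable
  have 2: "(\<lambda>x. fst (snd x) e) \<in> borel_measurable (disorder N p)" if "e \<in> pairs N" for e
    unfolding disorder_def using c[OF that] by measurable
  have "(\<lambda>x. snd (snd x)) \<in> measurable (disorder N p) (uniform_count_measure (perturbation_sets N p))"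
    unfolding disorder_def by measurable
  then have 3: "(\<lambda>x. snd (snd x)) \<in> measurable (disorder N p) (count_space (perturbation_sets N p))"
    by (simp add: measurable_cong_sets[OF refl u])
  have 4: "Measurable.pred (disorder N p) (\<lambda>x. e \<in> snd (snd x))" for e
    by (rule measurable_compose[OF 3]) simp
  have 5: "(\<lambda>x. perturb (snd (snd x)) (fst x) (fst (snd x)) e) \<in> borel_measurable (disorder N p)"
    if "e \<in> pairs N" for e
    unfolding perturb_def using 1[OF that] 2[OF that] 4[of e] by measurable
  show ?thesis
    unfolding case_prod_beta
    by (intro measurable_pair_measure measurable_gibbs 1 5)
qed

lemma prob_space_replica_law:
  assumes "0 \<le> p" "p \<le> 1" "p * (real N)\<^sup>2 \<in> \<int>"
  shows "prob_space (replica_law N \<beta> p)"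
proof -
  interpret prob_space "disorder N p" by (rule prob_space_disorder[OF assms])
  have "prob_space (gibbs N \<beta> g \<Otimes>\<^sub>M gibbs N \<beta> h)" for g h
    by (intro prob_space_pair prob_space_gibbs)
  then show ?thesis
    unfolding replica_law_def
    by (intro prob_space_bind[OF _ measurable_gibbs_pair]) (auto simp: case_prod_beta)
qed

lemma sets_replica_law:
  assumes "0 \<le> p" "p \<le> 1" "p * (real N)\<^sup>2 \<in> \<int>"
  shows "sets (replica_law N \<beta> p) = Pow (configs N \<times> configs N)"
proof -
  interpret prob_space "disorder N p" by (rule prob_space_disorder[OF assms])
  have "sets (replica_law N \<beta> p) = sets (count_space (configs N) \<Otimes>\<^sub>M count_space (configs N))"
    unfolding replica_law_def
    by (rule sets_bind[OF sets_kernel[OF measurable_gibbs_pair] not_empty])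
  then show ?thesis
    by (subst (asm) pair_measure_count_space) simp_all
qed

end

theory Submission
  imports Defs
begin

text \<open>
  Write \<open>\<theta>\<^sub>A\<close> for \<open>E(R\<^sub>1\<^sub>,\<^sub>2\<^sup>2)\<close> when exactly the couplings in \<open>A\<close> are shared. Since \<open>N\<^sup>2 R\<^sub>1\<^sub>,\<^sub>2\<^sup>2\<close> is the sum
  over \<open>e = (i, j)\<close> of \<open>\<sigma>\<^sup>1\<^sub>i \<sigma>\<^sup>1\<^sub>j \<sigma>\<^sup>2\<^sub>i \<sigma>\<^sup>2\<^sub>j\<close>, the Efron-Stein decomposition of the magnetizations
  gives weights \<open>w\<^sub>B \<ge> 0\<close> with \<open>\<theta>\<^sub>A = \<Sum>\<^sub>B\<^sub>\<subseteq>\<^sub>A w\<^sub>B\<close>. Replacing a random fraction \<open>p\<close> damps \<open>w\<^sub>B\<close> by at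
  least \<open>exp (- p |B|)\<close>, while keeping each coupling independently with probability \<open>s\<close> damps it
  by exactly \<open>s\<^sup>|\<^sup>B\<^sup>|\<close>. It therefore suffices that \<open>\<Sum>\<^sub>B w\<^sub>B s\<^sup>|\<^sup>B\<^sup>| = O(1 / sqrt N)\<close> for some \<open>s\<close> of order
  \<open>(1 + \<beta>)\<^sup>-\<^sup>3\<close>: the levels \<open>|B| \<le> m\<close> with \<open>m\<close> of order \<open>log N / (1 + \<beta>)\<close> then contribute little, and the
  remaining ones at most \<open>exp (- p m) \<le> 1 / (p m)\<close>.

  For that bound, consider \<open>G(s, \<lambda>) = E exp (\<lambda> N\<^sup>2 R\<^sub>1\<^sub>,\<^sub>2\<^sup>2)\<close>. Sharing one more coupling changes the joint
  law of the replicas by a one-dimensional covariance, and summing over the couplings gives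
  \<open>\<partial>\<^sub>s G \<le> (\<beta>\<^sup>2 / N) \<partial>\<^sub>\<lambda> G + O(\<beta>\<^sup>3 sqrt N) G\<close>. Integrating along characteristics reduces to \<open>s = 0\<close>, where by
  gauge symmetry the overlap is that of independent uniform signs. Jensen's inequality passes
  from the exponential moment back to \<open>E(R\<^sub>1\<^sub>,\<^sub>2\<^sup>2)\<close>.
\<close>

subsection \<open>Resampled couplings and their spectrum\<close>

text \<open>Boundedness gives integrability over every finite measure and survives products and
  partial integration, so it is the one side condition carried through all Fubini arguments
  below.\<close>

definition bdd_meas :: "'a measure \<Rightarrow> ('a \<Rightarrow> real) \<Rightarrow> bool" where
  "bdd_meas M f \<longleftrightarrow> f \<in> borel_measurable M \<and> (\<exists>B. \<forall>x\<in>space M. \<bar>f x\<bar> \<le> B)"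

lemma bdd_measI: "f \<in> borel_measurable M \<Longrightarrow> (\<And>x. x \<in> space M \<Longrightarrow> \<bar>f x\<bar> \<le> B) \<Longrightarrow> bdd_meas M f"
  unfolding bdd_meas_def by blast

lemma bdd_meas_measurable: "bdd_meas M f \<Longrightarrow> f \<in> borel_measurable M"
  by (simp add: bdd_meas_def)

lemma bdd_meas_const: "bdd_meas M (\<lambda>_. c)"
  by (rule bdd_measI) auto

lemma bdd_meas_add:
  assumes "bdd_meas M f" "bdd_meas M g" shows "bdd_meas M (\<lambda>x. f x + g x)"
proof -
  obtain B C where "\<And>x. x \<in> space M \<Longrightarrow> \<bar>f x\<bar> \<le> B" "\<And>x. x \<in> space M \<Longrightarrow> \<bar>g x\<bar> \<le> C"
    using assms unfolding bdd_meas_def by blast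
  then have "\<bar>f x + g x\<bar> \<le> B + C" if "x \<in> space M" for x
    using that by (meson abs_triangle_ineq add_mono order_trans)
  then show ?thesis using assms by (intro bdd_measI) (auto simp: bdd_meas_def)
qed

lemma bdd_meas_mult:
  assumes "bdd_meas M f" "bdd_meas M g" shows "bdd_meas M (\<lambda>x. f x * g x)"
proof -
  obtain B C where BC: "\<And>x. x \<in> space M \<Longrightarrow> \<bar>f x\<bar> \<le> B" "\<And>x. x \<in> space M \<Longrightarrow> \<bar>g x\<bar> \<le> C"
    using assms unfolding bdd_meas_def by blast
  have "\<bar>f x * g x\<bar> \<le> \<bar>B\<bar> * \<bar>C\<bar>" if "x \<in> space M" for x
    using BC[OF that] by (auto simp: abs_mult intro!: mult_mono)
  then show ?thesis using assms by (intro bdd_measI) (auto simp: bdd_meas_def)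
qed

lemma bdd_meas_diff:
  "bdd_meas M f \<Longrightarrow> bdd_meas M g \<Longrightarrow> bdd_meas M (\<lambda>x. f x - g x)"
  using bdd_meas_add[of M f "\<lambda>x. -1 * g x"] bdd_meas_mult[OF bdd_meas_const[of M "-1"], of g] by simp

lemma bdd_meas_sum: "(\<And>i. i \<in> A \<Longrightarrow> bdd_meas M (f i)) \<Longrightarrow> bdd_meas M (\<lambda>x. \<Sum>i\<in>A. f i x)"
  by (induction A rule: infinite_finite_induct) (auto intro: bdd_meas_const bdd_meas_add)

lemma bdd_meas_compose:
  "bdd_meas N f \<Longrightarrow> h \<in> measurable M N \<Longrightarrow> bdd_meas M (\<lambda>x. f (h x))"
  unfolding bdd_meas_def by (auto dest: measurable_space measurable_compose)

lemma bdd_meas_integrable: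
  assumes "finite_measure M" "bdd_meas M f" shows "integrable M f"
proof -
  interpret finite_measure M by fact
  obtain B where "\<And>x. x \<in> space M \<Longrightarrow> \<bar>f x\<bar> \<le> B" "f \<in> borel_measurable M"
    using assms(2) unfolding bdd_meas_def by blast
  then show ?thesis by (intro integrable_const_bound[where B=B]) auto
qed

lemma bdd_meas_integral:
  assumes "prob_space N" "bdd_meas (M \<Otimes>\<^sub>M N) (\<lambda>(x, y). f x y)"
  shows "bdd_meas M (\<lambda>x. \<integral>y. f x y \<partial>N)"
proof -
  interpret prob_space N by fact
  obtain B where B: "\<And>x y. x \<in> space M \<Longrightarrow> y \<in> space N \<Longrightarrow> \<bar>f x y\<bar> \<le> B"
    using assms(2) unfolding bdd_meas_def by (auto simp: space_pair_measure)
  have [measurable]: "(\<lambda>(x, y). f x y) \<in> borel_measurable (M \<Otimes>\<^sub>M N)"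
    using assms(2) by (rule bdd_meas_measurable)
  show ?thesis
  proof (rule bdd_measI)
    show "(\<lambda>x. \<integral>y. f x y \<partial>N) \<in> borel_measurable M" by measurable
    fix x assume x: "x \<in> space M"
    have "integrable N (f x)"
      using x B[OF x] by (intro integrable_const_bound[where B=B]) auto
    then have "\<bar>\<integral>y. f x y \<partial>N\<bar> \<le> (\<integral>y. \<bar>f x y\<bar> \<partial>N)" by (intro integral_abs_bound)
    also have "\<dots> \<le> (\<integral>y. B \<partial>N)"
      using B[OF x] \<open>integrable N (f x)\<close> by (intro integral_mono) auto
    finally show "\<bar>\<integral>y. f x y \<partial>N\<bar> \<le> B" by (simp add: prob_space)
  qed
qed

lemma sum_Pow_insert:
  assumes "finite F" "e \<notin> F"
  shows "(\<Sum>B\<in>Pow (insert e F). f B) = (\<Sum>B\<in>Pow F. f B) + (\<Sum>B\<in>Pow F. f (insert e B))"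
proof -
  have "inj_on (insert e) (Pow F)" using assms(2) by (auto simp: inj_on_def)
  then have "(\<Sum>B\<in>insert e ` Pow F. f B) = (\<Sum>B\<in>Pow F. f (insert e B))"
    by (simp add: sum.reindex)
  then show ?thesis
    unfolding Pow_insert using assms by (subst sum.union_disjoint) auto
qed

section \<open>Pairs of coupling arrays with a shared part\<close>

locale resampling =
  fixes I :: "(nat \<times> nat) set" and \<gamma> :: "real measure"
  assumes fin: "finite I" and prob: "prob_space \<gamma>" and sets_\<gamma>: "sets \<gamma> = sets borel"
begin

abbreviation M where "M \<equiv> PiM I (\<lambda>_. \<gamma>)"

text \<open>Expectation of \<open>U\<close> at two coupling arrays that share the entries in \<open>A\<close> and are independent
  elsewhere, so \<open>A\<close> is the complement of the replaced set.\<close>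

definition pair_mean :: "(nat \<times> nat) set \<Rightarrow> ((nat \<times> nat \<Rightarrow> real) \<Rightarrow> (nat \<times> nat \<Rightarrow> real) \<Rightarrow> real) \<Rightarrow> real" where
  "pair_mean A U = (\<integral>g. \<integral>g'. U g (perturb (I - A) g g') \<partial>M \<partial>M)"

text \<open>The conditional expectation of \<open>u\<close> given all couplings except
  \<open>e\<close>, kept as a function on full arrays that ignores its entry at
  \<open>e\<close>.\<close>

definition resample :: "nat \<times> nat \<Rightarrow> ((nat \<times> nat \<Rightarrow> real) \<Rightarrow> real) \<Rightarrow> (nat \<times> nat \<Rightarrow> real) \<Rightarrow> real" where
  "resample e u g = (\<integral>x. u (g(e := x)) \<partial>\<gamma>)"

abbreviation bm1 where "bm1 u \<equiv> bdd_meas M u"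
abbreviation bm2 where "bm2 U \<equiv> bdd_meas (M \<Otimes>\<^sub>M M) (\<lambda>(g, h). U g h)"

lemma prob_M: "prob_space M"
  by (intro prob_space_PiM prob)

lemma finm: "finite_measure M" "finite_measure \<gamma>"
  using prob_M prob by (auto simp: prob_space.finite_measure)

lemma measurable_upd [measurable (raw)]:
  assumes "e \<in> I" "f \<in> measurable N M" "h \<in> measurable N \<gamma>"
  shows "(\<lambda>w. (f w)(e := h w)) \<in> measurable N M"
proof -
  have "(\<lambda>(f, y). f(e := y)) \<in> measurable (M \<Otimes>\<^sub>M \<gamma>) (PiM (insert e I) (\<lambda>_. \<gamma>))"
    by (rule measurable_add_dim)
  then have *: "(\<lambda>(f, y). f(e := y)) \<in> measurable (M \<Otimes>\<^sub>M \<gamma>) M"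
    using assms(1) by (simp add: insert_absorb)
  show ?thesis using measurable_compose[OF measurable_Pair[OF assms(2,3)] *] by simp
qed

lemma measurable_perturb [measurable (raw)]:
  assumes [measurable]: "f \<in> measurable N M" "h \<in> measurable N M"
  shows "(\<lambda>w. perturb S (f w) (h w)) \<in> measurable N M"
proof (rule measurable_PiM_single')
  show "(\<lambda>w. perturb S (f w) (h w) e) \<in> measurable N \<gamma>" if "e \<in> I" for e
    using that unfolding perturb_def by (cases "e \<in> S") (simp_all, measurable)
  show "(\<lambda>w. perturb S (f w) (h w)) \<in> space N \<rightarrow> (\<Pi>\<^sub>E i\<in>I. space \<gamma>)"
    using measurable_space[OF assms(1)] measurable_space[OF assms(2)]
    by (fastforce simp: perturb_def space_PiM PiE_iff extensional_def)
qed

lemma space_perturb: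
  "g \<in> space M \<Longrightarrow> g' \<in> space M \<Longrightarrow> perturb S g g' \<in> space M"
  by (fastforce simp: perturb_def space_PiM PiE_iff extensional_def)

lemma integral_of_resample:
  assumes e: "e \<in> I" and u: "bm1 u"
  shows "(\<integral>g. resample e u g \<partial>M) = (\<integral>g. u g \<partial>M)" and "bm1 (resample e u)"
proof -
  interpret p: product_prob_space "\<lambda>_. \<gamma>" "I" 
    by (intro product_prob_spaceI prob)
  have "bdd_meas (M \<Otimes>\<^sub>M \<gamma>) (\<lambda>(g, x). u (g(e := x)))"
    unfolding case_prod_beta' by (rule bdd_meas_compose[OF u]) (use e in measurable)
  then show b: "bm1 (resample e u)"
    unfolding resample_def by (rule bdd_meas_integral[OF prob])
  have I: "integrable M u" "integrable M (resample e u)"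
    by (rule bdd_meas_integrable[OF finm(1)], fact)+
  have ins: "insert e (I - {e}) = I" using e by auto
  have *: "(\<integral>g. v g \<partial>M) = (\<integral>g. \<integral>x. v (g(e := x)) \<partial>\<gamma> \<partial>PiM (I - {e}) (\<lambda>_. \<gamma>))"
    if "integrable M v" for v :: "_ \<Rightarrow> real"
    using p.product_integral_insert[of "I - {e}" e v] fin that unfolding ins by simp
  show "(\<integral>g. resample e u g \<partial>M) = (\<integral>g. u g \<partial>M)"
    unfolding *[OF I(1)] *[OF I(2)] by (simp add: resample_def prob_space.prob_space[OF prob])
qed

lemma integral_swap:
  fixes f :: "_ \<Rightarrow> _ \<Rightarrow> real"
  assumes "bdd_meas (M \<Otimes>\<^sub>M \<gamma>) (\<lambda>(g, x). f g x)"
  shows "(\<integral>g. \<integral>x. f g x \<partial>\<gamma> \<partial>M) = (\<integral>x. \<integral>g. f g x \<partial>M \<partial>\<gamma>)"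
proof -
  interpret m: prob_space M by (rule prob_M)
  interpret g: prob_space \<gamma> by (rule prob)
  interpret pair_prob_space \<gamma> M ..
  interpret q: pair_prob_space M \<gamma> ..
  have "integrable (M \<Otimes>\<^sub>M \<gamma>) (\<lambda>(g, x). f g x)"
    by (intro bdd_meas_integrable assms q.finite_measure)
  then show ?thesis using q.Fubini_integral[of f] by simp
qed

lemma bm2_fix: "bm2 U \<Longrightarrow> g \<in> space M \<Longrightarrow> bm1 (U g)"
  using bdd_meas_compose[of "M \<Otimes>\<^sub>M M" "\<lambda>(g, h). U g h" "\<lambda>h. (g, h)" M] by simp

lemma bm2_mix:
  assumes "bm2 U" shows "bm2 (\<lambda>g g'. U g (perturb S g g'))"
  using bdd_meas_compose[OF assms, of "\<lambda>(g, g'). (g, perturb S g g')" "M \<Otimes>\<^sub>M M"]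
  by (simp add: case_prod_beta')

lemma bm2_inner: "bm2 U \<Longrightarrow> bm1 (\<lambda>g. \<integral>g'. U g g' \<partial>M)"
  by (rule bdd_meas_integral[OF prob_M])

lemma bm2_upd_indep:
  assumes "e \<in> I" "bm2 U"
  shows "bm2 (\<lambda>g h. \<integral>x. \<integral>y. U (g(e := x)) (h(e := y)) \<partial>\<gamma> \<partial>\<gamma>)"
proof -
  have "bdd_meas (((M \<Otimes>\<^sub>M M) \<Otimes>\<^sub>M \<gamma>) \<Otimes>\<^sub>M \<gamma>)
      (\<lambda>w. (\<lambda>(g, h). U g h) ((\<lambda>w. ((fst (fst (fst w)))(e := snd (fst w)), (snd (fst (fst w)))(e := snd w))) w))"
    by (rule bdd_meas_compose[OF assms(2)]) (use assms(1) in measurable)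
  then have "bdd_meas ((M \<Otimes>\<^sub>M M) \<Otimes>\<^sub>M \<gamma>)
      (\<lambda>w. \<integral>y. U ((fst (fst w))(e := snd w)) ((snd (fst w))(e := y)) \<partial>\<gamma>)"
    by (intro bdd_meas_integral[OF prob]) (simp add: case_prod_beta')
  then have "bdd_meas (M \<Otimes>\<^sub>M M)
      (\<lambda>w. \<integral>x. \<integral>y. U ((fst w)(e := x)) ((snd w)(e := y)) \<partial>\<gamma> \<partial>\<gamma>)"
    by (intro bdd_meas_integral[OF prob]) (simp add: case_prod_beta')
  then show ?thesis by (simp add: case_prod_beta')
qed

lemma bm2_upd_same:
  assumes "e \<in> I" "bm2 U"
  shows "bm2 (\<lambda>g h. \<integral>x. U (g(e := x)) (h(e := x)) \<partial>\<gamma>)"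
proof -
  have "bdd_meas ((M \<Otimes>\<^sub>M M) \<Otimes>\<^sub>M \<gamma>)
      (\<lambda>w. (\<lambda>(g, h). U g h) ((\<lambda>w. ((fst (fst w))(e := snd w), (snd (fst w))(e := snd w))) w))"
    by (rule bdd_meas_compose[OF assms(2)]) (use assms(1) in measurable)
  then have "bdd_meas (M \<Otimes>\<^sub>M M)
      (\<lambda>w. \<integral>x. U ((fst w)(e := x)) ((snd w)(e := x)) \<partial>\<gamma>)"
    by (intro bdd_meas_integral[OF prob]) (simp add: case_prod_beta')
  then show ?thesis by (simp add: case_prod_beta')
qed

lemma integral_of_resample_fst:
  assumes e: "e \<in> I" and U: "bm2 U"
  shows "(\<integral>g. \<integral>g'. U g g' \<partial>M \<partial>M) = (\<integral>g. \<integral>g'. \<integral>x. U (g(e := x)) g' \<partial>\<gamma> \<partial>M \<partial>M)"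
proof -
  have "(\<integral>g. \<integral>g'. U g g' \<partial>M \<partial>M) = (\<integral>g. \<integral>x. \<integral>g'. U (g(e := x)) g' \<partial>M \<partial>\<gamma> \<partial>M)"
    using integral_of_resample(1)[OF e bm2_inner[OF U]] by (simp add: resample_def)
  also have "\<dots> = (\<integral>g. \<integral>g'. \<integral>x. U (g(e := x)) g' \<partial>\<gamma> \<partial>M \<partial>M)"
  proof (rule Bochner_Integration.integral_cong[OF refl])
    fix g assume g: "g \<in> space M"
    have "bdd_meas (M \<Otimes>\<^sub>M \<gamma>) (\<lambda>w. (\<lambda>(g, h). U g h) ((\<lambda>w. (g(e := snd w), fst w)) w))"
      by (rule bdd_meas_compose[OF U]) (use e g in measurable)
    then show "(\<integral>x. \<integral>g'. U (g(e := x)) g' \<partial>M \<partial>\<gamma>) = (\<integral>g'. \<integral>x. U (g(e := x)) g' \<partial>\<gamma> \<partial>M)"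
      by (intro integral_swap[symmetric]) (simp add: case_prod_beta')
  qed
  finally show ?thesis .
qed

lemma integral_of_resample_snd:
  assumes e: "e \<in> I" and U: "bm2 U"
  shows "(\<integral>g. \<integral>g'. U g g' \<partial>M \<partial>M) = (\<integral>g. \<integral>g'. \<integral>y. U g (g'(e := y)) \<partial>\<gamma> \<partial>M \<partial>M)"
  by (rule Bochner_Integration.integral_cong[OF refl])
     (use integral_of_resample(1)[OF e bm2_fix[OF U]] in \<open>simp add: resample_def\<close>)

text \<open>When \<open>e\<close> is shared, updating \<open>g\<close> at \<open>e\<close> updates
  both arrays. The integrand on the right ignores both entries at \<open>e\<close>, so
  \<open>A\<close> may stand there whether or not it contains \<open>e\<close>;
  \<open>pair_mean_remove\<close> uses the same \<open>A\<close>, which makes shared and independent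
  entries comparable under one law.\<close>

lemma pair_mean_insert:
  assumes e: "e \<in> I" and U: "bm2 U"
  shows "pair_mean (insert e A) U = pair_mean A (\<lambda>g h. \<integral>x. U (g(e := x)) (h(e := x)) \<partial>\<gamma>)"
proof -
  have "perturb (I - insert e A) (g(e := x)) g' = (perturb (I - A) g g')(e := x)" for g x g'
    by (auto simp: perturb_def)
  then show ?thesis
    using integral_of_resample_fst[OF e bm2_mix[OF U], of "I - insert e A"] by (simp add: pair_mean_def)
qed

text \<open>When \<open>e\<close> is replaced, the second array reads its entry at \<open>e\<close>
  from \<open>g'\<close>, so updates of \<open>g\<close> and \<open>g'\<close> at \<open>e\<close>
  act on the two arrays separately.\<close>

lemma pair_mean_remove:
  assumes e: "e \<in> I" and U: "bm2 U"
  shows "pair_mean (A - {e}) U = pair_mean A (\<lambda>g h. \<integral>x. \<integral>y. U (g(e := x)) (h(e := y)) \<partial>\<gamma> \<partial>\<gamma>)"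
proof -
  let ?S = "I - (A - {e})"
  have pert: "perturb ?S (g(e := x)) (g'(e := y)) = (perturb (I - A) g g')(e := y)" for g x g' y
    using e by (auto simp: perturb_def)
  let ?W = "\<lambda>g g'. \<integral>y. U g (perturb ?S g (g'(e := y))) \<partial>\<gamma>"
  have "bdd_meas ((M \<Otimes>\<^sub>M M) \<Otimes>\<^sub>M \<gamma>)
      (\<lambda>w. (\<lambda>(g, h). U g h) ((\<lambda>w. (fst (fst w), perturb ?S (fst (fst w)) ((snd (fst w))(e := snd w)))) w))"
    by (rule bdd_meas_compose[OF U]) (use e in measurable)
  then have W: "bm2 ?W"
    unfolding case_prod_beta' by (intro bdd_meas_integral[OF prob]) (simp add: case_prod_beta')
  have "pair_mean (A - {e}) U = (\<integral>g. \<integral>g'. ?W g g' \<partial>M \<partial>M)"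
    unfolding pair_mean_def by (rule integral_of_resample_snd[OF e bm2_mix[OF U]])
  also have "\<dots> = (\<integral>g. \<integral>g'. \<integral>x. ?W (g(e := x)) g' \<partial>\<gamma> \<partial>M \<partial>M)"
    by (rule integral_of_resample_fst[OF e W])
  finally show ?thesis unfolding pair_mean_def pert .
qed

text \<open>As a single integral over the product space, \<open>pair_mean\<close> inherits linearity
  and monotonicity at once.\<close>

lemma pair_mean_pair:
  assumes "bm2 U"
  shows "pair_mean A U = (\<integral>w. U (fst w) (perturb (I - A) (fst w) (snd w)) \<partial>(M \<Otimes>\<^sub>M M))"
    and "integrable (M \<Otimes>\<^sub>M M) (\<lambda>w. U (fst w) (perturb (I - A) (fst w) (snd w)))"
proof -
  interpret m: prob_space M by (rule prob_M)
  interpret pair_prob_space M M ..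
  show i: "integrable (M \<Otimes>\<^sub>M M) (\<lambda>w. U (fst w) (perturb (I - A) (fst w) (snd w)))"
    using bdd_meas_integrable[OF finite_measure bm2_mix[OF assms, of "I - A"]] by (simp add: case_prod_beta')
  show "pair_mean A U = (\<integral>w. U (fst w) (perturb (I - A) (fst w) (snd w)) \<partial>(M \<Otimes>\<^sub>M M))"
    unfolding pair_mean_def using integral_fst'[OF i] by simp
qed

lemma bm2_lin:
  "bm2 U \<Longrightarrow> bm2 W \<Longrightarrow> bm2 (\<lambda>g h. U g h + W g h)"
  "bm2 U \<Longrightarrow> bm2 W \<Longrightarrow> bm2 (\<lambda>g h. U g h - W g h)"
  "bm2 U \<Longrightarrow> bm2 W \<Longrightarrow> bm2 (\<lambda>g h. U g h * W g h)"
  "bm2 (\<lambda>g h. c)"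
  "(\<And>i. i \<in> X \<Longrightarrow> bm2 (F i)) \<Longrightarrow> bm2 (\<lambda>g h. \<Sum>i\<in>X. F i g h)"
  "bm1 u \<Longrightarrow> bm2 (\<lambda>g h. u g)"
  "bm1 u \<Longrightarrow> bm2 (\<lambda>g h. u h)"
  using bdd_meas_compose[of M u fst "M \<Otimes>\<^sub>M M"] bdd_meas_compose[of M u snd "M \<Otimes>\<^sub>M M"]
  by (auto simp: case_prod_beta' intro: bdd_meas_add bdd_meas_diff bdd_meas_mult bdd_meas_const bdd_meas_sum)

lemma pair_mean_add: "bm2 U \<Longrightarrow> bm2 W \<Longrightarrow> pair_mean A (\<lambda>g h. U g h + W g h) = pair_mean A U + pair_mean A W"
  by (simp add: pair_mean_pair bm2_lin)

lemma pair_mean_diff: "bm2 U \<Longrightarrow> bm2 W \<Longrightarrow> pair_mean A (\<lambda>g h. U g h - W g h) = pair_mean A U - pair_mean A W"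
  by (simp add: pair_mean_pair bm2_lin)

lemma pair_mean_cmult: "bm2 U \<Longrightarrow> pair_mean A (\<lambda>g h. c * U g h) = c * pair_mean A U"
  by (simp add: pair_mean_pair bm2_lin)

lemma pair_mean_sum: "(\<And>i. i \<in> X \<Longrightarrow> bm2 (F i)) \<Longrightarrow> pair_mean A (\<lambda>g h. \<Sum>i\<in>X. F i g h) = (\<Sum>i\<in>X. pair_mean A (F i))"
  by (simp add: pair_mean_pair bm2_lin)

lemma pair_mean_const: "pair_mean A (\<lambda>g h. c) = c"
proof -
  interpret m: prob_space M by (rule prob_M)
  show ?thesis by (simp add: pair_mean_def m.prob_space)
qed

lemma pair_mean_mono:
  assumes "bm2 U" "bm2 W" "\<And>g h. g \<in> space M \<Longrightarrow> h \<in> space M \<Longrightarrow> U g h \<le> W g h"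
  shows "pair_mean A U \<le> pair_mean A W"
  unfolding pair_mean_pair(1)[OF assms(1)] pair_mean_pair(1)[OF assms(2)]
proof (rule integral_mono)
  fix w assume "w \<in> space (M \<Otimes>\<^sub>M M)"
  then show "U (fst w) (perturb (I - A) (fst w) (snd w)) \<le> W (fst w) (perturb (I - A) (fst w) (snd w))"
    by (intro assms space_perturb) (auto simp: space_pair_measure)
qed (use pair_mean_pair assms in auto)

lemma pair_mean_cong:
  assumes "\<And>g h. g \<in> space M \<Longrightarrow> h \<in> space M \<Longrightarrow> U g h = W g h"
  shows "pair_mean A U = pair_mean A W"
  unfolding pair_mean_def
by (intro Bochner_Integration.integral_cong refl assms space_perturb)

section \<open>Efron-Stein decomposition with nonnegative weights\<close>

lemma resample_in_slice:
  assumes "e \<in> I" "bm1 u" "g \<in> space M"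
  shows "integrable \<gamma> (\<lambda>x. u (g(e := x)))" "bdd_meas \<gamma> (\<lambda>x. u (g(e := x)))"
proof -
  show "bdd_meas \<gamma> (\<lambda>x. u (g(e := x)))"
    by (rule bdd_meas_compose[OF assms(2)]) (use assms in measurable)
  then show "integrable \<gamma> (\<lambda>x. u (g(e := x)))" by (intro bdd_meas_integrable finm)
qed

text \<open>Given the other couplings, the fluctuation \<open>u - resample e u\<close> has mean zero
  in the entry at \<open>e\<close>. Independent entries therefore leave only the averages, while a
  shared entry adds the product of fluctuations and the cross terms vanish.\<close>

lemma pair_mean_split:
  assumes e: "e \<in> I" and u: "bm1 u"
  shows "pair_mean (A - {e}) (\<lambda>g h. u g * u h) = pair_mean A (\<lambda>g h. resample e u g * resample e u h)"
    and "e \<in> A \<Longrightarrow> pair_mean A (\<lambda>g h. u g * u h) =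
      pair_mean A (\<lambda>g h. resample e u g * resample e u h) + pair_mean A (\<lambda>g h. (u g - resample e u g) * (u h - resample e u h))"
proof -
  interpret g: prob_space \<gamma> by (rule prob)
  note au = integral_of_resample(2)[OF e u]
  have resample_upd: "resample e u (g(e := x)) = resample e u g" for g x by (simp add: resample_def)
  show *: "pair_mean (A - {e}) (\<lambda>g h. u g * u h) = pair_mean A (\<lambda>g h. resample e u g * resample e u h)"
    by (subst pair_mean_remove[OF e]) (simp_all add: bm2_lin u resample_def)
  assume A: "e \<in> A"
  have "pair_mean (insert e A) (\<lambda>g h. (u g - resample e u g) * (u h - resample e u h)) =
     pair_mean A (\<lambda>g h. \<integral>x. (u (g(e := x)) - resample e u g) * (u (h(e := x)) - resample e u h) \<partial>\<gamma>)"
    using pair_mean_insert[OF e, of "\<lambda>g h. (u g - resample e u g) * (u h - resample e u h)" A] u au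
    by (simp add: bm2_lin resample_upd)
  also have "\<dots> = pair_mean A (\<lambda>g h. (\<integral>x. u (g(e := x)) * u (h(e := x)) \<partial>\<gamma>) - resample e u g * resample e u h)"
  proof (rule pair_mean_cong)
    fix g h assume gh: "g \<in> space M" "h \<in> space M"
    note i = resample_in_slice[OF e u gh(1)] resample_in_slice[OF e u gh(2)]
    have [simp]: "integrable \<gamma> (\<lambda>x. u (g(e := x)) * u (h(e := x)))"
      using i finm by (intro bdd_meas_integrable bdd_meas_mult)
    have "(\<integral>x. (u (g(e := x)) - resample e u g) * (u (h(e := x)) - resample e u h) \<partial>\<gamma>) =
      (\<integral>x. u (g(e := x)) * u (h(e := x)) - resample e u h * u (g(e := x)) - resample e u g * u (h(e := x))
        + resample e u g * resample e u h \<partial>\<gamma>)"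
      by (simp add: algebra_simps)
    also have "\<dots> = (\<integral>x. u (g(e := x)) * u (h(e := x)) \<partial>\<gamma>) - resample e u g * resample e u h"
      using i by (simp add: g.prob_space resample_def)
    finally show "(\<integral>x. (u (g(e := x)) - resample e u g) * (u (h(e := x)) - resample e u h) \<partial>\<gamma>) = \<dots>" .
  qed
  also have "\<dots> = pair_mean (insert e A) (\<lambda>g h. u g * u h) - pair_mean A (\<lambda>g h. resample e u g * resample e u h)"
    using pair_mean_insert[OF e, of "\<lambda>g h. u g * u h" A] bm2_upd_same[OF e, of "\<lambda>g h. u g * u h"] u au
    by (simp add: pair_mean_diff bm2_lin)
  finally show "pair_mean A (\<lambda>g h. u g * u h) =
      pair_mean A (\<lambda>g h. resample e u g * resample e u h) + pair_mean A (\<lambda>g h. (u g - resample e u g) * (u h - resample e u h))"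
    using A by (simp add: insert_absorb)
qed

text \<open>Only existence of the weights is needed, so the induction splits off one coordinate \<open>e\<close> at a time
  through \<open>u = resample e u + (u - resample e u)\<close> and no Moebius inversion occurs.\<close>

lemma anova_aux:
  assumes "finite F" "F \<subseteq> I" "bm1 u"
  shows "\<exists>w. (\<forall>B. 0 \<le> w B) \<and> (\<forall>A\<subseteq>F. pair_mean (A \<union> (I - F)) (\<lambda>g h. u g * u h) = (\<Sum>B\<in>Pow A. w B))"
  using assms
proof (induction F arbitrary: u rule: finite_induct)
  case empty
  \<comment> \<open>With \<open>F\<close> empty all entries are shared and the two arrays coincide,
    so the single weight is the mean of a square.\<close>
  have [simp]: "perturb {} g g' = g" for g g' by (simp add: perturb_def)
  interpret m: prob_space M by (rule prob_M)
  have "pair_mean I (\<lambda>g h. u g * u h) \<ge> 0" unfolding pair_mean_def by (simp add: m.prob_space)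
  then show ?case by (intro exI[of _ "\<lambda>_. pair_mean I (\<lambda>g h. u g * u h)"]) simp
next
  case (insert e F)
  then have e: "e \<in> I" by simp
  note au = integral_of_resample(2)[OF e insert.prems(2)]
  obtain w0 where w0: "\<And>B. 0 \<le> w0 B"
    "\<And>A. A \<subseteq> F \<Longrightarrow> pair_mean (A \<union> (I - F)) (\<lambda>g h. resample e u g * resample e u h) = (\<Sum>B\<in>Pow A. w0 B)"
    using insert.IH[OF _ au] insert.prems by auto
  obtain w1 where w1: "\<And>B. 0 \<le> w1 B"
    "\<And>A. A \<subseteq> F \<Longrightarrow> pair_mean (A \<union> (I - F)) (\<lambda>g h. (u g - resample e u g) * (u h - resample e u h)) = (\<Sum>B\<in>Pow A. w1 B)"
    using insert.IH[OF _ bdd_meas_diff[OF insert.prems(2) au]] insert.prems by auto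
  \<comment> \<open>Sets containing \<open>e\<close> carry the weights of the fluctuation part, the
    others those of the average; by \<open>pair_mean_split\<close> the former are added exactly when
    \<open>e\<close> is shared.\<close>
  define w where "w B = (if e \<in> B then w1 (B - {e}) else w0 B)" for B
  show ?case
  proof (intro exI[of _ w] conjI allI impI)
    show "0 \<le> w B" for B using w0 w1 by (simp add: w_def)
    fix A assume A: "A \<subseteq> insert e F"
    define A' where "A' = A - {e}"
    have A': "A' \<subseteq> F" "e \<notin> A'" using A by (auto simp: A'_def)
    have fA: "finite A'" using A' insert.hyps finite_subset by auto
    have s0: "(\<Sum>B\<in>Pow A'. w B) = (\<Sum>B\<in>Pow A'. w0 B)"
      using A' by (intro sum.cong) (auto simp: w_def)
    show "pair_mean (A \<union> (I - insert e F)) (\<lambda>g h. u g * u h) = (\<Sum>B\<in>Pow A. w B)"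
    proof (cases "e \<in> A")
      case False
      then have "A = A'" by (simp add: A'_def)
      moreover have "A' \<union> (I - insert e F) = A' \<union> (I - F) - {e}" using A' by auto
      ultimately show ?thesis
        using s0 w0(2)[OF A'(1)] pair_mean_split(1)[OF e insert.prems(2)] by simp
    next
      case True
      then have AA: "A = insert e A'" by (auto simp: A'_def)
      have "A \<union> (I - insert e F) = A' \<union> (I - F)" using AA A' e insert.hyps by auto
      moreover have "e \<in> A' \<union> (I - F)" using e insert.hyps by auto
      ultimately have "pair_mean (A \<union> (I - insert e F)) (\<lambda>g h. u g * u h) = (\<Sum>B\<in>Pow A'. w0 B) + (\<Sum>B\<in>Pow A'. w1 B)"
        using pair_mean_split(2)[OF e insert.prems(2)] w0(2)[OF A'(1)] w1(2)[OF A'(1)] by simp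
      also have "(\<Sum>B\<in>Pow A'. w1 B) = (\<Sum>B\<in>Pow A'. w (insert e B))"
      proof (rule sum.cong[OF refl])
        fix B assume "B \<in> Pow A'"
        then have "e \<notin> B" using A' by auto
        then show "w1 B = w (insert e B)" by (simp add: w_def)
      qed
      also have "(\<Sum>B\<in>Pow A'. w0 B) + \<dots> = (\<Sum>B\<in>Pow A. w B)"
        unfolding AA sum_Pow_insert[OF fA A'(2)] s0 ..
      finally show ?thesis .
    qed
  qed
qed

lemma anova:
  assumes "bm1 u"
  obtains w where "\<And>B. 0 \<le> w B" "\<And>A. A \<subseteq> I \<Longrightarrow> pair_mean A (\<lambda>g h. u g * u h) = (\<Sum>B\<in>Pow A. w B)"
  using anova_aux[OF fin subset_refl assms] by auto

end

subsection \<open>One-coupling tilts of a Gibbs measure\<close>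

text \<open>For a sign \<open>\<epsilon>\<close> of mean \<open>m\<close>, reweighting by \<open>exp (t \<epsilon>)\<close> has normalizing constant \<open>tilt_den m t\<close> and
  density \<open>1 + (\<epsilon> - m) * tilt m t\<close>; moreover \<open>1 / (tilt_den m t)\<^sup>2\<close> is the derivative of \<open>tilt m\<close>.\<close>

definition tilt_den :: "real \<Rightarrow> real \<Rightarrow> real" where
  "tilt_den m t = cosh t + m * sinh t"

definition tilt :: "real \<Rightarrow> real \<Rightarrow> real" where
  "tilt m t = sinh t / tilt_den m t"

lemma tilt_den_bounds:
  assumes "\<bar>m\<bar> \<le> 1"
  shows "exp (- \<bar>t\<bar>) \<le> tilt_den m t" "tilt_den m t \<le> exp \<bar>t\<bar>"
proof -
  have "\<bar>m * sinh t\<bar> \<le> 1 * sinh \<bar>t\<bar>"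
    unfolding abs_mult using assms by (intro mult_mono) (auto simp: abs_if)
  then have "m * sinh t \<le> sinh \<bar>t\<bar>" "- sinh \<bar>t\<bar> \<le> m * sinh t" by auto
  moreover have "cosh t = cosh \<bar>t\<bar>" by simp
  moreover have "cosh \<bar>t\<bar> + sinh \<bar>t\<bar> = exp \<bar>t\<bar>" "cosh \<bar>t\<bar> - sinh \<bar>t\<bar> = exp (- \<bar>t\<bar>)"
    by (simp_all add: cosh_plus_sinh cosh_minus_sinh del: cosh_real_abs sinh_real_abs)
  ultimately show "exp (- \<bar>t\<bar>) \<le> tilt_den m t" "tilt_den m t \<le> exp \<bar>t\<bar>"
    unfolding tilt_den_def by linarith+
qed

lemma tilt_den_pos: "\<bar>m\<bar> \<le> 1 \<Longrightarrow> 0 < tilt_den m t"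
  using tilt_den_bounds(1)[of m t] exp_gt_zero[of "- \<bar>t\<bar>"] by linarith

text \<open>The left side is half of
  \<open>exp (2 * \<bar>t\<bar>) * (1 - exp (- (2 * \<bar>t\<bar>)))\<close>, and the bracket is at
  most \<open>2 * \<bar>t\<bar>\<close>.\<close>

lemma sinh_abs_exp_bound: "\<bar>sinh t\<bar> * exp \<bar>t\<bar> \<le> \<bar>t\<bar> * exp (2 * \<bar>t\<bar>)" for t :: real
proof -
  have "1 - exp (- (2 * \<bar>t\<bar>)) \<le> 2 * \<bar>t\<bar>"
    using exp_ge_add_one_self[of "- (2 * \<bar>t\<bar>)"] by linarith
  then have "exp (2 * \<bar>t\<bar>) * (1 - exp (- (2 * \<bar>t\<bar>))) \<le> exp (2 * \<bar>t\<bar>) * (2 * \<bar>t\<bar>)"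
    by (intro mult_left_mono) auto
  also have "exp (2 * \<bar>t\<bar>) * (1 - exp (- (2 * \<bar>t\<bar>))) = 2 * (sinh \<bar>t\<bar> * exp \<bar>t\<bar>)"
    by (simp add: sinh_field_def algebra_simps flip: exp_add del: sinh_real_abs)
  also have "exp (2 * \<bar>t\<bar>) * (2 * \<bar>t\<bar>) = 2 * (\<bar>t\<bar> * exp (2 * \<bar>t\<bar>))"
    by (rule mult.left_commute[THEN trans]) (simp only: mult.commute[of "exp (2 * \<bar>t\<bar>)"])
  finally have "sinh \<bar>t\<bar> * exp \<bar>t\<bar> \<le> \<bar>t\<bar> * exp (2 * \<bar>t\<bar>)"
    unfolding mult_le_cancel_left_pos[OF zero_less_numeral] .
  then show ?thesis by (simp only: sinh_real_abs)
qed

lemma tilt_bound: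
  assumes "\<bar>m\<bar> \<le> 1"
  shows "\<bar>tilt m t\<bar> \<le> \<bar>t\<bar> * exp (2 * \<bar>t\<bar>)"
proof -
  have "\<bar>tilt m t\<bar> = \<bar>sinh t\<bar> / tilt_den m t"
    using tilt_den_pos[OF assms, of t] by (simp add: tilt_def)
  also have "\<dots> \<le> \<bar>sinh t\<bar> / exp (- \<bar>t\<bar>)"
    using tilt_den_bounds[OF assms, of t] by (intro divide_left_mono) (simp_all add: tilt_den_pos[OF assms])
  also have "\<dots> = \<bar>sinh t\<bar> * exp \<bar>t\<bar>" by (simp add: exp_minus field_simps)
  finally show ?thesis using sinh_abs_exp_bound[of t] by linarith
qed

lemma sinh_le_mult_cosh:
  fixes u :: real
  assumes "0 \<le> u" shows "sinh u \<le> u * cosh u"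
proof -
  have "(\<lambda>x. x * cosh x - sinh x) 0 \<le> (\<lambda>x. x * cosh x - sinh x) u"
  proof (rule DERIV_nonneg_imp_nondecreasing[OF assms])
    fix x :: real assume "0 \<le> x" "x \<le> u"
    moreover have "((\<lambda>x. x * cosh x - sinh x) has_real_derivative x * sinh x) (at x)"
      by (auto intro!: derivative_eq_intros simp: algebra_simps)
    ultimately show "\<exists>y. ((\<lambda>x. x * cosh x - sinh x) has_real_derivative y) (at x) \<and> 0 \<le> y"
      by (intro exI[of _ "x * sinh x"]) simp
  qed
  then show ?thesis by simp
qed

text \<open>The numerator of \<open>tilt m t - t\<close> is
  \<open>(sinh t - t * cosh t) - t * m * sinh t\<close>, and each of its two parts is at most
  \<open>\<bar>t\<bar> * \<bar>sinh t\<bar>\<close>. Uniformity in \<open>m\<close> is what later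
  makes the covariance of two tilts independent of the magnetizations to leading order.\<close>

lemma tilt_linear:
  assumes m: "\<bar>m\<bar> \<le> 1"
  shows "\<bar>tilt m t - t\<bar> \<le> 2 * t\<^sup>2 * exp (2 * \<bar>t\<bar>)"
proof -
  have *: "\<bar>sinh t - t * cosh t\<bar> \<le> \<bar>t\<bar> * \<bar>sinh t\<bar>"
  proof -
    have nonneg: "\<bar>sinh u - u * cosh u\<bar> \<le> u * sinh u" if "0 \<le> u" for u :: real
    proof -
      have le: "cosh u - 1 \<le> sinh u"
        using cosh_minus_sinh[of u] that by (simp add: algebra_simps)
      have sl: "u \<le> sinh u"
        using real_le_x_sinh[OF that] by (simp add: sinh_field_def exp_minus)
      have "u * cosh u - sinh u \<le> u * cosh u - u" using sl by simp
      also have "\<dots> = u * (cosh u - 1)" by (simp add: algebra_simps)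
      also have "\<dots> \<le> u * sinh u" using le that by (intro mult_left_mono)
      finally have 1: "u * cosh u - sinh u \<le> u * sinh u" .
      have "sinh u \<le> u * cosh u" by (rule sinh_le_mult_cosh[OF that])
      then show ?thesis using 1 by simp
    qed
    show ?thesis
    proof (cases "0 \<le> t")
      case True then show ?thesis using nonneg[of t] by simp
    next
      case False then show ?thesis using nonneg[of "- t"] by (simp add: abs_minus_commute)
    qed
  qed
  have D: "0 < tilt_den m t" using tilt_den_pos[OF m] .
  have "\<bar>tilt m t - t\<bar> = \<bar>(sinh t - t * cosh t) - t * m * sinh t\<bar> / tilt_den m t"
    using D unfolding tilt_def tilt_den_def by (simp add: field_simps)
  also have "\<dots> \<le> \<bar>(sinh t - t * cosh t) - t * m * sinh t\<bar> / exp (- \<bar>t\<bar>)"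
    using tilt_den_bounds[OF m, of t] D by (intro divide_left_mono) auto
  also have "\<dots> = \<bar>(sinh t - t * cosh t) - t * m * sinh t\<bar> * exp \<bar>t\<bar>"
    by (simp add: exp_minus field_simps)
  also have "\<dots> \<le> (2 * \<bar>t\<bar> * \<bar>sinh t\<bar>) * exp \<bar>t\<bar>"
  proof (intro mult_right_mono)
    have "\<bar>t * m * sinh t\<bar> \<le> \<bar>t\<bar> * \<bar>sinh t\<bar>"
      using m by (simp add: abs_mult mult_right_le_one_le mult_left_le_one_le mult.assoc mult_left_mono)
    then show "\<bar>(sinh t - t * cosh t) - t * m * sinh t\<bar> \<le> 2 * \<bar>t\<bar> * \<bar>sinh t\<bar>"
      using * by linarith
  qed simp
  also have "\<dots> = 2 * \<bar>t\<bar> * (\<bar>sinh t\<bar> * exp \<bar>t\<bar>)" by simp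
  also have "\<dots> \<le> 2 * \<bar>t\<bar> * (\<bar>t\<bar> * exp (2 * \<bar>t\<bar>))"
    using sinh_abs_exp_bound[of t] by (intro mult_left_mono) auto
  also have "\<dots> = 2 * t\<^sup>2 * exp (2 * \<bar>t\<bar>)" by (simp add: power2_eq_square)
  finally show ?thesis .
qed

text \<open>The reciprocal square lies between \<open>exp (- (2 * \<bar>t\<bar>))\<close> and
  \<open>exp (2 * \<bar>t\<bar>)\<close>. It is the factor by which centred Gibbs weights change
  with one coupling, see \<open>mu_centred_upd\<close>.\<close>

lemma tilt_den_sq_bound:
  assumes m: "\<bar>m\<bar> \<le> 1"
  shows "\<bar>1 / (tilt_den m t)\<^sup>2 - 1\<bar> \<le> 2 * \<bar>t\<bar> * exp (2 * \<bar>t\<bar>)"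
proof -
  have D: "0 < tilt_den m t" using tilt_den_pos[OF m] .
  have "(exp (- \<bar>t\<bar>))\<^sup>2 \<le> (tilt_den m t)\<^sup>2" "(tilt_den m t)\<^sup>2 \<le> (exp \<bar>t\<bar>)\<^sup>2"
    using tilt_den_bounds[OF m, of t] D by (intro power_mono; simp)+
  then have "exp (- (2 * \<bar>t\<bar>)) \<le> (tilt_den m t)\<^sup>2" "(tilt_den m t)\<^sup>2 \<le> exp (2 * \<bar>t\<bar>)"
    by (simp_all add: power2_eq_square flip: exp_add)
  then have "1 / exp (2 * \<bar>t\<bar>) \<le> 1 / (tilt_den m t)\<^sup>2" "1 / (tilt_den m t)\<^sup>2 \<le> 1 / exp (- (2 * \<bar>t\<bar>))"
    using D by (intro divide_left_mono; simp)+
  then have b: "exp (- (2 * \<bar>t\<bar>)) \<le> 1 / (tilt_den m t)\<^sup>2" "1 / (tilt_den m t)\<^sup>2 \<le> exp (2 * \<bar>t\<bar>)"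
    by (simp_all add: exp_minus field_simps)
  have 1: "1 - 2 * \<bar>t\<bar> \<le> exp (- (2 * \<bar>t\<bar>))"
    using exp_ge_add_one_self[of "- (2 * \<bar>t\<bar>)"] by linarith
  have "exp (2 * \<bar>t\<bar>) * (1 - 2 * \<bar>t\<bar>) \<le> exp (2 * \<bar>t\<bar>) * exp (- (2 * \<bar>t\<bar>))"
    using 1 by (intro mult_left_mono) auto
  then have 2: "exp (2 * \<bar>t\<bar>) - 1 \<le> 2 * \<bar>t\<bar> * exp (2 * \<bar>t\<bar>)"
    by (simp add: algebra_simps flip: exp_add)
  have "2 * \<bar>t\<bar> * 1 \<le> 2 * \<bar>t\<bar> * exp (2 * \<bar>t\<bar>)" by (intro mult_left_mono) auto
  then have "2 * \<bar>t\<bar> \<le> 2 * \<bar>t\<bar> * exp (2 * \<bar>t\<bar>)" by simp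
  then show ?thesis using b 1 2 unfolding abs_le_iff by linarith
qed

text \<open>The coupling \<open>g e\<close> acts on a configuration only through the sign \<open>s e \<sigma>\<close>; for the S-K model
  \<open>s (i, j) \<sigma> = \<sigma>\<^sub>i \<sigma>\<^sub>j\<close> and \<open>a = \<beta> / sqrt (2 N)\<close>, so that \<open>q\<close> is \<open>N\<^sup>2 R\<^sup>2\<close>.\<close>

locale ising =
  fixes I :: "(nat \<times> nat) set" and \<Omega> :: "'c set" and s :: "nat \<times> nat \<Rightarrow> 'c \<Rightarrow> real" and a :: real
  assumes finI: "finite I" and fin\<Omega>: "finite \<Omega>" and ne\<Omega>: "\<Omega> \<noteq> {}"
    and s_cases: "\<And>e \<sigma>. e \<in> I \<Longrightarrow> \<sigma> \<in> \<Omega> \<Longrightarrow> s e \<sigma> = 1 \<or> s e \<sigma> = -1"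
begin

definition wt :: "(nat \<times> nat \<Rightarrow> real) \<Rightarrow> 'c \<Rightarrow> real" where
  "wt g \<sigma> = exp (a * (\<Sum>e\<in>I. g e * s e \<sigma>))"

definition mu :: "(nat \<times> nat \<Rightarrow> real) \<Rightarrow> 'c \<Rightarrow> real" where
  "mu g \<sigma> = wt g \<sigma> / (\<Sum>\<tau>\<in>\<Omega>. wt g \<tau>)"

definition mag :: "nat \<times> nat \<Rightarrow> (nat \<times> nat \<Rightarrow> real) \<Rightarrow> real" where
  "mag e g = (\<Sum>\<sigma>\<in>\<Omega>. mu g \<sigma> * s e \<sigma>)"

definition q :: "'c \<Rightarrow> 'c \<Rightarrow> real" where
  "q \<sigma> \<tau> = (\<Sum>e\<in>I. s e \<sigma> * s e \<tau>)"

lemma Z_pos: "0 < (\<Sum>\<tau>\<in>\<Omega>. wt g \<tau>)"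
  using fin\<Omega> ne\<Omega> by (intro sum_pos) (auto simp: wt_def)

lemma mu_nonneg: "0 \<le> mu g \<sigma>"
  unfolding mu_def by (intro divide_nonneg_pos Z_pos) (simp add: wt_def)

lemma sum_mu: "(\<Sum>\<sigma>\<in>\<Omega>. mu g \<sigma>) = 1"
  unfolding mu_def sum_divide_distrib[symmetric] using Z_pos[of g] by (intro divide_self) linarith

lemma mu_le_1: "\<sigma> \<in> \<Omega> \<Longrightarrow> mu g \<sigma> \<le> 1"
  unfolding sum_mu[of g, symmetric] by (rule member_le_sum) (auto simp: mu_nonneg fin\<Omega>)

lemma abs_mag_le: "e \<in> I \<Longrightarrow> \<bar>mag e g\<bar> \<le> 1"
proof -
  assume e: "e \<in> I"
  have "\<bar>mag e g\<bar> \<le> (\<Sum>\<sigma>\<in>\<Omega>. \<bar>mu g \<sigma> * s e \<sigma>\<bar>)" unfolding mag_def by (rule sum_abs)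
  also have "\<dots> = (\<Sum>\<sigma>\<in>\<Omega>. mu g \<sigma>)"
    using s_cases[OF e] mu_nonneg by (intro sum.cong refl) (fastforce simp: abs_mult)
  finally show ?thesis by (simp add: sum_mu)
qed

text \<open>For a sign \<open>S\<close> one has \<open>exp (t * S) = cosh t + S * sinh t\<close>, so
  the weight is affine in the sign. The value 0 at \<open>e\<close> is the common reference point
  for all updates.\<close>

lemma wt_upd:
  assumes "e \<in> I" "\<sigma> \<in> \<Omega>"
  shows "wt (g(e := x)) \<sigma> = wt (g(e := 0)) \<sigma> * (cosh (a * x) + s e \<sigma> * sinh (a * x))"
proof -
  have "(\<Sum>i\<in>I. (g(e := y)) i * s i \<sigma>) = y * s e \<sigma> + (\<Sum>i\<in>I - {e}. g i * s i \<sigma>)" for y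
    using assms finI by (subst sum.remove[of I e]) (auto intro!: sum.cong)
  then have "wt (g(e := x)) \<sigma> = wt (g(e := 0)) \<sigma> * exp (a * x * s e \<sigma>)"
    by (simp add: wt_def algebra_simps flip: exp_add)
  also have "exp (a * x * s e \<sigma>) = cosh (a * x) + s e \<sigma> * sinh (a * x)"
    using s_cases[OF assms] cosh_plus_sinh[of "a * x"] cosh_minus_sinh[of "a * x"] by auto
  finally show ?thesis .
qed

lemma mu_upd_quot:
  assumes "e \<in> I" "\<sigma> \<in> \<Omega>"
  shows "mu (g(e := x)) \<sigma> = mu (g(e := 0)) \<sigma> * (cosh (a * x) + s e \<sigma> * sinh (a * x)) /
    tilt_den (mag e (g(e := 0))) (a * x)"
proof -
  let ?Z = "\<Sum>\<tau>\<in>\<Omega>. wt (g(e := 0)) \<tau>"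
  have "(\<Sum>\<tau>\<in>\<Omega>. wt (g(e := x)) \<tau>) = (\<Sum>\<tau>\<in>\<Omega>. wt (g(e := 0)) \<tau> * cosh (a * x) + wt (g(e := 0)) \<tau> * s e \<tau> * sinh (a * x))"
    by (intro sum.cong refl) (simp only: wt_upd[OF assms(1), of _ g x] distrib_left mult.assoc)
  also have "\<dots> = ?Z * cosh (a * x) + (\<Sum>\<tau>\<in>\<Omega>. wt (g(e := 0)) \<tau> * s e \<tau>) * sinh (a * x)"
    by (simp add: sum.distrib sum_distrib_right)
  also have "(\<Sum>\<tau>\<in>\<Omega>. wt (g(e := 0)) \<tau> * s e \<tau>) = ?Z * mag e (g(e := 0))"
    using Z_pos[of "g(e := 0)"] by (simp add: mag_def mu_def sum_distrib_left)
  finally have "(\<Sum>\<tau>\<in>\<Omega>. wt (g(e := x)) \<tau>) = ?Z * tilt_den (mag e (g(e := 0))) (a * x)"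
    by (simp only: tilt_den_def distrib_left mult.assoc)
  then show ?thesis by (simp add: mu_def wt_upd[OF assms, where g=g and x=x])
qed

text \<open>Here \<open>x\<close> enters through a scalar alone, multiplied by a centred sign. A
  product over two replicas then has four terms, and only the one with both tilts can tell a shared
  entry from independent ones.\<close>

lemma mu_upd:
  assumes "e \<in> I" "\<sigma> \<in> \<Omega>"
  shows "mu (g(e := x)) \<sigma> = mu (g(e := 0)) \<sigma> *
    (1 + (s e \<sigma> - mag e (g(e := 0))) * tilt (mag e (g(e := 0))) (a * x))"
proof -
  let ?m = "mag e (g(e := 0))" and ?t = "a * x"
  have "tilt_den ?m ?t \<noteq> 0" using tilt_den_pos[OF abs_mag_le[OF assms(1)], of "g(e := 0)" ?t] by simp
  then have "1 + (s e \<sigma> - ?m) * tilt ?m ?t = (tilt_den ?m ?t + (s e \<sigma> - ?m) * sinh ?t) / tilt_den ?m ?t"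
    by (simp add: tilt_def add_divide_distrib)
  also have "tilt_den ?m ?t + (s e \<sigma> - ?m) * sinh ?t = cosh ?t + s e \<sigma> * sinh ?t"
    by (simp add: tilt_den_def algebra_simps)
  finally show ?thesis unfolding mu_upd_quot[OF assms, of g x] by (simp only: times_divide_eq_right)
qed

text \<open>In the quotient form \<open>mu_upd_quot\<close>, numerator and denominator both lie
  between \<open>exp (- \<bar>a * x\<bar>)\<close> and \<open>exp \<bar>a * x\<bar>\<close>.\<close>

lemma mu_upd_lower:
  assumes "e \<in> I" "\<sigma> \<in> \<Omega>"
  shows "mu (g(e := 0)) \<sigma> * exp (- (2 * \<bar>a * x\<bar>)) \<le> mu (g(e := x)) \<sigma>"
proof -
  let ?m = "mag e (g(e := 0))" and ?t = "a * x"
  note m = abs_mag_le[OF assms(1), of "g(e := 0)"]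
  have "exp (- \<bar>?t\<bar>) / exp \<bar>?t\<bar> \<le> (cosh ?t + s e \<sigma> * sinh ?t) / tilt_den ?m ?t"
    using tilt_den_bounds[OF m, of ?t] tilt_den_pos[OF m, of ?t]
      tilt_den_bounds(1)[of "s e \<sigma>" ?t] tilt_den_pos[of "s e \<sigma>" ?t] s_cases[OF assms]
    by (intro frac_le) (auto simp: tilt_den_def)
  moreover have "exp (- \<bar>?t\<bar>) / exp \<bar>?t\<bar> = exp (- (2 * \<bar>?t\<bar>))"
    by (simp flip: exp_diff)
  ultimately have "mu (g(e := 0)) \<sigma> * exp (- (2 * \<bar>?t\<bar>)) \<le>
      mu (g(e := 0)) \<sigma> * ((cosh ?t + s e \<sigma> * sinh ?t) / tilt_den ?m ?t)"
    by (intro mult_left_mono mu_nonneg) simp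
  then show ?thesis unfolding mu_upd_quot[OF assms, of g x] by simp
qed

lemma mag_upd:
  assumes e: "e \<in> I"
  shows "mag e (g(e := x)) = (mag e (g(e := 0)) * cosh (a * x) + sinh (a * x)) / tilt_den (mag e (g(e := 0))) (a * x)"
proof -
  let ?m = "mag e (g(e := 0))" and ?t = "a * x"
  have aux: "u * (c + S * d) / r * S = (u * S * c + u * d) / r" if "S * S = 1" for u c d r S :: real
  proof -
    have "u * (c + S * d) * S = u * S * c + u * (S * S) * d" by (simp add: algebra_simps)
    then show ?thesis by (simp add: that)
  qed
  have "mu (g(e := x)) \<sigma> * s e \<sigma> = (mu (g(e := 0)) \<sigma> * s e \<sigma> * cosh ?t + mu (g(e := 0)) \<sigma> * sinh ?t) / tilt_den ?m ?t"
    if "\<sigma> \<in> \<Omega>" for \<sigma>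
    unfolding mu_upd_quot[OF e that, of g x] by (rule aux) (use s_cases[OF e that] in auto)
  then have "mag e (g(e := x)) = (\<Sum>\<sigma>\<in>\<Omega>. (mu (g(e := 0)) \<sigma> * s e \<sigma> * cosh ?t + mu (g(e := 0)) \<sigma> * sinh ?t) / tilt_den ?m ?t)"
    unfolding mag_def[of e "g(e := x)"] by (intro sum.cong refl)
  also have "\<dots> = (?m * cosh ?t + sinh ?t) / tilt_den ?m ?t"
    by (simp add: mag_def[of e "g(e := 0)"] sum.distrib sum_mu flip: sum_divide_distrib sum_distrib_right)
  finally show ?thesis .
qed

text \<open>This is \<open>mu_upd\<close> differentiated in \<open>a * x\<close>: the Gibbs weight
  has derivative weight times centred sign, and \<open>tilt\<close> has derivative
  \<open>1 / (tilt_den m t)\<^sup>2\<close>. The proof verifies it algebraically from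
  \<open>S * S = 1\<close> and the hyperbolic Pythagorean identity.\<close>

lemma mu_centred_upd:
  assumes "e \<in> I" "\<sigma> \<in> \<Omega>"
  shows "mu (g(e := x)) \<sigma> * (s e \<sigma> - mag e (g(e := x))) =
    mu (g(e := 0)) \<sigma> * (s e \<sigma> - mag e (g(e := 0))) * (1 / (tilt_den (mag e (g(e := 0))) (a * x))\<^sup>2)"
proof -
  let ?m = "mag e (g(e := 0))" and ?t = "a * x"
  define c where "c = cosh ?t"
  define d where "d = sinh ?t"
  define S where "S = s e \<sigma>"
  have cd: "c * c = 1 + d * d" using hyperbolic_pythagoras[of ?t] by (simp add: c_def d_def power2_eq_square)
  have SS: "S * S = 1" using s_cases[OF assms] by (auto simp: S_def)
  have D: "0 < tilt_den ?m ?t" using tilt_den_pos[OF abs_mag_le[OF assms(1)]] .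
  have "(c + S * d) * (S * (c + m * d) - (m * c + d)) = (S - m) * (c * c - d * d) + (S * S - 1) * (c * d + m * (d * d))" for m
    by (simp add: algebra_simps)
  then have "(c + S * d) * (S * (c + ?m * d) - (?m * c + d)) = S - ?m"
    by (simp add: cd SS)
  then have *: "(c + S * d) * (S * tilt_den ?m ?t - (?m * c + d)) = S - ?m"
    by (simp add: tilt_den_def c_def d_def)
  have aux: "u * y / r * (S - z / r) = u * (y * (S * r - z)) / r\<^sup>2" if "0 < r" for u y r z :: real
    using that by (simp add: divide_simps power2_eq_square)
  have "mu (g(e := x)) \<sigma> * (s e \<sigma> - mag e (g(e := x))) =
     mu (g(e := 0)) \<sigma> * ((c + S * d) * (S * tilt_den ?m ?t - (?m * c + d))) / (tilt_den ?m ?t)\<^sup>2"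
    unfolding mu_upd_quot[OF assms, of g x] mag_upd[OF assms(1), of g x] c_def[symmetric] d_def[symmetric] S_def[symmetric]
    using D by (rule aux)
  then show ?thesis unfolding * unfolding S_def by (simp only: times_divide_eq_right mult_1_right)
qed

end

subsection \<open>The effect of sharing one more coupling\<close>

text \<open>The one-coupling estimates rest on the mean, the variance and an exponential moment of
  \<open>\<gamma>\<close>. The bound 1/8 on \<open>a\<close> makes \<open>1 - 4 * a\<close> at least
  1/2, which \<open>key_step\<close> uses to compare \<open>gibbs_mean\<close> at entry 0 with its
  average.\<close>

locale ising_resampling = resampling I \<gamma> + ising I \<Omega> s a
  for I :: "(nat \<times> nat) set" and \<gamma> :: "real measure" and \<Omega> :: "'c set"
    and s :: "nat \<times> nat \<Rightarrow> 'c \<Rightarrow> real" and a :: real +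
  assumes a_nonneg: "0 \<le> a" and a_small: "a \<le> 1 / 8"
    and mean_0: "(\<integral>x. x \<partial>\<gamma>) = 0" and var_1: "(\<integral>x. x\<^sup>2 \<partial>\<gamma>) = 1"
    and exp_moment: "integrable \<gamma> (\<lambda>x. exp (8 * \<bar>x\<bar>))"
begin

section \<open>One-dimensional expectations of tilts\<close>

definition exp_const :: real where "exp_const = (\<integral>x. exp (8 * \<bar>x\<bar>) \<partial>\<gamma>)"

lemma borel_\<gamma>: "f \<in> borel_measurable borel \<Longrightarrow> f \<in> borel_measurable \<gamma>"
  by (simp add: measurable_cong_sets[OF sets_\<gamma> refl])

lemma exp_const_ge_1: "1 \<le> exp_const"
proof -
  interpret g: prob_space \<gamma> by (rule prob)
  have "(\<integral>x. 1 \<partial>\<gamma>) \<le> exp_const" unfolding exp_const_def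
    by (intro integral_mono exp_moment) auto
  then show ?thesis by (simp add: g.prob_space)
qed

lemma abs_le_exp: "\<bar>x\<bar> \<le> exp \<bar>x\<bar>" for x :: real
  using exp_ge_add_one_self[of "\<bar>x\<bar>"] by linarith

text \<open>All one-dimensional integrands are compared with this one dominating function, so the
  single number \<open>exp_const\<close> controls every error.\<close>

lemma dominated:
  assumes "f \<in> borel_measurable borel" "\<And>x. \<bar>f x\<bar> \<le> c * exp (8 * \<bar>x\<bar>)"
  shows "integrable \<gamma> f" "\<bar>\<integral>x. f x \<partial>\<gamma>\<bar> \<le> c * exp_const"
proof -
  have c: "0 \<le> c * exp (8 * \<bar>x\<bar>)" for x
    using assms(2)[of x] by (meson abs_ge_zero order_trans)
  show i: "integrable \<gamma> f"
    using assms(2) by (intro Bochner_Integration.integrable_bound[OF integrable_mult_right[OF exp_moment, of c]] borel_\<gamma> assms(1))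
      (auto simp: abs_of_nonneg[OF c])
  have "\<bar>\<integral>x. f x \<partial>\<gamma>\<bar> \<le> (\<integral>x. \<bar>f x\<bar> \<partial>\<gamma>)" by (rule integral_abs_bound)
  also have "\<dots> \<le> (\<integral>x. c * exp (8 * \<bar>x\<bar>) \<partial>\<gamma>)"
    using assms(2) i by (intro integral_mono integrable_mult_right exp_moment) auto
  finally show "\<bar>\<integral>x. f x \<partial>\<gamma>\<bar> \<le> c * exp_const" by (simp add: exp_const_def)
qed

abbreviation H where "H m x \<equiv> tilt m (a * x)"
abbreviation X where "X m x \<equiv> 1 / (tilt_den m (a * x))\<^sup>2"

lemma meas_HX [measurable]: "H m \<in> borel_measurable borel" "X m \<in> borel_measurable borel"
  unfolding tilt_def tilt_den_def sinh_field_def cosh_field_def by measurable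

lemma exp_2ax: "exp (2 * \<bar>a * x\<bar>) \<le> exp \<bar>x\<bar>"
proof -
  have "2 * a * \<bar>x\<bar> \<le> 1 * \<bar>x\<bar>" using a_small by (intro mult_right_mono) auto
  then show ?thesis using a_nonneg by (simp add: abs_mult)
qed

lemma abs_ax: "\<bar>a * x\<bar> \<le> a * exp \<bar>x\<bar>"
  using a_nonneg abs_le_exp[of x] by (simp add: abs_mult mult_left_mono)

lemma H_bound: "\<bar>m\<bar> \<le> 1 \<Longrightarrow> \<bar>H m x\<bar> \<le> a * exp (2 * \<bar>x\<bar>)"
proof -
  assume "\<bar>m\<bar> \<le> 1"
  then have "\<bar>H m x\<bar> \<le> \<bar>a * x\<bar> * exp (2 * \<bar>a * x\<bar>)" by (rule tilt_bound)
  also have "\<dots> \<le> (a * exp \<bar>x\<bar>) * exp \<bar>x\<bar>" using a_nonneg by (intro mult_mono abs_ax exp_2ax) auto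
  finally show ?thesis by (simp add: mult_exp_exp mult.assoc)
qed

lemma H_linear: "\<bar>m\<bar> \<le> 1 \<Longrightarrow> \<bar>H m x - a * x\<bar> \<le> 2 * a\<^sup>2 * exp (3 * \<bar>x\<bar>)"
proof -
  assume "\<bar>m\<bar> \<le> 1"
  then have "\<bar>H m x - a * x\<bar> \<le> 2 * (a * x)\<^sup>2 * exp (2 * \<bar>a * x\<bar>)" by (rule tilt_linear)
  also have "\<dots> = 2 * (\<bar>a * x\<bar> * \<bar>a * x\<bar>) * exp (2 * \<bar>a * x\<bar>)" by (simp add: power2_eq_square)
  also have "\<dots> \<le> 2 * ((a * exp \<bar>x\<bar>) * (a * exp \<bar>x\<bar>)) * exp \<bar>x\<bar>"
    using a_nonneg by (intro mult_mono abs_ax exp_2ax) auto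
  also have "\<dots> = 2 * a\<^sup>2 * exp (3 * \<bar>x\<bar>)"
    by (simp add: power2_eq_square flip: exp_add)
  finally show ?thesis .
qed

lemma X_bound: "\<bar>m\<bar> \<le> 1 \<Longrightarrow> \<bar>X m x - 1\<bar> \<le> 2 * a * exp (2 * \<bar>x\<bar>)"
proof -
  assume "\<bar>m\<bar> \<le> 1"
  then have "\<bar>X m x - 1\<bar> \<le> 2 * \<bar>a * x\<bar> * exp (2 * \<bar>a * x\<bar>)" by (rule tilt_den_sq_bound)
  also have "\<dots> \<le> 2 * (a * exp \<bar>x\<bar>) * exp \<bar>x\<bar>" using a_nonneg by (intro mult_mono abs_ax exp_2ax) auto
  finally show ?thesis by (simp add: mult_exp_exp mult.assoc)
qed

lemma exp_le_exp8: "k \<le> 8 \<Longrightarrow> exp (k * \<bar>x\<bar>) \<le> exp (8 * \<bar>x\<bar>)" for x k :: real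
  by (simp add: mult_right_mono)

lemma mult_le_exp8:
  fixes u v b c x j k :: real
  assumes "\<bar>u\<bar> \<le> b * exp (j * \<bar>x\<bar>)" "\<bar>v\<bar> \<le> c * exp (k * \<bar>x\<bar>)" "0 \<le> b" "0 \<le> c" "j + k \<le> 8"
  shows "\<bar>u * v\<bar> \<le> b * c * exp (8 * \<bar>x\<bar>)"
proof -
  have "\<bar>u * v\<bar> \<le> (b * exp (j * \<bar>x\<bar>)) * (c * exp (k * \<bar>x\<bar>))"
    unfolding abs_mult using assms by (intro mult_mono) auto
  also have "\<dots> = b * c * exp ((j + k) * \<bar>x\<bar>)" by (simp add: exp_add distrib_right)
  also have "\<dots> \<le> b * c * exp (8 * \<bar>x\<bar>)"
    using assms by (intro mult_left_mono exp_le_exp8) auto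
  finally show ?thesis .
qed

lemma le_exp8:
  fixes u b x j :: real
  assumes "\<bar>u\<bar> \<le> b * exp (j * \<bar>x\<bar>)" "0 \<le> b" "j \<le> 8"
  shows "\<bar>u\<bar> \<le> b * exp (8 * \<bar>x\<bar>)"
  using mult_le_exp8[of u b j x 1 1 0] assms by simp

lemma integrable_H: "\<bar>m\<bar> \<le> 1 \<Longrightarrow> integrable \<gamma> (H m)"
  by (rule dominated(1)[of _ a]) (auto intro!: le_exp8 H_bound a_nonneg)

lemma integrable_HH: "\<bar>m\<bar> \<le> 1 \<Longrightarrow> \<bar>m'\<bar> \<le> 1 \<Longrightarrow> integrable \<gamma> (\<lambda>x. H m x * H m' x)"
  by (rule dominated(1)[of _ "a * a"]) (auto intro!: mult_le_exp8[OF H_bound H_bound] a_nonneg)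

lemma integrable_id: "integrable \<gamma> (\<lambda>x. x)"
proof (rule dominated(1)[of _ 1])
  show "\<bar>x\<bar> \<le> 1 * exp (8 * \<bar>x\<bar>)" for x :: real
    using le_exp8[of x 1 1 x] abs_le_exp[of x] by simp
qed simp

lemma integrable_sq: "integrable \<gamma> (\<lambda>x. x\<^sup>2)"
proof (rule dominated(1)[of _ 1])
  show "\<bar>x\<^sup>2\<bar> \<le> 1 * exp (8 * \<bar>x\<bar>)" for x :: real
    using mult_le_exp8[of x 1 1 x x 1 1] abs_le_exp[of x] by (simp add: power2_eq_square)
qed simp

lemma integrable_X: "\<bar>m\<bar> \<le> 1 \<Longrightarrow> integrable \<gamma> (X m)" "\<bar>m\<bar> \<le> 1 \<Longrightarrow> \<bar>(\<integral>x. X m x \<partial>\<gamma>) - 1\<bar> \<le> 2 * a * exp_const"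
proof -
  interpret g: prob_space \<gamma> by (rule prob)
  assume m: "\<bar>m\<bar> \<le> 1"
  have b: "\<bar>X m x - 1\<bar> \<le> 2 * a * exp (8 * \<bar>x\<bar>)" for x
    using a_nonneg by (intro le_exp8[OF X_bound[OF m]]) auto
  have *: "integrable \<gamma> (\<lambda>x. X m x - 1)" "\<bar>\<integral>x. X m x - 1 \<partial>\<gamma>\<bar> \<le> 2 * a * exp_const"
    by (rule dominated[OF _ b]; intro borel_measurable_diff meas_HX borel_measurable_const)+
  have "integrable \<gamma> (\<lambda>x. (X m x - 1) + 1)" using *(1) by (intro Bochner_Integration.integrable_add) auto
  then show i: "integrable \<gamma> (X m)" by simp
  show "\<bar>(\<integral>x. X m x \<partial>\<gamma>) - 1\<bar> \<le> 2 * a * exp_const"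
    using *(2) i by (simp add: g.prob_space)
qed

lemma integrable_XX:
  assumes m: "\<bar>m\<bar> \<le> 1" "\<bar>m'\<bar> \<le> 1"
  shows "integrable \<gamma> (\<lambda>x. X m x * X m' x)" "\<bar>(\<integral>x. X m x * X m' x \<partial>\<gamma>) - 1\<bar> \<le> 8 * a * exp_const"
proof -
  interpret g: prob_space \<gamma> by (rule prob)
  have b: "\<bar>X m x * X m' x - 1\<bar> \<le> 8 * a * exp (8 * \<bar>x\<bar>)" for x
  proof -
    have "X m x * X m' x - 1 = (X m x - 1) * (X m' x - 1) + ((X m x - 1) + (X m' x - 1))"
      by (simp only: ring_distribs mult_1_left mult_1_right)
    also have "\<bar>\<dots>\<bar> \<le> \<bar>(X m x - 1) * (X m' x - 1)\<bar> + (\<bar>X m x - 1\<bar> + \<bar>X m' x - 1\<bar>)"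
      by (meson abs_triangle_ineq add_left_mono order_trans)
    also have "\<dots> \<le> 2 * a * (2 * a) * exp (8 * \<bar>x\<bar>) + (2 * a * exp (8 * \<bar>x\<bar>) + 2 * a * exp (8 * \<bar>x\<bar>))"
      using a_nonneg by (intro add_mono mult_le_exp8[OF X_bound X_bound] le_exp8[OF X_bound] m) auto
    also have "\<dots> = (4 * a * a + 4 * a) * exp (8 * \<bar>x\<bar>)" by (simp add: algebra_simps)
    also have "\<dots> \<le> 8 * a * exp (8 * \<bar>x\<bar>)"
      using a_small a_nonneg mult_left_mono[of a 1 a] by (intro mult_right_mono) auto
    finally show ?thesis .
  qed
  have *: "integrable \<gamma> (\<lambda>x. X m x * X m' x - 1)" "\<bar>\<integral>x. X m x * X m' x - 1 \<partial>\<gamma>\<bar> \<le> 8 * a * exp_const"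
    by (rule dominated[OF _ b]; intro borel_measurable_diff borel_measurable_times meas_HX borel_measurable_const)+
  have "integrable \<gamma> (\<lambda>x. (X m x * X m' x - 1) + 1)" using *(1) by (intro Bochner_Integration.integrable_add) auto
  then show i: "integrable \<gamma> (\<lambda>x. X m x * X m' x)" by simp
  show "\<bar>(\<integral>x. X m x * X m' x \<partial>\<gamma>) - 1\<bar> \<le> 8 * a * exp_const"
    using *(2) i by (simp add: g.prob_space)
qed

lemma product_close_1:
  assumes "\<bar>u - 1\<bar> \<le> 2 * a * exp_const" "\<bar>v - 1\<bar> \<le> 2 * a * exp_const"
  shows "\<bar>u * v - 1\<bar> \<le> 8 * a * exp_const\<^sup>2"
proof -
  have "u * v - 1 = (u - 1) * (v - 1) + ((u - 1) + (v - 1))" by (simp add: algebra_simps)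
  also have "\<bar>\<dots>\<bar> \<le> \<bar>u - 1\<bar> * \<bar>v - 1\<bar> + (\<bar>u - 1\<bar> + \<bar>v - 1\<bar>)"
    unfolding abs_mult[symmetric] by (meson abs_triangle_ineq add_left_mono order_trans)
  also have "\<dots> \<le> (2 * a * exp_const) * (2 * a * exp_const) + (2 * a * exp_const + 2 * a * exp_const)"
    using assms by (intro add_mono mult_mono) auto
  also have "\<dots> = 4 * (a * (a * exp_const\<^sup>2)) + 4 * (a * exp_const)" by (simp add: power2_eq_square algebra_simps)
  also have "\<dots> \<le> 4 * (a * (1 * exp_const\<^sup>2)) + 4 * (a * exp_const\<^sup>2)"
    using exp_const_ge_1 a_nonneg a_small self_le_power[of exp_const 2]
    by (intro add_mono mult_left_mono mult_right_mono) auto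
  finally show ?thesis by simp
qed

text \<open>Since \<open>H m x\<close> equals \<open>a * x\<close> up to order
  \<open>a\<^sup>2\<close>, the mean of a product of tilts is \<open>a\<^sup>2\<close> up to order
  \<open>a ^ 3\<close>, and the product of the means is itself of order \<open>a ^ 3\<close>. The
  free factor \<open>\<xi>\<close> absorbs the mean of the \<open>X\<close> factors in
  \<open>key_step\<close>. The constant is 14 = 4 + 2 + 8, from the product of tilts, the product of
  means and \<open>\<xi>\<close>.\<close>

lemma tilt_covariance:
  assumes m: "\<bar>m\<bar> \<le> 1" "\<bar>m'\<bar> \<le> 1" and xi: "\<bar>\<xi> - 1\<bar> \<le> 8 * a * exp_const\<^sup>2"
  shows "\<bar>(\<integral>x. H m x * H m' x \<partial>\<gamma>) - (\<integral>x. H m x \<partial>\<gamma>) * (\<integral>x. H m' x \<partial>\<gamma>) - a\<^sup>2 * \<xi>\<bar> \<le> 14 * exp_const\<^sup>2 * a ^ 3"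
proof -
  have 1: "\<bar>(\<integral>x. H m x * H m' x \<partial>\<gamma>) - a\<^sup>2\<bar> \<le> 4 * a ^ 3 * exp_const"
  proof -
    have "\<bar>H m x * H m' x - a\<^sup>2 * x\<^sup>2\<bar> \<le> 4 * a ^ 3 * exp (8 * \<bar>x\<bar>)" for x
    proof -
      have "H m x * H m' x - a\<^sup>2 * x\<^sup>2 = (H m x - a * x) * H m' x + (a * x) * (H m' x - a * x)"
        by (simp add: algebra_simps power2_eq_square)
      also have "\<bar>\<dots>\<bar> \<le> \<bar>(H m x - a * x) * H m' x\<bar> + \<bar>(a * x) * (H m' x - a * x)\<bar>"
        by (rule abs_triangle_ineq)
      also have "\<dots> \<le> 2 * a\<^sup>2 * a * exp (8 * \<bar>x\<bar>) + a * (2 * a\<^sup>2) * exp (8 * \<bar>x\<bar>)"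
      proof (intro add_mono)
        show "\<bar>(H m x - a * x) * H m' x\<bar> \<le> 2 * a\<^sup>2 * a * exp (8 * \<bar>x\<bar>)"
          using a_nonneg by (intro mult_le_exp8[OF H_linear H_bound] m) auto
        show "\<bar>(a * x) * (H m' x - a * x)\<bar> \<le> a * (2 * a\<^sup>2) * exp (8 * \<bar>x\<bar>)"
          using a_nonneg abs_ax[of x] by (intro mult_le_exp8[OF _ H_linear, of _ _ 1] m) auto
      qed
      finally show ?thesis by (simp add: power2_eq_square power3_eq_cube)
    qed
    then have "\<bar>\<integral>x. H m x * H m' x - a\<^sup>2 * x\<^sup>2 \<partial>\<gamma>\<bar> \<le> 4 * a ^ 3 * exp_const"
      by (intro dominated(2)) measurable
    then show ?thesis using integrable_HH[OF m] integrable_sq by (simp add: var_1)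
  qed
  have 2: "\<bar>\<integral>x. H m x \<partial>\<gamma>\<bar> \<le> 2 * a\<^sup>2 * exp_const"
  proof -
    have "\<bar>\<integral>x. H m x - a * x \<partial>\<gamma>\<bar> \<le> 2 * a\<^sup>2 * exp_const"
      by (intro dominated(2)) (measurable, rule le_exp8[OF H_linear[OF m(1)]], auto)
    then show ?thesis using integrable_H[OF m(1)] integrable_id by (simp add: mean_0)
  qed
  have 3: "\<bar>\<integral>x. H m' x \<partial>\<gamma>\<bar> \<le> a * exp_const"
    by (intro dominated(2)) (measurable, rule le_exp8[OF H_bound[OF m(2)]], use a_nonneg in auto)
  have 4: "\<bar>(\<integral>x. H m x \<partial>\<gamma>) * (\<integral>x. H m' x \<partial>\<gamma>)\<bar> \<le> 2 * (exp_const\<^sup>2 * a ^ 3)"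
  proof -
    have "\<bar>(\<integral>x. H m x \<partial>\<gamma>) * (\<integral>x. H m' x \<partial>\<gamma>)\<bar> \<le> (2 * a\<^sup>2 * exp_const) * (a * exp_const)"
      unfolding abs_mult using 2 3 exp_const_ge_1 by (intro mult_mono) (auto intro!: mult_nonneg_nonneg)
    also have "(2 * a\<^sup>2 * exp_const) * (a * exp_const) = 2 * (exp_const\<^sup>2 * a ^ 3)"
      by (simp add: power2_eq_square power3_eq_cube)
    finally show ?thesis .
  qed
  have 5: "\<bar>a\<^sup>2 * \<xi> - a\<^sup>2\<bar> \<le> 8 * (exp_const\<^sup>2 * a ^ 3)"
  proof -
    have "\<bar>a\<^sup>2 * \<xi> - a\<^sup>2\<bar> = a\<^sup>2 * \<bar>\<xi> - 1\<bar>" using abs_mult[of "a\<^sup>2" "\<xi> - 1"] by (simp add: right_diff_distrib)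
    also have "\<dots> \<le> a\<^sup>2 * (8 * a * exp_const\<^sup>2)" using xi by (intro mult_left_mono) auto
    also have "a\<^sup>2 * (8 * a * exp_const\<^sup>2) = 8 * (exp_const\<^sup>2 * a ^ 3)"
      by (simp add: power2_eq_square power3_eq_cube)
    finally show ?thesis .
  qed
  have "exp_const * a ^ 3 \<le> exp_const\<^sup>2 * a ^ 3"
    using exp_const_ge_1 a_nonneg self_le_power[of exp_const 2] by (intro mult_right_mono) auto
  then have "4 * a ^ 3 * exp_const \<le> 4 * (exp_const\<^sup>2 * a ^ 3)" by (simp add: mult.commute)
  then show ?thesis unfolding mult.assoc[of 14] using 1 4 5 unfolding abs_le_iff by linarith
qed

section \<open>Gibbs means over two replicas\<close>

definition gibbs_mean :: "('c \<Rightarrow> 'c \<Rightarrow> real) \<Rightarrow> (nat \<times> nat \<Rightarrow> real) \<Rightarrow> (nat \<times> nat \<Rightarrow> real) \<Rightarrow> real" where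
  "gibbs_mean \<phi> g h = (\<Sum>\<sigma>\<in>\<Omega>. \<Sum>\<tau>\<in>\<Omega>. \<phi> \<sigma> \<tau> * (mu g \<sigma> * mu h \<tau>))"

text \<open>Multiplied by \<open>a\<^sup>2\<close>, this is the mixed derivative of
  \<open>gibbs_mean \<phi> g h\<close> in \<open>g e\<close> and \<open>h e\<close>, the term that
  Gaussian interpolation produces.\<close>

definition centred_mean :: "('c \<Rightarrow> 'c \<Rightarrow> real) \<Rightarrow> nat \<times> nat \<Rightarrow> (nat \<times> nat \<Rightarrow> real) \<Rightarrow> (nat \<times> nat \<Rightarrow> real) \<Rightarrow> real" where
  "centred_mean \<phi> e g h = (\<Sum>\<sigma>\<in>\<Omega>. \<Sum>\<tau>\<in>\<Omega>. \<phi> \<sigma> \<tau> * ((mu g \<sigma> * (s e \<sigma> - mag e g)) * (mu h \<tau> * (s e \<tau> - mag e h))))"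

lemma bm1_mu: "\<sigma> \<in> \<Omega> \<Longrightarrow> bm1 (\<lambda>g. mu g \<sigma>)"
proof (rule bdd_measI[where B=1])
  have [measurable]: "(\<lambda>g. g e) \<in> borel_measurable M" if "e \<in> I" for e
    using measurable_component_singleton[OF that, of "\<lambda>_. \<gamma>"]
    by (simp add: measurable_cong_sets[OF refl sets_\<gamma>])
  show "(\<lambda>g. mu g \<sigma>) \<in> borel_measurable M"
    unfolding mu_def wt_def by measurable
  show "\<bar>mu g \<sigma>\<bar> \<le> 1" if "\<sigma> \<in> \<Omega>" for g
    using mu_nonneg[of g \<sigma>] mu_le_1[OF that, of g] by simp
qed

lemma bm1_mag: "bm1 (mag e)"
proof -
  have "bm1 (\<lambda>g. \<Sum>\<sigma>\<in>\<Omega>. mu g \<sigma> * s e \<sigma>)"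
    by (intro bdd_meas_sum bdd_meas_mult bm1_mu bdd_meas_const)
  then show ?thesis by (simp add: mag_def[abs_def])
qed

lemma bm2_gibbs_mean: "bm2 (gibbs_mean \<phi>)"
  unfolding gibbs_mean_def[abs_def] by (intro bm2_lin bm1_mu)

lemma bm2_centred_mean: "bm2 (centred_mean \<phi> e)"
  unfolding centred_mean_def[abs_def] by (intro bm2_lin bm1_mu bm1_mag)

text \<open>Terms with a single tilt have the same expectation for shared and for independent
  entries. The coefficients \<open>P\<close> and \<open>Q\<close> therefore cancel in
  \<open>key_step\<close>, and it is enough that they exist.\<close>

lemma gibbs_mean_upd:
  assumes e: "e \<in> I"
  defines "m \<equiv> \<lambda>g. mag e (g(e := 0))"
  obtains P Q where "\<And>x y. gibbs_mean \<phi> (g(e := x)) (h(e := y)) = gibbs_mean \<phi> (g(e := 0)) (h(e := 0)) + P * H (m g) x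
     + Q * H (m h) y + centred_mean \<phi> e (g(e := 0)) (h(e := 0)) * (H (m g) x * H (m h) y)"
proof (rule that)
  fix x y
  let ?g = "g(e := 0)" and ?h = "h(e := 0)"
  let ?H = "H (m g) x" and ?H' = "H (m h) y"
  let ?P = "\<Sum>\<sigma>\<in>\<Omega>. \<Sum>\<tau>\<in>\<Omega>. \<phi> \<sigma> \<tau> * (mu ?g \<sigma> * mu ?h \<tau>) * (s e \<sigma> - mag e ?g)"
  let ?Q = "\<Sum>\<sigma>\<in>\<Omega>. \<Sum>\<tau>\<in>\<Omega>. \<phi> \<sigma> \<tau> * (mu ?g \<sigma> * mu ?h \<tau>) * (s e \<tau> - mag e ?h)"
  have al: "f * ((u * (1 + p * hx)) * (v * (1 + q * hy))) =
      f * (u * v) + f * (u * v) * p * hx + f * (u * v) * q * hy + f * ((u * p) * (v * q)) * (hx * hy)"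
    for f u v p q hx hy :: real by (simp add: algebra_simps)
  have "gibbs_mean \<phi> (g(e := x)) (h(e := y)) = (\<Sum>\<sigma>\<in>\<Omega>. \<Sum>\<tau>\<in>\<Omega>. \<phi> \<sigma> \<tau> *
     ((mu ?g \<sigma> * (1 + (s e \<sigma> - mag e ?g) * ?H)) * (mu ?h \<tau> * (1 + (s e \<tau> - mag e ?h) * ?H'))))"
    unfolding gibbs_mean_def m_def
    by (intro sum.cong refl) (simp only: mu_upd[OF e, of _ g x] mu_upd[OF e, of _ h y])
  also have "\<dots> = gibbs_mean \<phi> ?g ?h + ?P * ?H + ?Q * ?H' + centred_mean \<phi> e ?g ?h * (?H * ?H')"
    unfolding gibbs_mean_def centred_mean_def al by (simp only: sum.distrib sum_distrib_right)
  finally show "gibbs_mean \<phi> (g(e := x)) (h(e := y)) = gibbs_mean \<phi> ?g ?h + ?P * ?H + ?Q * ?H' + centred_mean \<phi> e ?g ?h * (?H * ?H')" .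
qed

lemma centred_mean_upd:
  assumes e: "e \<in> I"
  shows "centred_mean \<phi> e (g(e := x)) (h(e := y)) =
    centred_mean \<phi> e (g(e := 0)) (h(e := 0)) * (X (mag e (g(e := 0))) x * X (mag e (h(e := 0))) y)"
proof -
  have al: "f * ((u * p) * (v * q)) = f * (u * v) * (p * q)" for f u v p q :: real by simp
  show ?thesis unfolding centred_mean_def sum_distrib_right
    by (intro sum.cong refl) (simp only: mu_centred_upd[OF e, of _ g x] mu_centred_upd[OF e, of _ h y] al)
qed

lemma gibbs_mean_nonneg: "(\<And>\<sigma> \<tau>. 0 \<le> \<phi> \<sigma> \<tau>) \<Longrightarrow> 0 \<le> gibbs_mean \<phi> g h"
  unfolding gibbs_mean_def by (intro sum_nonneg mult_nonneg_nonneg mu_nonneg)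

text \<open>This is \<open>mu_upd_lower\<close> for both replicas, with the exponential replaced by
  a quadratic through \<open>2 * \<bar>z\<bar> \<le> 1 + z\<^sup>2\<close>, so that averaging over
  \<open>x\<close> and \<open>y\<close> takes only the second moment.\<close>

lemma gibbs_mean_upd_lower:
  assumes e: "e \<in> I" and \<phi>: "\<And>\<sigma> \<tau>. 0 \<le> \<phi> \<sigma> \<tau>"
  shows "gibbs_mean \<phi> (g(e := 0)) (h(e := 0)) * (1 - a * (2 + x\<^sup>2 + y\<^sup>2)) \<le> gibbs_mean \<phi> (g(e := x)) (h(e := y))"
proof -
  have "gibbs_mean \<phi> (g(e := 0)) (h(e := 0)) * exp (- (2 * \<bar>a * x\<bar>) + - (2 * \<bar>a * y\<bar>)) =
     (\<Sum>\<sigma>\<in>\<Omega>. \<Sum>\<tau>\<in>\<Omega>. \<phi> \<sigma> \<tau> * ((mu (g(e := 0)) \<sigma> * exp (- (2 * \<bar>a * x\<bar>))) * (mu (h(e := 0)) \<tau> * exp (- (2 * \<bar>a * y\<bar>)))))"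
    unfolding gibbs_mean_def sum_distrib_right exp_add by (simp only: mult_ac)
  also have "\<dots> \<le> gibbs_mean \<phi> (g(e := x)) (h(e := y))"
    unfolding gibbs_mean_def
    by (intro sum_mono mult_left_mono mult_mono mu_upd_lower e \<phi> mu_nonneg mult_nonneg_nonneg) auto
  finally have 1: "gibbs_mean \<phi> (g(e := 0)) (h(e := 0)) * exp (- (2 * \<bar>a * x\<bar>) + - (2 * \<bar>a * y\<bar>)) \<le> gibbs_mean \<phi> (g(e := x)) (h(e := y))" .
  have sq: "2 * \<bar>z\<bar> \<le> 1 + z\<^sup>2" for z :: real
    using zero_le_power2[of "\<bar>z\<bar> - 1"] by (simp add: power2_eq_square algebra_simps)
  have "a * (2 * \<bar>x\<bar> + 2 * \<bar>y\<bar>) \<le> a * (2 + x\<^sup>2 + y\<^sup>2)"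
    using sq[of x] sq[of y] a_nonneg by (intro mult_left_mono) linarith+
  then have "1 - a * (2 + x\<^sup>2 + y\<^sup>2) \<le> 1 + (- (2 * \<bar>a * x\<bar>) + - (2 * \<bar>a * y\<bar>))"
    using a_nonneg by (simp add: abs_mult algebra_simps)
  also have "\<dots> \<le> exp (- (2 * \<bar>a * x\<bar>) + - (2 * \<bar>a * y\<bar>))" by (rule exp_ge_add_one_self)
  finally show ?thesis
    using mult_left_mono[OF _ gibbs_mean_nonneg[OF \<phi>]] 1 by (meson order_trans)
qed

lemma centred_mean_le_gibbs_mean:
  assumes e: "e \<in> I" and \<phi>: "\<And>\<sigma> \<tau>. 0 \<le> \<phi> \<sigma> \<tau>"
  shows "\<bar>centred_mean \<phi> e g h\<bar> \<le> 4 * gibbs_mean \<phi> g h"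
proof -
  have 2: "\<bar>s e \<sigma> - mag e g\<bar> \<le> 2" if "\<sigma> \<in> \<Omega>" for \<sigma> g
    using s_cases[OF e that] abs_mag_le[OF e, of g] by auto
  have "\<bar>\<phi> \<sigma> \<tau> * ((mu g \<sigma> * (s e \<sigma> - mag e g)) * (mu h \<tau> * (s e \<tau> - mag e h)))\<bar> \<le> 4 * (\<phi> \<sigma> \<tau> * (mu g \<sigma> * mu h \<tau>))"
    if "\<sigma> \<in> \<Omega>" "\<tau> \<in> \<Omega>" for \<sigma> \<tau>
  proof -
    have "\<bar>s e \<sigma> - mag e g\<bar> * \<bar>s e \<tau> - mag e h\<bar> \<le> 2 * 2"
      using 2 that by (intro mult_mono) auto
    then have "(\<phi> \<sigma> \<tau> * (mu g \<sigma> * mu h \<tau>)) * (\<bar>s e \<sigma> - mag e g\<bar> * \<bar>s e \<tau> - mag e h\<bar>) \<le> (\<phi> \<sigma> \<tau> * (mu g \<sigma> * mu h \<tau>)) * (2 * 2)"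
      by (intro mult_left_mono mult_nonneg_nonneg \<phi> mu_nonneg)
    then show ?thesis using \<phi>[of \<sigma> \<tau>] mu_nonneg by (simp add: abs_mult mult_ac)
  qed
  then show ?thesis unfolding centred_mean_def gibbs_mean_def sum_distrib_left
    by (intro order_trans[OF sum_abs] sum_mono order_trans[OF sum_abs] sum_mono)
qed

text \<open>A discrete substitute for Gaussian integration by parts. Relative to \<open>g e = 0\<close> both sides are
  multiples of the same \<open>centred_mean\<close>, so only one-dimensional expectations are compared.\<close>

lemma key_step:
  assumes e: "e \<in> I" and \<phi>: "\<And>\<sigma> \<tau>. 0 \<le> \<phi> \<sigma> \<tau>"
  defines "c \<equiv> 112 * exp_const\<^sup>2 * a ^ 3"
  shows "pair_mean (insert e A) (gibbs_mean \<phi>) - pair_mean (A - {e}) (gibbs_mean \<phi>) \<le> a\<^sup>2 * pair_mean (insert e A) (centred_mean \<phi> e) + c * pair_mean (insert e A) (gibbs_mean \<phi>)"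
    and "pair_mean (insert e A) (gibbs_mean \<phi>) - pair_mean (A - {e}) (gibbs_mean \<phi>) \<le> a\<^sup>2 * pair_mean (A - {e}) (centred_mean \<phi> e) + c * pair_mean (A - {e}) (gibbs_mean \<phi>)"
proof -
  interpret g: prob_space \<gamma> by (rule prob)
  let ?R = "\<lambda>g h. a\<^sup>2 * centred_mean \<phi> e g h + c * gibbs_mean \<phi> g h"
  let ?D = "\<lambda>g h. (\<integral>x. gibbs_mean \<phi> (g(e := x)) (h(e := x)) \<partial>\<gamma>) - (\<integral>x. \<integral>y. gibbs_mean \<phi> (g(e := x)) (h(e := y)) \<partial>\<gamma> \<partial>\<gamma>)"
  have R: "bm2 ?R" by (intro bm2_lin bm2_gibbs_mean bm2_centred_mean)
  have GR: "pair_mean B ?R = a\<^sup>2 * pair_mean B (centred_mean \<phi> e) + c * pair_mean B (gibbs_mean \<phi>)" for B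
    by (simp only: pair_mean_add pair_mean_cmult bm2_lin bm2_gibbs_mean bm2_centred_mean)
  have D: "pair_mean (insert e A) (gibbs_mean \<phi>) - pair_mean (A - {e}) (gibbs_mean \<phi>) = pair_mean A ?D"
    unfolding pair_mean_insert[OF e bm2_gibbs_mean] pair_mean_remove[OF e bm2_gibbs_mean]
    by (intro pair_mean_diff[symmetric] bm2_upd_indep bm2_upd_same e bm2_gibbs_mean)
  have bD: "bm2 ?D" by (intro bm2_lin bm2_upd_indep bm2_upd_same e bm2_gibbs_mean)
  \<comment> \<open>The comparison holds for every fixed pair of arrays once the entry at
    \<open>e\<close> is averaged; \<open>pair_mean_mono\<close> then integrates it.\<close>
  have pt: "?D g h \<le> (\<integral>x. ?R (g(e := x)) (h(e := x)) \<partial>\<gamma>)"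
    "?D g h \<le> (\<integral>x. \<integral>y. ?R (g(e := x)) (h(e := y)) \<partial>\<gamma> \<partial>\<gamma>)" for g h
  proof -
    define m m' where "m = mag e (g(e := 0))" and "m' = mag e (h(e := 0))"
    define V0 L0 where "V0 = gibbs_mean \<phi> (g(e := 0)) (h(e := 0))" and "L0 = centred_mean \<phi> e (g(e := 0)) (h(e := 0))"
    have m: "\<bar>m\<bar> \<le> 1" "\<bar>m'\<bar> \<le> 1" using abs_mag_le[OF e] by (auto simp: m_def m'_def)
    obtain P Q where mean: "\<And>x y. gibbs_mean \<phi> (g(e := x)) (h(e := y)) = V0 + P * H m x + Q * H m' y + L0 * (H m x * H m' y)"
      using gibbs_mean_upd[OF e, of \<phi> g h] unfolding V0_def L0_def m_def m'_def by blast
    define Xm Xm' where "Xm = (\<lambda>x. X m x)" and "Xm' = (\<lambda>x. X m' x)"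
    have centred: "centred_mean \<phi> e (g(e := x)) (h(e := y)) = L0 * (Xm x * Xm' y)" for x y
      unfolding L0_def m_def m'_def Xm_def Xm'_def by (rule centred_mean_upd[OF e])
    note int = integrable_H[OF m(1)] integrable_H[OF m(2)] integrable_HH[OF m]
      integrable_X(1)[OF m(1), folded Xm_def] integrable_X(1)[OF m(2), folded Xm'_def]
      integrable_XX(1)[OF m, folded fun_cong[OF Xm_def] fun_cong[OF Xm'_def]]
    let ?h = "\<integral>x. H m x \<partial>\<gamma>" and ?h' = "\<integral>x. H m' x \<partial>\<gamma>" and ?hh = "\<integral>x. H m x * H m' x \<partial>\<gamma>"
    have same: "(\<integral>x. gibbs_mean \<phi> (g(e := x)) (h(e := x)) \<partial>\<gamma>) = V0 + P * ?h + Q * ?h' + L0 * ?hh"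
      unfolding mean using int by (simp add: g.prob_space)
    have "(\<integral>y. gibbs_mean \<phi> (g(e := x)) (h(e := y)) \<partial>\<gamma>) = V0 + P * H m x + Q * ?h' + L0 * (H m x * ?h')" for x
      unfolding mean using int by (simp add: g.prob_space)
    then have indep: "(\<integral>x. \<integral>y. gibbs_mean \<phi> (g(e := x)) (h(e := y)) \<partial>\<gamma> \<partial>\<gamma>) = V0 + P * ?h + Q * ?h' + L0 * (?h * ?h')"
      using int by (simp add: g.prob_space)
    have Dval: "?D g h = (?hh - ?h * ?h') * L0"
      unfolding same indep by (simp add: algebra_simps)
    have L0: "\<bar>L0\<bar> \<le> 4 * V0" unfolding L0_def V0_def by (rule centred_mean_le_gibbs_mean[OF e \<phi>])
    \<comment> \<open>One estimate for both claims: \<open>\<xi>\<close> will be the mean of the two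
      \<open>X\<close> factors and \<open>v\<close> that of \<open>gibbs_mean\<close>, for a shared
      or for independent entries. The constant is 112 = 14 * 4 * 2, from
      \<open>tilt_covariance\<close>, \<open>L0\<close> and the passage from \<open>V0\<close> to
      \<open>v\<close>.\<close>
    have main: "?D g h \<le> a\<^sup>2 * (L0 * \<xi>) + c * v"
      if xi: "\<bar>\<xi> - 1\<bar> \<le> 8 * a * exp_const\<^sup>2" and v: "V0 \<le> 2 * v" for \<xi> v
    proof -
      have "?D g h - a\<^sup>2 * (L0 * \<xi>) = (?hh - ?h * ?h' - a\<^sup>2 * \<xi>) * L0"
        unfolding Dval by (simp add: algebra_simps)
      also have "\<dots> \<le> \<bar>?hh - ?h * ?h' - a\<^sup>2 * \<xi>\<bar> * \<bar>L0\<bar>" by (simp only: abs_mult[symmetric] abs_ge_self)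
      also have "\<dots> \<le> (14 * exp_const\<^sup>2 * a ^ 3) * (4 * V0)"
        using tilt_covariance[OF m xi] L0 a_nonneg by (intro mult_mono) auto
      also have "\<dots> \<le> (14 * exp_const\<^sup>2 * a ^ 3) * (4 * (2 * v))"
        using v a_nonneg by (intro mult_left_mono) auto
      finally show ?thesis by (simp add: c_def)
    qed
    have low: "V0 * (1 - a * (2 + x\<^sup>2 + y\<^sup>2)) \<le> V0 + P * H m x + Q * H m' y + L0 * (H m x * H m' y)" for x y
      using gibbs_mean_upd_lower[where \<phi>=\<phi> and g=g and h=h and x=x and y=y, OF e \<phi>] unfolding V0_def[symmetric] mean[of x y] .
    have V0: "0 \<le> V0" unfolding V0_def by (rule gibbs_mean_nonneg[OF \<phi>])
    \<comment> \<open>In both cases \<open>2 + x\<^sup>2 + y\<^sup>2\<close> has mean 4, so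
      averaging \<open>low\<close> loses at most a factor 2.\<close>
    have half: "V0 * (1 / 2) \<le> V0 * (1 - a * 4)"
      using V0 a_small by (intro mult_left_mono) auto
    have "(\<integral>x. V0 * (1 - a * (2 + x\<^sup>2 + x\<^sup>2)) \<partial>\<gamma>) \<le> (\<integral>x. V0 + P * H m x + Q * H m' x + L0 * (H m x * H m' x) \<partial>\<gamma>)"
      by (rule integral_mono) (use int integrable_sq in simp, use int in simp, rule low)
    then have v1: "V0 \<le> 2 * (\<integral>x. gibbs_mean \<phi> (g(e := x)) (h(e := x)) \<partial>\<gamma>)"
      unfolding mean using half integrable_sq by (simp add: g.prob_space var_1)
    have "(\<integral>y. V0 * (1 - a * (2 + x\<^sup>2 + y\<^sup>2)) \<partial>\<gamma>) \<le> (\<integral>y. V0 + P * H m x + Q * H m' y + L0 * (H m x * H m' y) \<partial>\<gamma>)" for x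
      by (rule integral_mono) (use int integrable_sq in simp, use int in simp, rule low)
    then have "V0 * (1 - a * (3 + x\<^sup>2)) \<le> V0 + P * H m x + Q * ?h' + L0 * (H m x * ?h')" for x
      using int integrable_sq by (simp add: g.prob_space var_1 add.commute)
    then have "(\<integral>x. V0 * (1 - a * (3 + x\<^sup>2)) \<partial>\<gamma>) \<le> (\<integral>x. V0 + P * H m x + Q * ?h' + L0 * (H m x * ?h') \<partial>\<gamma>)"
      using int integrable_sq by (intro integral_mono) auto
    then have v2: "V0 \<le> 2 * (\<integral>x. \<integral>y. gibbs_mean \<phi> (g(e := x)) (h(e := y)) \<partial>\<gamma> \<partial>\<gamma>)"
      unfolding indep using half int integrable_sq by (simp add: g.prob_space var_1)
    have xi1: "\<bar>(\<integral>x. Xm x * Xm' x \<partial>\<gamma>) - 1\<bar> \<le> 8 * a * exp_const\<^sup>2"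
    proof -
      have "8 * a * exp_const \<le> 8 * a * exp_const\<^sup>2"
        using exp_const_ge_1 a_nonneg self_le_power[of exp_const 2] by (intro mult_left_mono) auto
      then show ?thesis using integrable_XX(2)[OF m] unfolding Xm_def Xm'_def by linarith
    qed
    have xi2: "\<bar>(\<integral>x. Xm x \<partial>\<gamma>) * (\<integral>x. Xm' x \<partial>\<gamma>) - 1\<bar> \<le> 8 * a * exp_const\<^sup>2"
      unfolding Xm_def Xm'_def by (intro product_close_1 integrable_X m)
    have "(\<integral>x. ?R (g(e := x)) (h(e := x)) \<partial>\<gamma>) = a\<^sup>2 * (L0 * (\<integral>x. Xm x * Xm' x \<partial>\<gamma>)) + c * (\<integral>x. gibbs_mean \<phi> (g(e := x)) (h(e := x)) \<partial>\<gamma>)"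
      unfolding centred mean using int by simp
    then show "?D g h \<le> (\<integral>x. ?R (g(e := x)) (h(e := x)) \<partial>\<gamma>)"
      using main[OF xi1 v1] by simp
    have "(\<integral>y. ?R (g(e := x)) (h(e := y)) \<partial>\<gamma>) = a\<^sup>2 * (L0 * (Xm x * (\<integral>x. Xm' x \<partial>\<gamma>))) + c * (\<integral>y. gibbs_mean \<phi> (g(e := x)) (h(e := y)) \<partial>\<gamma>)" for x
      unfolding centred mean using int by simp
    moreover have "integrable \<gamma> (\<lambda>x. \<integral>y. gibbs_mean \<phi> (g(e := x)) (h(e := y)) \<partial>\<gamma>)"
      unfolding mean using int by simp
    ultimately have "(\<integral>x. \<integral>y. ?R (g(e := x)) (h(e := y)) \<partial>\<gamma> \<partial>\<gamma>) =
      a\<^sup>2 * (L0 * ((\<integral>x. Xm x \<partial>\<gamma>) * (\<integral>x. Xm' x \<partial>\<gamma>))) + c * (\<integral>x. \<integral>y. gibbs_mean \<phi> (g(e := x)) (h(e := y)) \<partial>\<gamma> \<partial>\<gamma>)"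
      using int by simp
    then show "?D g h \<le> (\<integral>x. \<integral>y. ?R (g(e := x)) (h(e := y)) \<partial>\<gamma> \<partial>\<gamma>)"
      using main[OF xi2 v2] by simp
  qed
  show "pair_mean (insert e A) (gibbs_mean \<phi>) - pair_mean (A - {e}) (gibbs_mean \<phi>) \<le> a\<^sup>2 * pair_mean (insert e A) (centred_mean \<phi> e) + c * pair_mean (insert e A) (gibbs_mean \<phi>)"
    unfolding D GR[symmetric] pair_mean_insert[OF e R] by (intro pair_mean_mono bD bm2_upd_same e R pt)
  show "pair_mean (insert e A) (gibbs_mean \<phi>) - pair_mean (A - {e}) (gibbs_mean \<phi>) \<le> a\<^sup>2 * pair_mean (A - {e}) (centred_mean \<phi> e) + c * pair_mean (A - {e}) (gibbs_mean \<phi>)"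
    unfolding D GR[symmetric] pair_mean_remove[OF e R] by (intro pair_mean_mono bD bm2_upd_indep e R pt)
qed

end

subsection \<open>Couplings kept at random\<close>

text \<open>Each element of \<open>F\<close> is kept independently with probability \<open>s\<close>.\<close>

definition kept_mean :: "'e set \<Rightarrow> real \<Rightarrow> ('e set \<Rightarrow> real) \<Rightarrow> real" where
  "kept_mean F s G = (\<Sum>A\<in>Pow F. s ^ card A * (1 - s) ^ card (F - A) * G A)"

lemma kept_mean_insert:
  assumes "finite F" "e \<notin> F"
  shows "kept_mean (insert e F) s G = s * kept_mean F s (\<lambda>A. G (insert e A)) + (1 - s) * kept_mean F s G"
proof -
  have fin: "finite A" if "A \<in> Pow F" for A using that assms(1) finite_subset by auto
  have 1: "s ^ card A * (1 - s) ^ card (insert e F - A) * G A = (1 - s) * (s ^ card A * (1 - s) ^ card (F - A) * G A)"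
    if "A \<in> Pow F" for A
  proof -
    have "insert e F - A = insert e (F - A)" using that assms by auto
    then show ?thesis using assms by simp
  qed
  have 2: "s ^ card (insert e A) * (1 - s) ^ card (insert e F - insert e A) * G (insert e A) =
      s * (s ^ card A * (1 - s) ^ card (F - A) * G (insert e A))"
    if "A \<in> Pow F" for A
  proof -
    have "insert e F - insert e A = F - A" "e \<notin> A" using that assms by auto
    then show ?thesis using fin[OF that] by simp
  qed
  show ?thesis
    unfolding kept_mean_def sum_Pow_insert[OF assms] sum_distrib_left
    by (subst add.commute) (intro arg_cong2[where f="(+)"] sum.cong refl 1 2; assumption)
qed

lemma kept_mean_empty [simp]: "kept_mean {} s G = G {}"
  by (simp add: kept_mean_def)

lemma kept_mean_cong: "(\<And>A. A \<subseteq> F \<Longrightarrow> G A = G' A) \<Longrightarrow> kept_mean F s G = kept_mean F s G'"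
  unfolding kept_mean_def by (intro sum.cong) auto

lemma kept_mean_mono:
  assumes "0 \<le> s" "s \<le> 1" "\<And>A. A \<subseteq> F \<Longrightarrow> G A \<le> G' A"
  shows "kept_mean F s G \<le> kept_mean F s G'"
  unfolding kept_mean_def using assms by (intro sum_mono mult_left_mono) auto

lemma kept_mean_add: "kept_mean F s (\<lambda>A. G A + G' A) = kept_mean F s G + kept_mean F s G'"
  by (simp add: kept_mean_def distrib_left sum.distrib)

lemma kept_mean_diff: "kept_mean F s (\<lambda>A. G A - G' A) = kept_mean F s G - kept_mean F s G'"
  by (simp add: kept_mean_def right_diff_distrib sum_subtractf)

lemma kept_mean_cmult: "kept_mean F s (\<lambda>A. c * G A) = c * kept_mean F s G"
  by (simp add: kept_mean_def sum_distrib_left mult_ac)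

lemma kept_mean_sum: "kept_mean F s (\<lambda>A. \<Sum>i\<in>X. G i A) = (\<Sum>i\<in>X. kept_mean F s (G i))"
  unfolding kept_mean_def sum_distrib_left by (rule sum.swap)

lemma kept_mean_const: "finite F \<Longrightarrow> kept_mean F s (\<lambda>A. c) = c"
  by (induction F rule: finite_induct) (simp_all add: kept_mean_insert algebra_simps)

lemma kept_mean_0: "finite F \<Longrightarrow> kept_mean F 0 G = G {}"
  by (induction F rule: finite_induct) (simp_all add: kept_mean_insert)

text \<open>A set \<open>B\<close> lies inside the random kept set with probability
  \<open>s ^ card B\<close>.\<close>

lemma rsum_Pow_sum:
  assumes "finite F"
  shows "kept_mean F s (\<lambda>A. \<Sum>B\<in>Pow A. w B) = (\<Sum>B\<in>Pow F. w B * s ^ card B)"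
  using assms
proof (induction F arbitrary: w rule: finite_induct)
  case (insert e F)
  have fin: "finite A" if "A \<subseteq> F" for A using that insert.hyps finite_subset by auto
  have "kept_mean F s (\<lambda>A. \<Sum>B\<in>Pow (insert e A). w B) = kept_mean F s (\<lambda>A. \<Sum>B\<in>Pow A. w B) + kept_mean F s (\<lambda>A. \<Sum>B\<in>Pow A. w (insert e B))"
    unfolding kept_mean_add[symmetric] using insert.hyps fin
    by (intro kept_mean_cong sum_Pow_insert) auto
  then have "kept_mean (insert e F) s (\<lambda>A. \<Sum>B\<in>Pow A. w B) =
      (\<Sum>B\<in>Pow F. w B * s ^ card B) + s * (\<Sum>B\<in>Pow F. w (insert e B) * s ^ card B)"
    using insert.hyps by (simp add: kept_mean_insert insert.IH algebra_simps)
  also have "s * (\<Sum>B\<in>Pow F. w (insert e B) * s ^ card B) = (\<Sum>B\<in>Pow F. w (insert e B) * s ^ card (insert e B))"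
  proof -
    have "card (insert e B) = Suc (card B)" if "B \<in> Pow F" for B
      using that fin insert.hyps by (subst card_insert_disjoint) auto
    then show ?thesis unfolding sum_distrib_left by (intro sum.cong) auto
  qed
  finally show ?case by (simp only: sum_Pow_insert[OF insert.hyps])
qed simp

text \<open>Russo's formula. The difference between \<open>insert e A\<close> and
  \<open>A - {e}\<close> does not depend on whether \<open>A\<close> contains \<open>e\<close>, so
  the average may run over all of \<open>F\<close> instead of \<open>F - {e}\<close>.\<close>

lemma kept_mean_deriv:
  assumes "finite F"
  shows "((\<lambda>s. kept_mean F s G) has_real_derivative
     (\<Sum>e\<in>F. kept_mean F s (\<lambda>A. G (insert e A) - G (A - {e})))) (at s)"
  using assms
proof (induction F arbitrary: G rule: finite_induct)
  case (insert e F)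
  let ?d = "\<lambda>G. \<Sum>e'\<in>F. kept_mean F s (\<lambda>A. G (insert e' A) - G (A - {e'}))"
  have "((\<lambda>s. s * kept_mean F s (\<lambda>A. G (insert e A)) + (1 - s) * kept_mean F s G) has_real_derivative
     (1 * kept_mean F s (\<lambda>A. G (insert e A)) + ?d (\<lambda>A. G (insert e A)) * s
       + ((0 - 1) * kept_mean F s G + ?d G * (1 - s)))) (at s)"
    by (intro DERIV_add DERIV_mult DERIV_diff DERIV_ident DERIV_const insert.IH)
  then have 1: "((\<lambda>s. kept_mean (insert e F) s G) has_real_derivative
     (1 * kept_mean F s (\<lambda>A. G (insert e A)) + ?d (\<lambda>A. G (insert e A)) * s
       + ((0 - 1) * kept_mean F s G + ?d G * (1 - s)))) (at s)"
    by (simp add: kept_mean_insert[OF insert.hyps])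
  have "kept_mean (insert e F) s (\<lambda>A. G (insert e A) - G (A - {e})) = kept_mean F s (\<lambda>A. G (insert e A)) - kept_mean F s G"
  proof -
    have a: "kept_mean F s (\<lambda>A. G (insert e A) - G (A - {e})) = kept_mean F s (\<lambda>A. G (insert e A)) - kept_mean F s G"
      unfolding kept_mean_diff[symmetric]
    proof (rule kept_mean_cong)
      fix A assume "A \<subseteq> F"
      then have "A - {e} = A" using insert.hyps by auto
      then show "G (insert e A) - G (A - {e}) = G (insert e A) - G A" by simp
    qed
    have b: "kept_mean F s (\<lambda>A. G (insert e (insert e A)) - G (insert e A - {e})) = kept_mean F s (\<lambda>A. G (insert e A)) - kept_mean F s G"
      unfolding kept_mean_diff[symmetric]
    proof (rule kept_mean_cong)
      fix A assume "A \<subseteq> F"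
      then have "A - {e} = A" using insert.hyps by auto
      then show "G (insert e (insert e A)) - G (insert e A - {e}) = G (insert e A) - G A" by simp
    qed
    show ?thesis unfolding kept_mean_insert[OF insert.hyps] a b by (simp add: algebra_simps)
  qed
  moreover have "kept_mean (insert e F) s (\<lambda>A. G (insert e' A) - G (A - {e'})) =
     s * kept_mean F s (\<lambda>A. G (insert e (insert e' A)) - G (insert e (A - {e'})))
     + (1 - s) * kept_mean F s (\<lambda>A. G (insert e' A) - G (A - {e'}))" if "e' \<in> F" for e'
  proof -
    have "insert e A - {e'} = insert e (A - {e'})" for A using that insert.hyps by auto
    then show ?thesis by (simp add: kept_mean_insert[OF insert.hyps] insert_commute)
  qed
  ultimately have "(\<Sum>e'\<in>insert e F. kept_mean (insert e F) s (\<lambda>A. G (insert e' A) - G (A - {e'}))) =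
    1 * kept_mean F s (\<lambda>A. G (insert e A)) + ?d (\<lambda>A. G (insert e A)) * s
       + ((0 - 1) * kept_mean F s G + ?d G * (1 - s))"
    using insert.hyps by (simp add: sum.distrib sum_distrib_left mult.commute)
  then show ?case using 1 by simp
qed simp

section \<open>Flow of the exponential moment of the squared overlap\<close>

locale overlap_chaos = ising_resampling +
  assumes q_nonneg: "\<And>\<sigma> \<tau>. \<sigma> \<in> \<Omega> \<Longrightarrow> \<tau> \<in> \<Omega> \<Longrightarrow> 0 \<le> q \<sigma> \<tau>"
begin

abbreviation \<Phi> where "\<Phi> l \<equiv> \<lambda>\<sigma> \<tau>. exp (l * q \<sigma> \<tau>)"

lemma gibbs_mean_const: "gibbs_mean (\<lambda>\<sigma> \<tau>. c) g h = c"
  unfolding gibbs_mean_def by (simp add: sum_mu flip: sum_distrib_left)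

lemma gibbs_mean_add: "gibbs_mean (\<lambda>\<sigma> \<tau>. f \<sigma> \<tau> + f' \<sigma> \<tau>) g h = gibbs_mean f g h + gibbs_mean f' g h"
  unfolding gibbs_mean_def by (simp add: distrib_right sum.distrib)

lemma gibbs_mean_cmult: "gibbs_mean (\<lambda>\<sigma> \<tau>. c * f \<sigma> \<tau>) g h = c * gibbs_mean f g h"
  unfolding gibbs_mean_def by (simp add: sum_distrib_left mult.assoc)

lemma gibbs_mean_mono: "(\<And>\<sigma> \<tau>. \<sigma> \<in> \<Omega> \<Longrightarrow> \<tau> \<in> \<Omega> \<Longrightarrow> f \<sigma> \<tau> \<le> f' \<sigma> \<tau>) \<Longrightarrow> gibbs_mean f g h \<le> gibbs_mean f' g h"
  unfolding gibbs_mean_def by (intro sum_mono mult_right_mono mult_nonneg_nonneg mu_nonneg)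

lemma gibbs_mean_q: "gibbs_mean q g h = (\<Sum>e\<in>I. mag e g * mag e h)"
proof -
  have "gibbs_mean q g h = (\<Sum>\<sigma>\<in>\<Omega>. \<Sum>\<tau>\<in>\<Omega>. \<Sum>e\<in>I. (mu g \<sigma> * s e \<sigma>) * (mu h \<tau> * s e \<tau>))"
    unfolding gibbs_mean_def q_def sum_distrib_right by (intro sum.cong refl) (simp add: mult_ac)
  also have "\<dots> = (\<Sum>\<sigma>\<in>\<Omega>. \<Sum>e\<in>I. \<Sum>\<tau>\<in>\<Omega>. (mu g \<sigma> * s e \<sigma>) * (mu h \<tau> * s e \<tau>))"
    by (intro sum.cong refl sum.swap)
  also have "\<dots> = (\<Sum>e\<in>I. \<Sum>\<sigma>\<in>\<Omega>. \<Sum>\<tau>\<in>\<Omega>. (mu g \<sigma> * s e \<sigma>) * (mu h \<tau> * s e \<tau>))"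
    by (rule sum.swap)
  finally show ?thesis unfolding mag_def sum_product .
qed

text \<open>Chebyshev's association inequality: both factors are increasing functions of \<open>q\<close>.\<close>

lemma gibbs_mean_association:
  assumes l: "0 \<le> l"
  shows "gibbs_mean (\<Phi> l) g h * gibbs_mean q g h \<le> gibbs_mean (\<lambda>\<sigma> \<tau>. \<Phi> l \<sigma> \<tau> * q \<sigma> \<tau>) g h"
proof -
  define r where "r = gibbs_mean q g h"
  \<comment> \<open>The factors \<open>t - r\<close> and \<open>exp (l * t) - exp (l * r)\<close>
    have the same sign. As \<open>r\<close> is the mean of \<open>q\<close>, the left side averages
    to zero.\<close>
  have *: "exp (l * r) * (t - r) \<le> exp (l * t) * (t - r)" for t
  proof (cases "r \<le> t")
    case True then show ?thesis using l by (intro mult_right_mono) (auto intro: mult_left_mono)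
  next
    case False then show ?thesis using l by (intro mult_right_mono_neg) (auto intro: mult_left_mono)
  qed
  have "gibbs_mean (\<lambda>\<sigma> \<tau>. exp (l * r) * q \<sigma> \<tau> + - (exp (l * r) * r)) g h \<le>
      gibbs_mean (\<lambda>\<sigma> \<tau>. \<Phi> l \<sigma> \<tau> * q \<sigma> \<tau> + (- r) * \<Phi> l \<sigma> \<tau>) g h"
  proof (rule gibbs_mean_mono)
    show "exp (l * r) * q \<sigma> \<tau> + - (exp (l * r) * r) \<le> \<Phi> l \<sigma> \<tau> * q \<sigma> \<tau> + (- r) * \<Phi> l \<sigma> \<tau>" for \<sigma> \<tau>
      using *[of "q \<sigma> \<tau>"] by (simp add: algebra_simps)
  qed
  then show ?thesis unfolding gibbs_mean_add gibbs_mean_cmult gibbs_mean_const r_def[symmetric] by (simp add: mult.commute)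
qed

text \<open>In the expanded product of centred signs the two cross terms are averages of
  \<open>q\<close> over one replica. They are nonnegative and enter with a minus sign, which leaves
  \<open>q\<close> plus its Gibbs mean; association absorbs the latter into a second copy of the
  first term.\<close>

lemma sum_centred_mean_le:
  assumes l: "0 \<le> l"
  shows "(\<Sum>e\<in>I. centred_mean (\<Phi> l) e g h) \<le> 2 * gibbs_mean (\<lambda>\<sigma> \<tau>. \<Phi> l \<sigma> \<tau> * q \<sigma> \<tau>) g h"
proof -
  have pos: "0 \<le> (\<Sum>e\<in>I. mag e g * s e \<tau>)" if "\<tau> \<in> \<Omega>" for g \<tau>
  proof -
    have "(\<Sum>e\<in>I. mag e g * s e \<tau>) = (\<Sum>\<sigma>\<in>\<Omega>. mu g \<sigma> * q \<sigma> \<tau>)"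
      unfolding mag_def q_def sum_distrib_left sum_distrib_right
      by (subst sum.swap) (simp add: mult.assoc)
    also have "\<dots> \<ge> 0" using that by (intro sum_nonneg mult_nonneg_nonneg mu_nonneg q_nonneg)
    finally show ?thesis .
  qed
  have bound: "(\<Sum>e\<in>I. (s e \<sigma> - mag e g) * (s e \<tau> - mag e h)) \<le> q \<sigma> \<tau> + gibbs_mean q g h"
    if "\<sigma> \<in> \<Omega>" "\<tau> \<in> \<Omega>" for \<sigma> \<tau>
  proof -
    have "(\<Sum>e\<in>I. (s e \<sigma> - mag e g) * (s e \<tau> - mag e h)) =
      q \<sigma> \<tau> - (\<Sum>e\<in>I. mag e g * s e \<tau>) - (\<Sum>e\<in>I. mag e h * s e \<sigma>) + gibbs_mean q g h"
      unfolding gibbs_mean_q q_def by (simp add: algebra_simps sum.distrib sum_subtractf)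
    then show ?thesis using pos[OF that(1), of h] pos[OF that(2), of g] by linarith
  qed
  have "(\<Sum>e\<in>I. centred_mean (\<Phi> l) e g h) = (\<Sum>\<sigma>\<in>\<Omega>. \<Sum>\<tau>\<in>\<Omega>. \<Sum>e\<in>I.
      \<Phi> l \<sigma> \<tau> * ((mu g \<sigma> * (s e \<sigma> - mag e g)) * (mu h \<tau> * (s e \<tau> - mag e h))))"
    unfolding centred_mean_def by (subst sum.swap, intro sum.cong refl sum.swap)
  also have "\<dots> = gibbs_mean (\<lambda>\<sigma> \<tau>. \<Phi> l \<sigma> \<tau> * (\<Sum>e\<in>I. (s e \<sigma> - mag e g) * (s e \<tau> - mag e h))) g h"
    unfolding gibbs_mean_def sum_distrib_left sum_distrib_right by (intro sum.cong refl) (simp only: mult_ac)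
  also have "\<dots> \<le> gibbs_mean (\<lambda>\<sigma> \<tau>. \<Phi> l \<sigma> \<tau> * (q \<sigma> \<tau> + gibbs_mean q g h)) g h"
    by (intro gibbs_mean_mono mult_left_mono bound) auto
  also have "\<dots> = gibbs_mean (\<lambda>\<sigma> \<tau>. \<Phi> l \<sigma> \<tau> * q \<sigma> \<tau> + gibbs_mean q g h * \<Phi> l \<sigma> \<tau>) g h"
    by (simp only: distrib_left mult.commute)
  also have "\<dots> = gibbs_mean (\<lambda>\<sigma> \<tau>. \<Phi> l \<sigma> \<tau> * q \<sigma> \<tau>) g h + gibbs_mean (\<Phi> l) g h * gibbs_mean q g h"
    unfolding gibbs_mean_add gibbs_mean_cmult by simp
  finally show ?thesis using gibbs_mean_association[OF l, of g h] by linarith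
qed

text \<open>The law of the two replicas with the couplings averaged out. It separates the dependence
  on the shared set from that on \<open>l\<close>, so the flow can be differentiated in each
  factor.\<close>

definition joint :: "'a \<Rightarrow> 'a \<Rightarrow> (nat \<times> nat) set \<Rightarrow> real" where
  "joint \<sigma> \<tau> A = pair_mean A (\<lambda>g h. mu g \<sigma> * mu h \<tau>)"

lemma pair_mean_gibbs_mean: "pair_mean A (gibbs_mean f) = (\<Sum>\<sigma>\<in>\<Omega>. \<Sum>\<tau>\<in>\<Omega>. f \<sigma> \<tau> * joint \<sigma> \<tau> A)"
  unfolding gibbs_mean_def[abs_def] joint_def
  by (subst pair_mean_sum pair_mean_cmult; intro bm2_lin bm1_mu sum.cong refl | assumption)+

definition err :: real where "err = 112 * exp_const\<^sup>2 * a ^ 3 * card I"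

text \<open>The left side is the derivative from \<open>kept_mean_deriv\<close>. Summing
  \<open>key_step\<close> over the couplings brings in centred means, and
  \<open>sum_centred_mean_le\<close> turns these into
  \<open>\<Phi> l \<sigma> \<tau> * q \<sigma> \<tau>\<close>, the derivative of
  \<open>\<Phi> l\<close> in \<open>l\<close>.\<close>

lemma flow_bound:
  assumes l: "0 \<le> l" and t: "0 \<le> t" "t \<le> 1"
  shows "(\<Sum>e\<in>I. kept_mean I t (\<lambda>A. pair_mean (insert e A) (gibbs_mean (\<Phi> l)) - pair_mean (A - {e}) (gibbs_mean (\<Phi> l))))
     \<le> 2 * a\<^sup>2 * kept_mean I t (\<lambda>A. pair_mean A (gibbs_mean (\<lambda>\<sigma> \<tau>. \<Phi> l \<sigma> \<tau> * q \<sigma> \<tau>))) + err * kept_mean I t (\<lambda>A. pair_mean A (gibbs_mean (\<Phi> l)))"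
proof -
  let ?c = "112 * exp_const\<^sup>2 * a ^ 3"
  have "(\<Sum>e\<in>I. kept_mean I t (\<lambda>A. pair_mean (insert e A) (gibbs_mean (\<Phi> l)) - pair_mean (A - {e}) (gibbs_mean (\<Phi> l))))
     \<le> (\<Sum>e\<in>I. kept_mean I t (\<lambda>A. a\<^sup>2 * pair_mean A (centred_mean (\<Phi> l) e) + ?c * pair_mean A (gibbs_mean (\<Phi> l))))"
  proof (intro sum_mono kept_mean_mono t)
    fix e A assume e: "e \<in> I"
    show "pair_mean (insert e A) (gibbs_mean (\<Phi> l)) - pair_mean (A - {e}) (gibbs_mean (\<Phi> l)) \<le> a\<^sup>2 * pair_mean A (centred_mean (\<Phi> l) e) + ?c * pair_mean A (gibbs_mean (\<Phi> l))"
    \<comment> \<open>The two forms of \<open>key_step\<close> let the right side be evaluated at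
      \<open>A\<close> itself in either case.\<close>
    proof (cases "e \<in> A")
      case True
      then show ?thesis using key_step(1)[OF e, of "\<Phi> l" A] by (simp add: insert_absorb)
    next
      case False
      then show ?thesis using key_step(2)[OF e, of "\<Phi> l" A] by simp
    qed
  qed
  also have "\<dots> = kept_mean I t (\<lambda>A. a\<^sup>2 * (\<Sum>e\<in>I. pair_mean A (centred_mean (\<Phi> l) e)) + err * pair_mean A (gibbs_mean (\<Phi> l)))"
    unfolding kept_mean_sum[symmetric] by (simp add: sum.distrib sum_distrib_left err_def mult_ac)
  also have "\<dots> \<le> kept_mean I t (\<lambda>A. a\<^sup>2 * (2 * pair_mean A (gibbs_mean (\<lambda>\<sigma> \<tau>. \<Phi> l \<sigma> \<tau> * q \<sigma> \<tau>))) + err * pair_mean A (gibbs_mean (\<Phi> l)))"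
  proof (intro kept_mean_mono t add_right_mono mult_left_mono)
    fix A
    have "(\<Sum>e\<in>I. pair_mean A (centred_mean (\<Phi> l) e)) = pair_mean A (\<lambda>g h. \<Sum>e\<in>I. centred_mean (\<Phi> l) e g h)"
      by (intro pair_mean_sum[symmetric] bm2_centred_mean)
    also have "\<dots> \<le> pair_mean A (\<lambda>g h. 2 * gibbs_mean (\<lambda>\<sigma> \<tau>. \<Phi> l \<sigma> \<tau> * q \<sigma> \<tau>) g h)"
      by (intro pair_mean_mono bm2_lin bm2_centred_mean bm2_gibbs_mean sum_centred_mean_le l)
    also have "\<dots> = 2 * pair_mean A (gibbs_mean (\<lambda>\<sigma> \<tau>. \<Phi> l \<sigma> \<tau> * q \<sigma> \<tau>))"
      by (intro pair_mean_cmult bm2_gibbs_mean)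
    finally show "(\<Sum>e\<in>I. pair_mean A (centred_mean (\<Phi> l) e)) \<le> \<dots>" .
  qed simp
  also have "\<dots> = 2 * a\<^sup>2 * kept_mean I t (\<lambda>A. pair_mean A (gibbs_mean (\<lambda>\<sigma> \<tau>. \<Phi> l \<sigma> \<tau> * q \<sigma> \<tau>))) + err * kept_mean I t (\<lambda>A. pair_mean A (gibbs_mean (\<Phi> l)))"
    unfolding kept_mean_add kept_mean_cmult by simp
  finally show ?thesis .
qed

text \<open>By \<open>flow_bound\<close>, the exponential moment is, up to the factor \<open>exp (err * t)\<close>, nonincreasing along the
  characteristics \<open>l + 2 a\<^sup>2 t = const\<close> of the transport equation \<open>\<partial>\<^sub>t = 2 a\<^sup>2 \<partial>\<^sub>l\<close>.\<close>

lemma exp_overlap_flow: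
  assumes l0: "0 \<le> l0" and s0: "0 \<le> s0" "s0 \<le> 1"
  shows "kept_mean I s0 (\<lambda>A. pair_mean A (gibbs_mean (\<Phi> l0))) \<le> exp (err * s0) * pair_mean {} (gibbs_mean (\<Phi> (l0 + 2 * a\<^sup>2 * s0)))"
proof -
  \<comment> \<open>The characteristic that ends in \<open>l0\<close> at time \<open>s0\<close>; it
    starts from \<open>l0 + 2 * a\<^sup>2 * s0\<close> at time 0, where nothing is shared.\<close>
  define l where "l t = l0 + 2 * a\<^sup>2 * (s0 - t)" for t
  define Y where "Y t = kept_mean I t (\<lambda>A. pair_mean A (gibbs_mean (\<Phi> (l t))))" for t
  define Y' where "Y' t = (\<Sum>e\<in>I. kept_mean I t (\<lambda>A. pair_mean (insert e A) (gibbs_mean (\<Phi> (l t))) - pair_mean (A - {e}) (gibbs_mean (\<Phi> (l t)))))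
      - 2 * a\<^sup>2 * kept_mean I t (\<lambda>A. pair_mean A (gibbs_mean (\<lambda>\<sigma> \<tau>. \<Phi> (l t) \<sigma> \<tau> * q \<sigma> \<tau>)))" for t
  have Y: "Y t = (\<Sum>\<sigma>\<in>\<Omega>. \<Sum>\<tau>\<in>\<Omega>. exp (l t * q \<sigma> \<tau>) * kept_mean I t (joint \<sigma> \<tau>))" for t
    unfolding Y_def pair_mean_gibbs_mean kept_mean_sum kept_mean_cmult by simp
  have dY: "(Y has_real_derivative Y' t) (at t)" for t
  proof -
    have dl: "(l has_real_derivative - (2 * a\<^sup>2)) (at t)"
      unfolding l_def[abs_def] by (auto intro!: derivative_eq_intros)
    have "((\<lambda>t. exp (l t * q \<sigma> \<tau>) * kept_mean I t (joint \<sigma> \<tau>)) has_real_derivative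
       exp (l t * q \<sigma> \<tau>) * (- (2 * a\<^sup>2) * q \<sigma> \<tau>) * kept_mean I t (joint \<sigma> \<tau>) +
       (\<Sum>e\<in>I. kept_mean I t (\<lambda>A. joint \<sigma> \<tau> (insert e A) - joint \<sigma> \<tau> (A - {e}))) * exp (l t * q \<sigma> \<tau>)) (at t)" for \<sigma> \<tau>
      by (intro DERIV_mult kept_mean_deriv fin DERIV_fun_exp DERIV_cmult_right dl)
    then have "(Y has_real_derivative (\<Sum>\<sigma>\<in>\<Omega>. \<Sum>\<tau>\<in>\<Omega>. exp (l t * q \<sigma> \<tau>) * (- (2 * a\<^sup>2) * q \<sigma> \<tau>) * kept_mean I t (joint \<sigma> \<tau>) +
       (\<Sum>e\<in>I. kept_mean I t (\<lambda>A. joint \<sigma> \<tau> (insert e A) - joint \<sigma> \<tau> (A - {e}))) * exp (l t * q \<sigma> \<tau>))) (at t)"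
      unfolding Y by (intro DERIV_sum)
    also have "(\<Sum>\<sigma>\<in>\<Omega>. \<Sum>\<tau>\<in>\<Omega>. exp (l t * q \<sigma> \<tau>) * (- (2 * a\<^sup>2) * q \<sigma> \<tau>) * kept_mean I t (joint \<sigma> \<tau>) +
       (\<Sum>e\<in>I. kept_mean I t (\<lambda>A. joint \<sigma> \<tau> (insert e A) - joint \<sigma> \<tau> (A - {e}))) * exp (l t * q \<sigma> \<tau>)) =
       (\<Sum>\<sigma>\<in>\<Omega>. \<Sum>\<tau>\<in>\<Omega>. \<Sum>e\<in>I. exp (l t * q \<sigma> \<tau>) * kept_mean I t (\<lambda>A. joint \<sigma> \<tau> (insert e A) - joint \<sigma> \<tau> (A - {e})))
       - 2 * a\<^sup>2 * (\<Sum>\<sigma>\<in>\<Omega>. \<Sum>\<tau>\<in>\<Omega>. exp (l t * q \<sigma> \<tau>) * q \<sigma> \<tau> * kept_mean I t (joint \<sigma> \<tau>))"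
      by (simp add: sum_distrib_left sum_distrib_right sum_subtractf[symmetric] mult_ac)
    also have "(\<Sum>\<sigma>\<in>\<Omega>. \<Sum>\<tau>\<in>\<Omega>. \<Sum>e\<in>I. exp (l t * q \<sigma> \<tau>) * kept_mean I t (\<lambda>A. joint \<sigma> \<tau> (insert e A) - joint \<sigma> \<tau> (A - {e})))
      = (\<Sum>e\<in>I. \<Sum>\<sigma>\<in>\<Omega>. \<Sum>\<tau>\<in>\<Omega>. exp (l t * q \<sigma> \<tau>) * kept_mean I t (\<lambda>A. joint \<sigma> \<tau> (insert e A) - joint \<sigma> \<tau> (A - {e})))"
      by (rule trans[OF sum.cong[OF refl sum.swap] sum.swap])
    also have "\<dots> - 2 * a\<^sup>2 * (\<Sum>\<sigma>\<in>\<Omega>. \<Sum>\<tau>\<in>\<Omega>. exp (l t * q \<sigma> \<tau>) * q \<sigma> \<tau> * kept_mean I t (joint \<sigma> \<tau>)) = Y' t"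
      unfolding Y'_def pair_mean_gibbs_mean kept_mean_diff kept_mean_sum kept_mean_cmult by (simp add: sum_subtractf right_diff_distrib)
    finally show ?thesis .
  qed
  \<comment> \<open>Gronwall's argument: along the characteristic the two terms with
    \<open>q\<close> cancel, so \<open>Y' t \<le> err * Y t\<close>.\<close>
  have "exp (- err * s0) * Y s0 \<le> exp (- err * 0) * Y 0"
  proof (rule DERIV_nonpos_imp_nonincreasing[OF s0(1)])
    fix t assume t: "0 \<le> t" "t \<le> s0"
    have "0 \<le> l t" using l0 t by (simp add: l_def)
    then have "Y' t \<le> err * Y t"
      using flow_bound[of "l t" t] t s0 by (simp add: Y'_def Y_def)
    then have "exp (- err * t) * Y' t \<le> exp (- err * t) * (err * Y t)" by (intro mult_left_mono) auto
    moreover have "((\<lambda>t. exp (- err * t) * Y t) has_real_derivative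
       exp (- err * t) * (- err * 1) * Y t + Y' t * exp (- err * t)) (at t)"
      by (intro DERIV_mult dY DERIV_fun_exp DERIV_cmult DERIV_ident)
    ultimately show "\<exists>y. ((\<lambda>t. exp (- err * t) * Y t) has_real_derivative y) (at t) \<and> y \<le> 0"
      by (intro exI[of _ "exp (- err * t) * (- err * 1) * Y t + Y' t * exp (- err * t)"]) (simp add: algebra_simps)
  qed
  then have "exp (err * s0) * (exp (- err * s0) * Y s0) \<le> exp (err * s0) * Y 0"
    by (intro mult_left_mono) auto
  then have "Y s0 \<le> exp (err * s0) * Y 0"
    by (simp add: mult.assoc[symmetric] mult_exp_exp)
  then show ?thesis using fin by (simp add: Y_def l_def kept_mean_0)
qed

text \<open>Jensen's inequality in tangent form, \<open>exp x \<ge> exp k * (1 + x - k)\<close>,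
  which is affine in \<open>x\<close> and so passes through the Gibbs, coupling and subset averages
  in turn. The tangent point \<open>k\<close> is the logarithm of the final upper bound, so
  \<open>exp k\<close> cancels.\<close>

lemma overlap_at_strong_noise:
  assumes l0: "0 \<le> l0" and s0: "0 \<le> s0" "s0 \<le> 1"
    and init: "pair_mean {} (gibbs_mean (\<Phi> (l0 + 2 * a\<^sup>2 * s0))) \<le> exp b"
  shows "l0 * kept_mean I s0 (\<lambda>A. pair_mean A (gibbs_mean q)) \<le> err * s0 + b"
proof -
  define k where "k = err * s0 + b"
  have "exp k * (1 - k) + exp k * l0 * kept_mean I s0 (\<lambda>A. pair_mean A (gibbs_mean q)) = kept_mean I s0 (\<lambda>A. exp k * (1 - k) + exp k * l0 * pair_mean A (gibbs_mean q))"
    unfolding kept_mean_add kept_mean_cmult kept_mean_const[OF fin] ..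
  also have "\<dots> \<le> kept_mean I s0 (\<lambda>A. pair_mean A (gibbs_mean (\<Phi> l0)))"
  proof (intro kept_mean_mono s0)
    fix A
    have "exp k * (1 - k) + exp k * l0 * pair_mean A (gibbs_mean q) = pair_mean A (\<lambda>g h. exp k * (1 - k) + exp k * l0 * gibbs_mean q g h)"
      by (simp only: pair_mean_add pair_mean_cmult pair_mean_const bm2_lin bm2_gibbs_mean)
    also have "\<dots> \<le> pair_mean A (gibbs_mean (\<Phi> l0))"
    proof (intro pair_mean_mono bm2_lin bm2_gibbs_mean)
      fix g h
      have "exp k * (1 - k) + exp k * l0 * gibbs_mean q g h = gibbs_mean (\<lambda>\<sigma> \<tau>. exp k * (1 - k) + exp k * l0 * q \<sigma> \<tau>) g h"
        unfolding gibbs_mean_add gibbs_mean_cmult gibbs_mean_const ..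
      also have "\<dots> \<le> gibbs_mean (\<Phi> l0) g h"
      proof (rule gibbs_mean_mono)
        fix \<sigma> \<tau>
        have "exp k * (1 + (l0 * q \<sigma> \<tau> - k)) \<le> exp k * exp (l0 * q \<sigma> \<tau> - k)"
          by (intro mult_left_mono exp_ge_add_one_self) auto
        then show "exp k * (1 - k) + exp k * l0 * q \<sigma> \<tau> \<le> exp (l0 * q \<sigma> \<tau>)"
          by (simp add: mult_exp_exp algebra_simps)
      qed
      finally show "exp k * (1 - k) + exp k * l0 * gibbs_mean q g h \<le> gibbs_mean (\<Phi> l0) g h" .
    qed
    finally show "exp k * (1 - k) + exp k * l0 * pair_mean A (gibbs_mean q) \<le> pair_mean A (gibbs_mean (\<Phi> l0))" .
  qed
  also have "\<dots> \<le> exp (err * s0) * pair_mean {} (gibbs_mean (\<Phi> (l0 + 2 * a\<^sup>2 * s0)))" by (rule exp_overlap_flow[OF l0 s0])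
  also have "\<dots> \<le> exp (err * s0) * exp b" using init by (intro mult_left_mono) auto
  also have "\<dots> = exp k" by (simp add: k_def exp_add)
  finally have "exp k * (1 - k + l0 * kept_mean I s0 (\<lambda>A. pair_mean A (gibbs_mean q))) \<le> exp k * 1"
    by (simp add: algebra_simps)
  then have "1 - k + l0 * kept_mean I s0 (\<lambda>A. pair_mean A (gibbs_mean q)) \<le> 1" by (subst (asm) mult_le_cancel_left_pos) auto
  then show ?thesis by (simp add: k_def)
qed

text \<open>By \<open>gibbs_mean_q\<close> the mean of \<open>q\<close> is a sum of products
  \<open>mag e g * mag e h\<close>; each has nonnegative weights by \<open>anova\<close>, and these
  add up.\<close>

lemma overlap_spectrum:
  obtains w where "\<And>B. 0 \<le> w B" "\<And>A. A \<subseteq> I \<Longrightarrow> pair_mean A (gibbs_mean q) = (\<Sum>B\<in>Pow A. w B)"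
proof -
  have "\<forall>e. \<exists>w. (\<forall>B. 0 \<le> w B) \<and> (\<forall>A\<subseteq>I. pair_mean A (\<lambda>g h. mag e g * mag e h) = (\<Sum>B\<in>Pow A. w B))"
    using anova[OF bm1_mag] by metis
  then obtain w where w: "\<And>e B. 0 \<le> w e B"
    "\<And>e A. A \<subseteq> I \<Longrightarrow> pair_mean A (\<lambda>g h. mag e g * mag e h) = (\<Sum>B\<in>Pow A. w e B)" by metis
  show ?thesis
  proof (rule that[of "\<lambda>B. \<Sum>e\<in>I. w e B"])
    show "0 \<le> (\<Sum>e\<in>I. w e B)" for B by (intro sum_nonneg w)
    fix A assume A: "A \<subseteq> I"
    have "pair_mean A (gibbs_mean q) = pair_mean A (\<lambda>g h. \<Sum>e\<in>I. mag e g * mag e h)"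
      by (rule pair_mean_cong) (rule gibbs_mean_q)
    also have "\<dots> = (\<Sum>e\<in>I. pair_mean A (\<lambda>g h. mag e g * mag e h))"
      by (intro pair_mean_sum bm2_lin bm1_mag)
    also have "\<dots> = (\<Sum>B\<in>Pow A. \<Sum>e\<in>I. w e B)"
      using A by (simp add: w) (rule sum.swap)
    finally show "pair_mean A (gibbs_mean q) = (\<Sum>B\<in>Pow A. \<Sum>e\<in>I. w e B)" .
  qed
qed

end

subsection \<open>Random subsets and random signs\<close>

text \<open>Removing one element from a set of size \<open>m\<close>, with
  \<open>k \<le> m \<le> n\<close>, multiplies the number of \<open>k\<close>-subsets by
  \<open>1 - k / m\<close>, which is at most \<open>1 - k / n\<close>. For \<open>k > m\<close> the
  count is zero.\<close>

lemma binomial_avoid_bound: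
  assumes "0 < n" "b \<le> n" "k \<le> n"
  shows "real ((n - b) choose k) \<le> (1 - real k / real n) ^ b * real (n choose k)"
  using assms(2)
proof (induction b)
  case (Suc b)
  define m where "m = n - b"
  have m: "0 < m" "m \<le> n" using Suc.prems by (auto simp: m_def)
  have "real ((m - 1) choose k) \<le> (1 - real k / real n) * real (m choose k)"
  proof (cases "k \<le> m")
    case True
    have "real (m - k) * real (m choose k) = real m * real ((m - 1) choose k)"
      using binomial_absorb_comp[of m k] by (simp only: flip: of_nat_mult)
    then have "real ((m - 1) choose k) = (1 - real k / real m) * real (m choose k)"
      using m True by (simp add: field_simps of_nat_diff)
    also have "\<dots> \<le> (1 - real k / real n) * real (m choose k)"
      using m by (intro mult_right_mono diff_left_mono divide_left_mono) auto
    finally show ?thesis .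
  next
    case False
    then show ?thesis using m by (simp add: binomial_eq_0)
  qed
  also have "\<dots> \<le> (1 - real k / real n) * ((1 - real k / real n) ^ b * real (n choose k))"
    using Suc assms by (intro mult_left_mono) (auto simp: m_def)
  finally show ?case by (simp add: m_def mult.assoc)
qed simp

lemma random_subset_avoid:
  assumes "finite I" "B \<subseteq> I" "k \<le> card I" "0 < card I"
  shows "real (card {S. S \<subseteq> I \<and> card S = k \<and> B \<subseteq> I - S})
    \<le> exp (- (real k / real (card I)) * real (card B)) * real (card I choose k)"
proof -
  have "{S. S \<subseteq> I \<and> card S = k \<and> B \<subseteq> I - S} = {S. S \<subseteq> I - B \<and> card S = k}"
    using assms(2) by auto
  then have "real (card {S. S \<subseteq> I \<and> card S = k \<and> B \<subseteq> I - S}) = real ((card I - card B) choose k)"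
    using assms by (simp add: n_subsets card_Diff_subset finite_subset)
  also have "\<dots> \<le> (1 - real k / real (card I)) ^ card B * real (card I choose k)"
    using assms by (intro binomial_avoid_bound card_mono)
  also have "\<dots> \<le> exp (- (real k / real (card I))) ^ card B * real (card I choose k)"
    using assms exp_ge_add_one_self[of "- (real k / real (card I))"]
    by (intro mult_right_mono power_mono) (auto simp: divide_le_eq_1)
  finally show ?thesis by (simp add: exp_of_nat_mult[symmetric] mult.commute)
qed

text \<open>Splits the spectrum at level \<open>m\<close>: low levels are controlled by the noise level \<open>s\<close>,
  high levels are damped by the random subset.\<close>

lemma random_subset_average:
  fixes w :: "'e set \<Rightarrow> real"
  assumes I: "finite I" "0 < card I" "k \<le> card I" and w: "\<And>B. 0 \<le> w B" and s: "0 < s" "s \<le> 1" and m: "0 \<le> m"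
  shows "(\<Sum>S\<in>{S. S \<subseteq> I \<and> card S = k}. \<Sum>B\<in>Pow (I - S). w B) \<le> real (card I choose k) *
    (s powr (- m) * (\<Sum>B\<in>Pow I. w B * s ^ card B) + exp (- (real k / real (card I)) * m) * (\<Sum>B\<in>Pow I. w B))"
proof -
  let ?p = "real k / real (card I)" and ?c = "real (card I choose k)"
  have "(\<Sum>S\<in>{S. S \<subseteq> I \<and> card S = k}. \<Sum>B\<in>Pow (I - S). w B) =
     (\<Sum>S\<in>{S. S \<subseteq> I \<and> card S = k}. \<Sum>B\<in>{B\<in>Pow I. B \<subseteq> I - S}. w B)"
    by (intro sum.cong refl) auto
  also have "\<dots> = (\<Sum>B\<in>Pow I. \<Sum>S\<in>{S\<in>{S. S \<subseteq> I \<and> card S = k}. B \<subseteq> I - S}. w B)"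
    using I by (intro sum.swap_restrict) auto
  also have "\<dots> = (\<Sum>B\<in>Pow I. real (card {S. S \<subseteq> I \<and> card S = k \<and> B \<subseteq> I - S}) * w B)"
    by (simp add: conj_assoc)
  also have "\<dots> \<le> (\<Sum>B\<in>Pow I. ?c * (s powr (- m) * (w B * s ^ card B) + exp (- ?p * m) * w B))"
  proof (rule sum_mono)
    fix B assume B: "B \<in> Pow I"
    have "real (card {S. S \<subseteq> I \<and> card S = k \<and> B \<subseteq> I - S}) * w B \<le> exp (- ?p * real (card B)) * ?c * w B"
      using B I by (intro mult_right_mono random_subset_avoid w) auto
    also have "\<dots> \<le> (s powr (- m) * s ^ card B + exp (- ?p * m)) * ?c * w B"
    proof (intro mult_right_mono w)
      show "exp (- ?p * real (card B)) \<le> s powr (- m) * s ^ card B + exp (- ?p * m)"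
      proof (cases "real (card B) \<le> m")
        case True
        have "exp (- ?p * real (card B)) \<le> 1" by simp
        also have "1 \<le> s powr (real (card B) - m)"
          using s True powr_mono'[of "real (card B) - m" 0 s] by simp
        also have "\<dots> = s powr (- m) * s ^ card B"
          using s by (simp add: powr_realpow[symmetric] flip: powr_add)
        finally show ?thesis by (simp add: add_increasing2)
      next
        case False
        then have "exp (- ?p * real (card B)) \<le> exp (- ?p * m)"
          by (simp add: mult_left_mono divide_right_mono)
        then show ?thesis using s by (simp add: add_increasing)
      qed
    qed simp
    finally show "real (card {S. S \<subseteq> I \<and> card S = k \<and> B \<subseteq> I - S}) * w B \<le>
        ?c * (s powr (- m) * (w B * s ^ card B) + exp (- ?p * m) * w B)"
      by (simp add: algebra_simps)
  qed
  also have "\<dots> = ?c * (s powr (- m) * (\<Sum>B\<in>Pow I. w B * s ^ card B) + exp (- ?p * m) * (\<Sum>B\<in>Pow I. w B))"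
    by (simp only: sum_distrib_left sum.distrib distrib_left)
  finally show ?thesis .
qed

section \<open>Exponential moments of squared sums of signs\<close>

lemma cosh_le_exp_square: "cosh u \<le> exp (u\<^sup>2 / 2)" for u :: real
proof -
  have *: "cosh v \<le> exp (v\<^sup>2 / 2)" if v: "0 \<le> v" for v :: real
  proof -
    have "(\<lambda>x. exp (- (x\<^sup>2 / 2)) * cosh x) v \<le> (\<lambda>x. exp (- (x\<^sup>2 / 2)) * cosh x) 0"
    proof (rule DERIV_nonpos_imp_nonincreasing[OF v])
      fix x :: real assume "0 \<le> x" "x \<le> v"
      then have "exp (- (x\<^sup>2 / 2)) * (sinh x - x * cosh x) \<le> 0"
        using sinh_le_mult_cosh[of x] by (intro mult_nonneg_nonpos) auto
      moreover have "((\<lambda>x. exp (- (x\<^sup>2 / 2)) * cosh x) has_real_derivative exp (- (x\<^sup>2 / 2)) * (sinh x - x * cosh x)) (at x)"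
        by (auto intro!: derivative_eq_intros simp: algebra_simps)
      ultimately show "\<exists>y. ((\<lambda>x. exp (- (x\<^sup>2 / 2)) * cosh x) has_real_derivative y) (at x) \<and> y \<le> 0"
        by blast
    qed
    then show ?thesis by (simp add: exp_minus field_simps)
  qed
  show ?thesis using *[of "\<bar>u\<bar>"] by simp
qed

text \<open>Signs are summed out one at a time. Averaging over one sign costs a factor
  \<open>exp l\<close> and raises \<open>l\<close> to at most \<open>l + 2 * l\<^sup>2\<close>, so
  \<open>1 / l\<close> drops by at most 2. The hypothesis pays for that drop over all of
  \<open>J\<close> and keeps \<open>l \<le> 1 / (2 * c)\<close> throughout.\<close>

lemma sum_signs_exp_square:
  assumes "finite J" "0 < c" "0 \<le> l" "l * (2 * real (card J) + 2 * c) \<le> 1"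
  shows "(\<Sum>\<epsilon>\<in>PiE J (\<lambda>_. {-1, 1}). exp (l * (\<Sum>i\<in>J. \<epsilon> i)\<^sup>2)) \<le> 2 ^ card J * exp (real (card J) / (2 * c))"
  using assms
proof (induction J arbitrary: l rule: finite_induct)
  case (insert x J)
  let ?P = "PiE J (\<lambda>_. {-1, 1}) :: ('a \<Rightarrow> real) set"
  define l' where "l' = l + 2 * l\<^sup>2"
  define D where "D = 2 * real (card J) + 2 * c"
  have lD: "l * (D + 2) \<le> 1" using insert by (simp add: D_def algebra_simps)
  have "l' * D = l * (D + 2) * (1 + 2 * l) - 2 * l * (1 + 2 * l)"
    by (simp add: l'_def power2_eq_square algebra_simps)
  also have "\<dots> \<le> 1 * (1 + 2 * l) - 2 * l * (1 + 2 * l)"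
    using lD insert by (intro diff_right_mono mult_right_mono) auto
  also have "\<dots> \<le> 1" using insert by (simp add: algebra_simps)
  finally have l'D: "l' * D \<le> 1" .
  have "l * (2 * c) \<le> l * (D + 2)" using insert by (intro mult_left_mono) (auto simp: D_def)
  then have lc: "l \<le> 1 / (2 * c)" using lD insert by (simp add: field_simps)
  have step: "exp (l * (S + 1)\<^sup>2) + exp (l * (S - 1)\<^sup>2) \<le> 2 * exp (1 / (2 * c)) * exp (l' * S\<^sup>2)" for S
  proof -
    have "exp (l * (S + 1)\<^sup>2) + exp (l * (S - 1)\<^sup>2) = exp (l + l * S\<^sup>2) * (2 * cosh (2 * l * S))"
      by (simp add: cosh_field_def power2_eq_square algebra_simps flip: exp_add)
    also have "\<dots> \<le> exp (l + l * S\<^sup>2) * (2 * exp ((2 * l * S)\<^sup>2 / 2))"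
      by (intro mult_left_mono cosh_le_exp_square) auto
    also have "\<dots> = 2 * exp l * exp (l' * S\<^sup>2)"
      by (simp add: l'_def power2_eq_square algebra_simps flip: exp_add)
    also have "\<dots> \<le> 2 * exp (1 / (2 * c)) * exp (l' * S\<^sup>2)"
      using lc by (intro mult_right_mono mult_left_mono) auto
    finally show ?thesis .
  qed
  have S: "(\<Sum>i\<in>insert x J. (\<epsilon>(x := y)) i) = (\<Sum>i\<in>J. \<epsilon> i) + y" for \<epsilon> :: "'a \<Rightarrow> real" and y
  proof -
    have "(\<Sum>i\<in>J. (\<epsilon>(x := y)) i) = (\<Sum>i\<in>J. \<epsilon> i)" using insert.hyps by (intro sum.cong) auto
    then show ?thesis using insert.hyps by simp
  qed
  have "(\<Sum>\<epsilon>\<in>PiE (insert x J) (\<lambda>_. {-1, 1}). exp (l * (\<Sum>i\<in>insert x J. \<epsilon> i)\<^sup>2)) =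
    (\<Sum>(y, \<epsilon>)\<in>{-1, 1} \<times> ?P. exp (l * (\<Sum>i\<in>insert x J. (\<epsilon>(x := y)) i)\<^sup>2))"
    unfolding PiE_insert_eq using inj_combinator[OF insert.hyps(2), of "\<lambda>_. {-1, 1}"]
    by (subst sum.reindex) (auto simp: case_prod_beta)
  also have "\<dots> = (\<Sum>y\<in>{-1, 1}. \<Sum>\<epsilon>\<in>?P. exp (l * ((\<Sum>i\<in>J. \<epsilon> i) + y)\<^sup>2))"
    unfolding S by (rule sum.cartesian_product[symmetric])
  also have "\<dots> = (\<Sum>\<epsilon>\<in>?P. exp (l * ((\<Sum>i\<in>J. \<epsilon> i) + 1)\<^sup>2) + exp (l * ((\<Sum>i\<in>J. \<epsilon> i) - 1)\<^sup>2))"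
    by (simp add: sum.distrib)
  also have "\<dots> \<le> (\<Sum>\<epsilon>\<in>?P. 2 * exp (1 / (2 * c)) * exp (l' * (\<Sum>i\<in>J. \<epsilon> i)\<^sup>2))"
    by (intro sum_mono step)
  also have "\<dots> = 2 * exp (1 / (2 * c)) * (\<Sum>\<epsilon>\<in>?P. exp (l' * (\<Sum>i\<in>J. \<epsilon> i)\<^sup>2))"
    by (simp add: sum_distrib_left)
  also have "\<dots> \<le> 2 * exp (1 / (2 * c)) * (2 ^ card J * exp (real (card J) / (2 * c)))"
    using insert.IH[of l'] l'D insert.prems by (intro mult_left_mono) (auto simp: l'_def D_def)
  also have "\<dots> = 2 ^ card (insert x J) * exp (real (card (insert x J)) / (2 * c))"
    using insert.hyps by (simp add: add_divide_distrib exp_add)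
  finally show ?case .
qed simp

section \<open>Sign symmetry of the couplings\<close>

context resampling
begin

definition flip :: "(nat \<times> nat) set \<Rightarrow> (nat \<times> nat \<Rightarrow> real) \<Rightarrow> nat \<times> nat \<Rightarrow> real" where
  "flip D g = (\<lambda>e. if e \<in> D then - g e else g e)"

text \<open>For a single entry, symmetry of \<open>\<gamma>\<close> makes \<open>resample e\<close>
  of the flipped function equal to that of the original, and \<open>resample e\<close> preserves
  means. Induction on \<open>D\<close> flips the remaining entries.\<close>

lemma integral_flip:
  assumes symm: "\<And>f. f \<in> borel_measurable borel \<Longrightarrow> (\<integral>x. f (- x) \<partial>\<gamma>) = (\<integral>x. f x \<partial>\<gamma> :: real)"
    and D: "D \<subseteq> I" and u: "bm1 u"
  shows "(\<integral>g. u (flip D g) \<partial>M) = (\<integral>g. u g \<partial>M)"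
proof -
  have "finite D" using D fin finite_subset by auto
  then show ?thesis using D u
  proof (induction D arbitrary: u rule: finite_induct)
    case empty
    then show ?case by (simp add: flip_def)
  next
    case (insert e D)
    then have e: "e \<in> I" by simp
    define v where "v g = u (g(e := - g e))" for g
    have comp: "(\<lambda>g. g e) \<in> measurable M \<gamma>" using e by (rule measurable_component_singleton)
    have neg: "(\<lambda>x. - x) \<in> measurable \<gamma> \<gamma>"
      by (simp add: measurable_cong_sets[OF sets_\<gamma> sets_\<gamma>])
    have "(\<lambda>g. g(e := - g e)) \<in> measurable M M"
      by (rule measurable_upd[OF e measurable_ident measurable_compose[OF comp neg], unfolded id_def])
    then have v: "bm1 v" unfolding v_def by (intro bdd_meas_compose[OF insert.prems(2)])
    have resample_v: "resample e v g = resample e u g" if g: "g \<in> space M" for g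
    proof -
      have "(\<lambda>x. u (g(e := x))) \<in> borel_measurable borel"
        using bdd_meas_measurable[OF resample_in_slice(2)[OF e insert.prems(2) g]]
        unfolding measurable_cong_sets[OF sets_\<gamma> refl] .
      from symm[OF this] show ?thesis by (simp add: resample_def v_def)
    qed
    have "u (flip (insert e D) g) = v (flip D g)" for g
      using insert.hyps by (auto simp: v_def flip_def intro!: arg_cong[of _ _ u])
    then have "(\<integral>g. u (flip (insert e D) g) \<partial>M) = (\<integral>g. v g \<partial>M)"
      using insert.IH[OF _ v] insert.prems by simp
    also have "\<dots> = (\<integral>g. resample e u g \<partial>M)"
      unfolding integral_of_resample(1)[OF e v, symmetric] by (intro Bochner_Integration.integral_cong resample_v refl)
    also have "\<dots> = (\<integral>g. u g \<partial>M)" by (rule integral_of_resample(1)[OF e insert.prems(2)])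
    finally show ?case .
  qed
qed

end

subsection \<open>The Sherrington-Kirkpatrick model\<close>

abbreviation std_normal :: "real measure" where
  "std_normal \<equiv> density lborel (\<lambda>x. ennreal (std_normal_density x))"

lemma std_normal_integral:
  fixes f :: "real \<Rightarrow> real"
  assumes "f \<in> borel_measurable borel"
  shows "(\<integral>x. f x \<partial>std_normal) = (\<integral>x. std_normal_density x * f x \<partial>lborel)"
    and "integrable std_normal f \<longleftrightarrow> integrable lborel (\<lambda>x. std_normal_density x * f x)"
  using assms by (simp_all add: integral_real_density integrable_real_density integral_density integrable_density)

lemma std_normal_mean: "(\<integral>x. x \<partial>std_normal) = 0"
  using integral_std_normal_moment_odd[of 0] by (simp add: std_normal_integral)

lemma std_normal_second_moment: "(\<integral>x. x\<^sup>2 \<partial>std_normal) = 1"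
  using integral_std_normal_moment_even[of 1] by (simp add: std_normal_integral)

lemma std_normal_symmetric:
  fixes f :: "real \<Rightarrow> real"
  assumes "f \<in> borel_measurable borel"
  shows "(\<integral>x. f (- x) \<partial>std_normal) = (\<integral>x. f x \<partial>std_normal)"
proof -
  have "(\<lambda>x. f (- x)) \<in> borel_measurable borel" using assms by measurable
  moreover have "std_normal_density (- x) = std_normal_density x" for x
    by (simp add: normal_density_def)
  ultimately show ?thesis
    using lborel_integral_real_affine[of "-1" "\<lambda>x. std_normal_density x * f x" 0] assms
    by (simp add: std_normal_integral)
qed

text \<open>A Gaussian density times \<open>exp (c * x)\<close> is a multiple of a shifted Gaussian
  density, and \<open>exp (8 * \<bar>x\<bar>)\<close> is at most the sum of the cases
  \<open>c = 8\<close> and \<open>c = - 8\<close>.\<close>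

lemma std_normal_exp_moment: "integrable std_normal (\<lambda>x. exp (8 * \<bar>x\<bar>))"
proof -
  have shift: "std_normal_density x * exp (c * x) = exp (c\<^sup>2 / 2) * normal_density c 1 x" for c x :: real
    by (simp add: normal_density_def power2_eq_square algebra_simps diff_divide_distrib add_divide_distrib flip: exp_add)
  have i: "integrable lborel (\<lambda>x. std_normal_density x * exp (c * x))" for c :: real
    unfolding shift by (intro integrable_mult_right integrable_normal_density) simp
  have "integrable lborel (\<lambda>x. std_normal_density x * exp (8 * \<bar>x\<bar>))"
  proof (rule Bochner_Integration.integrable_bound)
    show "integrable lborel (\<lambda>x. std_normal_density x * exp (8 * x) + std_normal_density x * exp (- 8 * x))"
      by (intro Bochner_Integration.integrable_add i)
    have "norm (std_normal_density x * exp (8 * \<bar>x\<bar>)) \<le> norm (std_normal_density x * exp (8 * x) + std_normal_density x * exp (- 8 * x))" for x :: real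
      by (simp add: abs_mult abs_of_nonneg add_nonneg_nonneg flip: distrib_left) (auto simp: abs_if intro!: mult_left_mono)
    then show "AE x in lborel. norm (std_normal_density x * exp (8 * \<bar>x\<bar>)) \<le> norm (std_normal_density x * exp (8 * x) + std_normal_density x * exp (- 8 * x))"
      by simp
  qed simp
  then show ?thesis by (subst std_normal_integral(2)) auto
qed

lemma prob_space_std_normal: "prob_space std_normal"
  by (rule prob_space_normal_density) simp

section \<open>The S-K model as an instance of the general setting\<close>

definition bond :: "nat \<times> nat \<Rightarrow> (nat \<Rightarrow> real) \<Rightarrow> real" where
  "bond e \<sigma> = \<sigma> (fst e) * \<sigma> (snd e)"

lemma config_cases: "\<sigma> \<in> configs N \<Longrightarrow> i \<in> {1..N} \<Longrightarrow> \<sigma> i = -1 \<or> \<sigma> i = 1"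
  by (auto simp: configs_def PiE_iff)

lemma sum_bond_overlap:
  "(\<Sum>e\<in>pairs N. bond e \<sigma> * bond e \<tau>) = (\<Sum>i=1..N. \<sigma> i * \<tau> i)\<^sup>2"
  by (simp add: pairs_def bond_def sum.cartesian_product' power2_eq_square sum_product mult_ac)

lemma hamiltonian_bond:
  "- \<beta> * hamiltonian N g \<sigma> = \<beta> / sqrt (2 * real N) * (\<Sum>e\<in>pairs N. g e * bond e \<sigma>)"
  by (simp add: hamiltonian_def pairs_def bond_def sum.cartesian_product' mult.assoc)

text \<open>The assumption \<open>small\<close> is \<open>a \<le> 1 / 8\<close> for this model. When
  it fails, \<open>\<beta>\<close> is at least of order \<open>sqrt N\<close> and the asserted bound
  exceeds 1.\<close>

locale sk =
  fixes N :: nat and \<beta> :: real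
  assumes N: "2 \<le> N" and \<beta>: "0 \<le> \<beta>" and small: "\<beta> / sqrt (2 * real N) \<le> 1 / 8"
begin

abbreviation \<alpha> where "\<alpha> \<equiv> \<beta> / sqrt (2 * real N)"

sublocale overlap_chaos "pairs N" std_normal "configs N" bond \<alpha>
proof -
  have bond_cases: "bond e \<sigma> = 1 \<or> bond e \<sigma> = -1" if "e \<in> pairs N" "\<sigma> \<in> configs N" for e \<sigma>
    using that config_cases[OF that(2), of "fst e"] config_cases[OF that(2), of "snd e"]
    by (auto simp: bond_def pairs_def)
  interpret ising "pairs N" "configs N" bond \<alpha>
    by unfold_locales (rule finite_pairs finite_configs configs_nonempty bond_cases | assumption)+
  interpret resampling "pairs N" std_normal
    by (rule resampling.intro) (simp_all add: prob_space_std_normal)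
  interpret ising_resampling "pairs N" std_normal "configs N" bond \<alpha>
  proof unfold_locales
    show "0 \<le> \<alpha>" using \<beta> by simp
  qed (rule small std_normal_mean std_normal_second_moment std_normal_exp_moment)+
  show "overlap_chaos (pairs N) std_normal (configs N) bond \<alpha>"
    by unfold_locales (simp add: q_def sum_bond_overlap)
qed

section \<open>Gauge symmetry and independent replicas\<close>

lemma M_couplings: "M = couplings N"
  by (simp add: couplings_def)

lemma q_overlap: "q \<sigma> \<tau> = (\<Sum>i=1..N. \<sigma> i * \<tau> i)\<^sup>2"
  unfolding q_def by (rule sum_bond_overlap)

lemma gibbs_mu: "exp (- \<beta> * hamiltonian N g \<sigma>) / partition_function N \<beta> g = mu g \<sigma>"
  unfolding mu_def wt_def partition_function_def hamiltonian_bond ..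

definition gauge :: "(nat \<Rightarrow> real) \<Rightarrow> (nat \<Rightarrow> real) \<Rightarrow> nat \<Rightarrow> real" where
  "gauge \<tau> \<sigma> = (\<lambda>i\<in>{1..N}. \<tau> i * \<sigma> i)"

lemma gauge_config: "\<tau> \<in> configs N \<Longrightarrow> \<sigma> \<in> configs N \<Longrightarrow> gauge \<tau> \<sigma> \<in> configs N"
  using config_cases[of \<tau> N] config_cases[of \<sigma> N]
  by (fastforce simp: gauge_def configs_def PiE_iff)

lemma gauge_involution:
  assumes "\<tau> \<in> configs N" "\<sigma> \<in> configs N" shows "gauge \<tau> (gauge \<tau> \<sigma>) = \<sigma>"
proof
  fix i
  show "gauge \<tau> (gauge \<tau> \<sigma>) i = \<sigma> i"
  proof (cases "i \<in> {1..N}")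
    case True
    then show ?thesis using config_cases[OF assms(1) True] by (auto simp: gauge_def)
  next
    case False
    then show ?thesis using assms(2) by (auto simp: gauge_def configs_def PiE_iff extensional_def)
  qed
qed

lemma gauge_commute: "gauge \<tau> \<sigma> = gauge \<sigma> \<tau>"
  by (simp add: gauge_def mult.commute)

lemma bij_gauge: "\<tau> \<in> configs N \<Longrightarrow> bij_betw (gauge \<tau>) (configs N) (configs N)"
  by (rule bij_betwI[where g="gauge \<tau>"]) (auto simp: gauge_config gauge_involution)

lemma bond_gauge: "e \<in> pairs N \<Longrightarrow> bond e (gauge \<tau> \<sigma>) = bond e \<tau> * bond e \<sigma>"
  by (auto simp: bond_def gauge_def pairs_def)

text \<open>The flip multiplies each \<open>g e\<close> by \<open>bond e \<tau>\<close>, and this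
  factor can be moved onto the configuration because bonds are multiplicative under
  \<open>gauge\<close>.\<close>

lemma mu_gauge:
  assumes "\<tau> \<in> configs N"
  shows "mu (flip {e\<in>pairs N. bond e \<tau> = -1} g) \<sigma> = mu g (gauge \<tau> \<sigma>)"
proof -
  have *: "flip {e\<in>pairs N. bond e \<tau> = -1} g e * bond e \<sigma> = g e * bond e (gauge \<tau> \<sigma>)" if "e \<in> pairs N" for e \<sigma>
    using s_cases[OF that assms] that by (auto simp: flip_def bond_gauge)
  have wt: "wt (flip {e\<in>pairs N. bond e \<tau> = -1} g) \<sigma> = wt g (gauge \<tau> \<sigma>)" for \<sigma>
    unfolding wt_def by (simp add: * cong: sum.cong)
  have "(\<Sum>\<sigma>\<in>configs N. wt g (gauge \<tau> \<sigma>)) = (\<Sum>\<sigma>\<in>configs N. wt g \<sigma>)"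
    by (rule sum.reindex_bij_betw[OF bij_gauge[OF assms]])
  then show ?thesis by (simp add: mu_def wt)
qed

text \<open>Gauge transformations act transitively on configurations and preserve the law of the
  couplings. All configurations thus have the same mean mass, and these masses sum to 1.\<close>

lemma mean_mu:
  assumes "\<sigma> \<in> configs N"
  shows "(\<integral>g. mu g \<sigma> \<partial>M) = 1 / 2 ^ N"
proof -
  interpret m: prob_space M by (rule prob_M)
  have inv: "(\<integral>g. mu g (gauge \<tau> \<sigma>') \<partial>M) = (\<integral>g. mu g \<sigma>' \<partial>M)" if "\<tau> \<in> configs N" "\<sigma>' \<in> configs N" for \<tau> \<sigma>'
    using integral_flip[OF std_normal_symmetric _ bm1_mu[OF that(2)], of "{e\<in>pairs N. bond e \<tau> = -1}"]
    by (simp add: mu_gauge[OF that(1)])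
  have same: "(\<integral>g. mu g \<tau> \<partial>M) = (\<integral>g. mu g \<sigma> \<partial>M)" if t: "\<tau> \<in> configs N" for \<tau>
  proof -
    \<comment> \<open>The transformation that carries \<open>\<sigma>\<close> to
      \<open>\<tau>\<close>.\<close>
    have "gauge (gauge \<tau> \<sigma>) \<sigma> = \<tau>"
      using gauge_involution[OF assms t] by (metis gauge_commute)
    then show ?thesis using inv[OF gauge_config[OF t assms] assms] by simp
  qed
  have "1 = (\<integral>g. (\<Sum>\<tau>\<in>configs N. mu g \<tau>) \<partial>M)" by (simp add: sum_mu m.prob_space)
  also have "\<dots> = (\<Sum>\<tau>\<in>configs N. \<integral>g. mu g \<tau> \<partial>M)"
    by (intro Bochner_Integration.integral_sum bdd_meas_integrable finm bm1_mu)
  also have "\<dots> = real (card (configs N)) * (\<integral>g. mu g \<sigma> \<partial>M)"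
    using same by simp
  also have "card (configs N) = 2 ^ N" by (simp add: configs_def card_PiE numeral_2_eq_2)
  finally show ?thesis by (simp add: field_simps)
qed

text \<open>With nothing shared, the averaged replicas are independent and uniform, and gauging by
  \<open>\<sigma>\<close> turns \<open>q\<close> into a squared sum of signs. Taking
  \<open>c = N\<close> in \<open>sum_signs_exp_square\<close> gives the factor 4 in the hypothesis
  and the exponent 1/2.\<close>

lemma independent_replicas:
  assumes l: "0 \<le> l" "l * (4 * real N) \<le> 1"
  shows "pair_mean {} (gibbs_mean (\<Phi> l)) \<le> exp (1 / 2)"
proof -
  have joint: "joint \<sigma> \<tau> {} = 1 / 2 ^ N * (1 / 2 ^ N)" if "\<sigma> \<in> configs N" "\<tau> \<in> configs N" for \<sigma> \<tau>
  proof -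
    have "mu (perturb (pairs N) g g') \<tau> = mu g' \<tau>" for g g'
      unfolding mu_def wt_def by (simp add: perturb_def)
    then show ?thesis by (simp add: joint_def pair_mean_def mean_mu that)
  qed
  have inner: "(\<Sum>\<tau>\<in>configs N. exp (l * q \<sigma> \<tau>)) \<le> 2 ^ N * exp (1 / 2)" if "\<sigma> \<in> configs N" for \<sigma>
  proof -
    have "(\<Sum>\<tau>\<in>configs N. exp (l * q \<sigma> \<tau>)) = (\<Sum>\<tau>\<in>configs N. exp (l * (\<Sum>i=1..N. gauge \<sigma> \<tau> i)\<^sup>2))"
      by (simp add: q_overlap gauge_def)
    also have "\<dots> = (\<Sum>\<epsilon>\<in>configs N. exp (l * (\<Sum>i=1..N. \<epsilon> i)\<^sup>2))"
      by (rule sum.reindex_bij_betw[OF bij_gauge[OF that]])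
    also have "\<dots> \<le> 2 ^ card {1..N} * exp (real (card {1..N}) / (2 * real N))"
      unfolding configs_def using N l by (intro sum_signs_exp_square) auto
    finally show ?thesis using N by simp
  qed
  have "pair_mean {} (gibbs_mean (\<Phi> l)) = (\<Sum>\<sigma>\<in>configs N. 1 / 2 ^ N * (1 / 2 ^ N) * (\<Sum>\<tau>\<in>configs N. exp (l * q \<sigma> \<tau>)))"
    unfolding pair_mean_gibbs_mean sum_distrib_left by (intro sum.cong refl) (simp add: joint)
  also have "\<dots> \<le> (\<Sum>\<sigma>\<in>configs N. 1 / 2 ^ N * (1 / 2 ^ N) * (2 ^ N * exp (1 / 2)))"
    by (intro sum_mono mult_left_mono inner) auto
  also have "\<dots> = real (card (configs N)) * (1 / 2 ^ N * exp (1 / 2))" by simp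
  also have "card (configs N) = 2 ^ N" by (simp add: configs_def card_PiE numeral_2_eq_2)
  finally show ?thesis by simp
qed

end

section \<open>The expected squared overlap as an average over replaced sets\<close>

lemma abs_overlap_le_1:
  assumes "\<sigma> \<in> configs N" "\<tau> \<in> configs N" "0 < N"
  shows "\<bar>overlap N \<sigma> \<tau>\<bar> \<le> 1"
proof -
  have "\<bar>\<Sum>i=1..N. \<sigma> i * \<tau> i\<bar> \<le> (\<Sum>i=1..N. \<bar>\<sigma> i * \<tau> i\<bar>)" by (rule sum_abs)
  also have "\<dots> \<le> (\<Sum>i=1..N. 1)"
    using config_cases[OF assms(1)] config_cases[OF assms(2)] by (intro sum_mono) (fastforce simp: abs_mult)
  finally show ?thesis using assms(3) by (simp add: overlap_def abs_mult)
qed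

lemma overlap_sq_le_1:
  "\<sigma> \<in> configs N \<Longrightarrow> \<tau> \<in> configs N \<Longrightarrow> 0 < N \<Longrightarrow> (overlap N \<sigma> \<tau>)\<^sup>2 \<le> 1"
  using abs_overlap_le_1[of \<sigma> N \<tau>] by (simp add: abs_square_le_1)

lemma expectation_le_1:
  assumes "0 \<le> p" "p \<le> 1" "p * (real N)\<^sup>2 \<in> \<int>" "0 < N"
  shows "prob_space.expectation (replica_law N \<beta> p) (\<lambda>(\<sigma>1, \<sigma>2). (overlap N \<sigma>1 \<sigma>2)\<^sup>2) \<le> 1"
proof -
  interpret r: prob_space "replica_law N \<beta> p" by (rule prob_space_replica_law[OF assms(1-3)])
  have space: "space (replica_law N \<beta> p) = configs N \<times> configs N"
    using sets_eq_imp_space_eq[of "replica_law N \<beta> p" "count_space (configs N \<times> configs N)"]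
    by (simp add: sets_replica_law[OF assms(1-3)])
  have "r.expectation (\<lambda>(\<sigma>1, \<sigma>2). (overlap N \<sigma>1 \<sigma>2)\<^sup>2) \<le> r.expectation (\<lambda>_. 1)"
  proof (rule integral_mono)
    show "integrable (replica_law N \<beta> p) (\<lambda>(\<sigma>1, \<sigma>2). (overlap N \<sigma>1 \<sigma>2)\<^sup>2)"
    proof (rule r.integrable_const_bound[where B=1])
      show "(\<lambda>(\<sigma>1, \<sigma>2). (overlap N \<sigma>1 \<sigma>2)\<^sup>2) \<in> borel_measurable (replica_law N \<beta> p)"
        by (rule measurableI) (auto simp: sets_replica_law[OF assms(1-3)] space)
    qed (auto simp: space assms intro!: AE_I2 overlap_sq_le_1)
  qed (auto simp: space assms intro!: overlap_sq_le_1)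
  then show ?thesis by (simp add: r.prob_space)
qed

context sk
begin

text \<open>Integrating over the two Gibbs measures first gives \<open>gibbs_mean q\<close> divided
  by \<open>N\<^sup>2\<close>. Fubini then leaves the average over replaced sets \<open>S\<close>,
  for which the shared part is \<open>pairs N - S\<close>.\<close>

lemma expectation_overlap:
  assumes p: "0 \<le> p" "p \<le> 1" "p * (real N)\<^sup>2 \<in> \<int>"
  shows "prob_space.expectation (replica_law N \<beta> p) (\<lambda>(\<sigma>1, \<sigma>2). (overlap N \<sigma>1 \<sigma>2)\<^sup>2) =
    (\<Sum>S\<in>perturbation_sets N p. pair_mean (pairs N - S) (gibbs_mean q)) / (real (card (perturbation_sets N p)) * (real N)\<^sup>2)"
proof -
  let ?R = "\<lambda>(\<sigma>1, \<sigma>2). (overlap N \<sigma>1 \<sigma>2)\<^sup>2"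
  let ?CC = "count_space (configs N) \<Otimes>\<^sub>M count_space (configs N)"
  let ?k = "\<lambda>(g, g', S). gibbs N \<beta> g \<Otimes>\<^sub>M gibbs N \<beta> (perturb S g g')"
  let ?U = "uniform_count_measure (perturbation_sets N p)"
  let ?W = "\<lambda>g h. gibbs_mean q g h / (real N)\<^sup>2"
  interpret m: prob_space M by (rule prob_M)
  interpret u: prob_space ?U
    by (intro prob_space_uniform_count_measure perturbation_sets_nonempty p) simp
  interpret mu: pair_prob_space M ?U ..
  interpret mmu: pair_prob_space M "M \<Otimes>\<^sub>M ?U" ..
  interpret d: prob_space "disorder N p" by (rule prob_space_disorder[OF p])
  have dis: "disorder N p = M \<Otimes>\<^sub>M M \<Otimes>\<^sub>M ?U" by (simp add: disorder_def M_couplings)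
  have CC: "?CC = count_space (configs N \<times> configs N)" by (simp add: pair_measure_count_space)
  have meas: "?R \<in> borel_measurable ?CC" unfolding CC by simp
  have inner: "(\<integral>z. ?R z \<partial>(gibbs N \<beta> g \<Otimes>\<^sub>M gibbs N \<beta> h)) = ?W g h" for g h
  proof -
    interpret g: prob_space "gibbs N \<beta> g" by (rule prob_space_gibbs)
    interpret h: prob_space "gibbs N \<beta> h" by (rule prob_space_gibbs)
    interpret gh: pair_prob_space "gibbs N \<beta> g" "gibbs N \<beta> h" ..
    have "integrable (gibbs N \<beta> g \<Otimes>\<^sub>M gibbs N \<beta> h) ?R"
    proof (rule gh.integrable_const_bound[where B=1])
      show "?R \<in> borel_measurable (gibbs N \<beta> g \<Otimes>\<^sub>M gibbs N \<beta> h)"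
        using meas by (simp cong: measurable_cong_sets add: measurable_cong_sets[OF sets_pair_measure_cong[OF sets_gibbs sets_gibbs] refl])
    qed (use N in \<open>auto simp: space_pair_measure intro!: AE_I2 overlap_sq_le_1\<close>)
    then have "(\<integral>z. ?R z \<partial>(gibbs N \<beta> g \<Otimes>\<^sub>M gibbs N \<beta> h)) = (\<integral>\<sigma>. \<integral>\<tau>. (overlap N \<sigma> \<tau>)\<^sup>2 \<partial>gibbs N \<beta> h \<partial>gibbs N \<beta> g)"
      by (subst gh.integral_fst'[symmetric]) auto
    also have "\<dots> = (\<Sum>\<sigma>\<in>configs N. mu g \<sigma> * (\<Sum>\<tau>\<in>configs N. mu h \<tau> * (overlap N \<sigma> \<tau>)\<^sup>2))"
      unfolding gibbs_def gibbs_mu by (simp add: lebesgue_integral_point_measure_finite mu_nonneg)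
    also have "\<dots> = ?W g h"
      unfolding gibbs_mean_def sum_divide_distrib sum_distrib_left
      by (intro sum.cong refl) (simp add: q_overlap overlap_def power_divide)
    finally show ?thesis .
  qed
  have kernel: "(\<integral>z. ?R z \<partial>?k \<omega>) = ?W (fst \<omega>) (perturb (snd (snd \<omega>)) (fst \<omega>) (fst (snd \<omega>)))" for \<omega>
    by (cases \<omega>) (simp only: prod.case fst_conv snd_conv inner)
  have "prob_space.expectation (replica_law N \<beta> p) ?R = (\<integral>\<omega>. (\<integral>z. ?R z \<partial>?k \<omega>) \<partial>disorder N p)"
    unfolding replica_law_def
  proof (rule integral_bind[where K="?CC" and B=1 and B'=1])
    show "?R \<in> borel_measurable ?CC" by (rule meas)
    show "\<bar>?R x\<bar> \<le> 1" if "x \<in> space ?CC" for x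
      using that N by (auto simp: space_pair_measure intro!: overlap_sq_le_1)
    show "?k \<in> measurable (disorder N p) (subprob_algebra ?CC)" by (rule measurable_gibbs_pair)
    show "finite_measure (disorder N p)" by (rule d.finite_measure)
    have "prob_space (?k \<omega>)" for \<omega>
      by (auto simp: case_prod_beta intro!: prob_space_pair prob_space_gibbs)
    then show "AE \<omega> in disorder N p. emeasure (?k \<omega>) (space (?k \<omega>)) \<le> ennreal 1"
      by (simp add: prob_space.emeasure_space_1)
  qed
  also have "\<dots> = (\<integral>\<omega>. ?W (fst \<omega>) (perturb (snd (snd \<omega>)) (fst \<omega>) (fst (snd \<omega>))) \<partial>disorder N p)"
    by (simp only: kernel)
  also have "\<dots> = (\<integral>g. \<integral>g'. \<integral>S. ?W g (perturb S g g') \<partial>?U \<partial>M \<partial>M)"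
  proof -
    \<comment> \<open>Joint measurability in the couplings and the random set is inherited from the
      kernel.\<close>
    have "(\<lambda>\<omega>. \<integral>z. ?R z \<partial>?k \<omega>) \<in> borel_measurable (disorder N p)"
      by (rule measurable_compose[OF measurable_gibbs_pair integral_measurable_subprob_algebra[OF meas]])
    then have m3: "(\<lambda>\<omega>. ?W (fst \<omega>) (perturb (snd (snd \<omega>)) (fst \<omega>) (fst (snd \<omega>)))) \<in> borel_measurable (M \<Otimes>\<^sub>M M \<Otimes>\<^sub>M ?U)"
      by (simp only: kernel dis)
    obtain B where B: "\<And>g h. \<bar>?W g h\<bar> \<le> B"
    proof
      fix g h
      have "gibbs_mean q g h \<le> gibbs_mean (\<lambda>_ _. (real N)\<^sup>2) g h" "gibbs_mean (\<lambda>_ _. 0) g h \<le> gibbs_mean q g h"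
        using N overlap_sq_le_1[of _ N]
        by (auto intro!: gibbs_mean_mono q_nonneg simp: q_overlap overlap_def power_divide divide_le_eq_1)
      then show "\<bar>?W g h\<bar> \<le> 1" using N by (simp add: gibbs_mean_const)
    qed
    have i3: "integrable (M \<Otimes>\<^sub>M M \<Otimes>\<^sub>M ?U) (\<lambda>\<omega>. ?W (fst \<omega>) (perturb (snd (snd \<omega>)) (fst \<omega>) (fst (snd \<omega>))))"
      by (rule mmu.integrable_const_bound[where B=B, OF _ m3]) (use B in simp)
    have i2: "integrable (M \<Otimes>\<^sub>M ?U) (\<lambda>\<omega>. ?W g (perturb (snd \<omega>) g (fst \<omega>)))" if "g \<in> space M" for g
    proof (rule mu.integrable_const_bound[where B=B])
      show "(\<lambda>\<omega>. ?W g (perturb (snd \<omega>) g (fst \<omega>))) \<in> borel_measurable (M \<Otimes>\<^sub>M ?U)"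
        using measurable_compose[OF measurable_Pair1'[OF that] m3] by simp
    qed (use B in simp)
    have "(\<integral>\<omega>. ?W (fst \<omega>) (perturb (snd (snd \<omega>)) (fst \<omega>) (fst (snd \<omega>))) \<partial>disorder N p) =
      (\<integral>g. \<integral>\<omega>. ?W g (perturb (snd \<omega>) g (fst \<omega>)) \<partial>(M \<Otimes>\<^sub>M ?U) \<partial>M)"
      unfolding dis using mmu.integral_fst'[OF i3] by (simp only: fst_conv snd_conv)
    also have "\<dots> = (\<integral>g. \<integral>g'. \<integral>S. ?W g (perturb S g g') \<partial>?U \<partial>M \<partial>M)"
      by (intro Bochner_Integration.integral_cong refl) (use mu.integral_fst'[OF i2] in \<open>simp only: fst_conv snd_conv\<close>)
    finally show ?thesis .
  qed
  also have "\<dots> = (\<integral>g. \<integral>g'. (\<Sum>S\<in>perturbation_sets N p. gibbs_mean q g (perturb S g g')) / (real (card (perturbation_sets N p)) * (real N)\<^sup>2) \<partial>M \<partial>M)"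
    by (simp add: integral_uniform_count_measure sum_divide_distrib[symmetric] mult.commute)
  also have "\<dots> = (\<integral>g. \<integral>g'. (\<Sum>S\<in>perturbation_sets N p. gibbs_mean q g (perturb S g g')) \<partial>M \<partial>M) / (real (card (perturbation_sets N p)) * (real N)\<^sup>2)"
    by simp
  also have "(\<integral>g. \<integral>g'. (\<Sum>S\<in>perturbation_sets N p. gibbs_mean q g (perturb S g g')) \<partial>M \<partial>M) =
     (\<integral>g. (\<Sum>S\<in>perturbation_sets N p. \<integral>g'. gibbs_mean q g (perturb S g g') \<partial>M) \<partial>M)"
    by (intro Bochner_Integration.integral_cong refl Bochner_Integration.integral_sum
        bdd_meas_integrable finm bm2_fix[OF bm2_mix[OF bm2_gibbs_mean]])
  also have "\<dots> = (\<Sum>S\<in>perturbation_sets N p. \<integral>g. \<integral>g'. gibbs_mean q g (perturb S g g') \<partial>M \<partial>M)"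
    by (intro Bochner_Integration.integral_sum bdd_meas_integrable finm bm2_inner bm2_mix bm2_gibbs_mean)
  also have "\<dots> = (\<Sum>S\<in>perturbation_sets N p. pair_mean (pairs N - S) (gibbs_mean q))"
  proof (intro sum.cong refl)
    fix S assume "S \<in> perturbation_sets N p"
    then have "pairs N - (pairs N - S) = S" by (auto simp: perturbation_sets_def)
    then show "(\<integral>g. \<integral>g'. gibbs_mean q g (perturb S g g') \<partial>M \<partial>M) = pair_mean (pairs N - S) (gibbs_mean q)" by (simp add: pair_mean_def)
  qed
  finally show ?thesis .
qed

end

section \<open>Choice of the noise level and the final bound\<close>

definition exp_moment_const :: real where
  "exp_moment_const = (\<integral>x. exp (8 * \<bar>x\<bar>) \<partial>std_normal)"

context sk
begin

text \<open>The constant on the right is defined outside the locale and so depends on neither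
  \<open>N\<close> nor \<open>\<beta>\<close>.\<close>

lemma exp_const_const: "exp_const = exp_moment_const"
  by (simp add: exp_const_def exp_moment_const_def)

lemma card_pairs: "card (pairs N) = N\<^sup>2"
  by (simp add: pairs_def power2_eq_square)

lemma q_le: "\<sigma> \<in> configs N \<Longrightarrow> \<tau> \<in> configs N \<Longrightarrow> q \<sigma> \<tau> \<le> (real N)\<^sup>2"
  using overlap_sq_le_1[of \<sigma> N \<tau>] N by (simp add: q_overlap overlap_def power_divide divide_le_eq_1)

text \<open>The cube cancels the \<open>\<beta> ^ 3\<close> in \<open>err\<close>, and the factor 8
  keeps the displacement \<open>2 * \<alpha>\<^sup>2 * s0\<close> along the characteristic below
  \<open>1 / (8 * N)\<close>.\<close>

definition s0 :: real where "s0 = 1 / (8 * (1 + \<beta>) ^ 3)"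

lemma s0_bounds: "0 < s0" "s0 \<le> 1"
proof -
  have "1 \<le> (1 + \<beta>) ^ 3" using \<beta> by (intro one_le_power) simp
  then have "1 \<le> 8 * (1 + \<beta>) ^ 3" by linarith
  moreover have "1 / d \<le> 1" "0 < 1 / d" if "1 \<le> d" for d :: real using that by auto
  ultimately show "0 < s0" "s0 \<le> 1" unfolding s0_def by blast+
qed

lemma strong_noise_overlap:
  "kept_mean (pairs N) s0 (\<lambda>A. pair_mean A (gibbs_mean q)) \<le> (112 * exp_moment_const\<^sup>2 + 4) * (real N * sqrt (real N))"
proof -
  \<comment> \<open>Half of the range \<open>1 / (4 * N)\<close> allowed by
    \<open>independent_replicas\<close>; the other half is reserved for the displacement.\<close>
  let ?l0 = "1 / (8 * real N)"
  have N0: "0 < real N" and s0: "0 < s0" "s0 \<le> 1" using N s0_bounds by auto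
  have b3: "\<beta> ^ 3 \<le> (1 + \<beta>) ^ 3" using \<beta> by (intro power_mono) auto
  have b2: "\<beta>\<^sup>2 \<le> (1 + \<beta>) ^ 3"
  proof -
    have "\<beta>\<^sup>2 \<le> (1 + \<beta>)\<^sup>2" using \<beta> by (intro power_mono) auto
    also have "\<dots> \<le> (1 + \<beta>) ^ 3" using \<beta> by (intro power_increasing) auto
    finally show ?thesis .
  qed
  have pos: "0 < (1 + \<beta>) ^ 3" using \<beta> by simp
  have a2: "2 * \<alpha>\<^sup>2 * s0 \<le> 1 / (8 * real N)"
  proof -
    have "2 * \<alpha>\<^sup>2 * s0 = \<beta>\<^sup>2 / (1 + \<beta>) ^ 3 * (1 / (8 * real N))"
      using N0 by (simp add: s0_def power_divide)
    also have "\<dots> \<le> 1 * (1 / (8 * real N))"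
      using b2 pos by (intro mult_right_mono) (auto simp: divide_le_eq_1)
    finally show ?thesis by simp
  qed
  have init: "pair_mean {} (gibbs_mean (\<Phi> (?l0 + 2 * \<alpha>\<^sup>2 * s0))) \<le> exp (1 / 2)"
  proof (rule independent_replicas)
    have "(?l0 + 2 * \<alpha>\<^sup>2 * s0) * (4 * real N) \<le> (1 / (8 * real N) + 1 / (8 * real N)) * (4 * real N)"
      using a2 by (intro mult_right_mono) auto
    then show "(?l0 + 2 * \<alpha>\<^sup>2 * s0) * (4 * real N) \<le> 1" using N0 by simp
  qed (use s0 in simp)
  have "?l0 * kept_mean (pairs N) s0 (\<lambda>A. pair_mean A (gibbs_mean q)) \<le> err * s0 + 1 / 2"
    using s0 by (intro overlap_at_strong_noise init) auto
  then have 1: "kept_mean (pairs N) s0 (\<lambda>A. pair_mean A (gibbs_mean q)) \<le> 8 * real N * (err * s0 + 1 / 2)"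
    using N0 by (simp add: field_simps)
  have err: "err * s0 \<le> 14 * exp_moment_const\<^sup>2 * sqrt (real N)"
  proof -
    have "sqrt (real N) \<le> sqrt (2 * real N)" by simp
    then have "(sqrt (real N)) ^ 3 \<le> (sqrt (2 * real N)) ^ 3" by (intro power_mono) auto
    moreover have "(sqrt (real N)) ^ 3 = real N * sqrt (real N)"
      by (simp add: power3_eq_cube)
    ultimately have den: "real N * sqrt (real N) \<le> (sqrt (2 * real N)) ^ 3" by simp
    have "\<alpha> ^ 3 * s0 = \<beta> ^ 3 / (1 + \<beta>) ^ 3 * (1 / (8 * sqrt (2 * real N) ^ 3))"
      by (simp add: s0_def power_divide)
    also have "\<dots> \<le> 1 * (1 / (8 * (real N * sqrt (real N))))"
      using b3 pos den N0 \<beta> by (intro mult_mono divide_left_mono mult_left_mono) (auto simp: divide_le_eq_1)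
    finally have a3: "\<alpha> ^ 3 * s0 \<le> 1 / (8 * (real N * sqrt (real N)))" by simp
    \<comment> \<open>There are \<open>N\<^sup>2\<close> couplings, each with an error of order
      \<open>N\<close> to the power -3/2 after multiplication by \<open>s0\<close>, hence the
      \<open>sqrt N\<close>; and 14 = 112 / 8.\<close>
    have "err * s0 = 112 * exp_moment_const\<^sup>2 * (real N)\<^sup>2 * (\<alpha> ^ 3 * s0)"
      unfolding err_def exp_const_const card_pairs by (simp only: of_nat_power mult_ac)
    also have "\<dots> \<le> 112 * exp_moment_const\<^sup>2 * (real N)\<^sup>2 * (1 / (8 * (real N * sqrt (real N))))"
      using a3 by (intro mult_left_mono) auto
    also have "\<dots> = 14 * exp_moment_const\<^sup>2 * (real N / sqrt (real N))"
      using N0 by (simp add: power2_eq_square)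
    also have "real N / sqrt (real N) = sqrt (real N)" by (simp add: real_div_sqrt)
    finally show ?thesis .
  qed
  have "1 \<le> sqrt (real N)" using N by simp
  then have "err * s0 + 1 / 2 \<le> 14 * exp_moment_const\<^sup>2 * sqrt (real N) + 1 / 2 * sqrt (real N)"
    using err by linarith
  then have "8 * real N * (err * s0 + 1 / 2) \<le> 8 * real N * (14 * exp_moment_const\<^sup>2 * sqrt (real N) + 1 / 2 * sqrt (real N))"
    using N0 by (intro mult_left_mono) auto
  also have "\<dots> = (112 * exp_moment_const\<^sup>2 + 4) * (real N * sqrt (real N))"
    by (simp add: algebra_simps)
  finally show ?thesis using 1 by linarith
qed

lemma overlap_bound:
  assumes p: "0 < p" "p \<le> 1" "p * (real N)\<^sup>2 \<in> \<int>"
  shows "prob_space.expectation (replica_law N \<beta> p) (\<lambda>(\<sigma>1, \<sigma>2). (overlap N \<sigma>1 \<sigma>2)\<^sup>2)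
    \<le> (448 * exp_moment_const\<^sup>2 + 28) * (1 + \<beta>) / (p * ln (real N))"
proof -
  define C where "C = 112 * exp_moment_const\<^sup>2 + 4"
  have N0: "0 < real N" and lnN: "0 < ln (real N)" using N by auto
  have b1: "0 < 1 + \<beta>" using \<beta> by simp
  obtain w where w: "\<And>B. 0 \<le> w B" "\<And>A. A \<subseteq> pairs N \<Longrightarrow> pair_mean A (gibbs_mean q) = (\<Sum>B\<in>Pow A. w B)"
    by (rule overlap_spectrum) blast
  have low: "(\<Sum>B\<in>Pow (pairs N). w B * s0 ^ card B) \<le> C * (real N * sqrt (real N))"
  proof -
    have "(\<Sum>B\<in>Pow (pairs N). w B * s0 ^ card B) = kept_mean (pairs N) s0 (\<lambda>A. \<Sum>B\<in>Pow A. w B)"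
      by (rule rsum_Pow_sum[symmetric]) simp
    also have "\<dots> = kept_mean (pairs N) s0 (\<lambda>A. pair_mean A (gibbs_mean q))" by (intro kept_mean_cong w(2)[symmetric])
    finally show ?thesis using strong_noise_overlap by (simp add: C_def)
  qed
  have total: "(\<Sum>B\<in>Pow (pairs N). w B) \<le> (real N)\<^sup>2"
  proof -
    have "pair_mean (pairs N) (gibbs_mean q) \<le> pair_mean (pairs N) (gibbs_mean (\<lambda>_ _. (real N)\<^sup>2))"
      by (intro pair_mean_mono bm2_gibbs_mean gibbs_mean_mono q_le)
    also have "gibbs_mean (\<lambda>_ _. (real N)\<^sup>2) = (\<lambda>g h. (real N)\<^sup>2)" by (intro ext gibbs_mean_const)
    finally show ?thesis by (simp add: pair_mean_const w(2))
  qed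
  \<comment> \<open>Any admissible set supplies the natural number \<open>k\<close> equal to
    \<open>p * N\<^sup>2\<close>.\<close>
  obtain S1 where S1: "S1 \<in> perturbation_sets N p" using perturbation_sets_nonempty[of p N] p by auto
  define k where "k = card S1"
  have k: "real k = p * (real N)\<^sup>2" "k \<le> card (pairs N)"
    using S1 by (auto simp: k_def perturbation_sets_def intro: card_mono)
  have PS: "perturbation_sets N p = {S. S \<subseteq> pairs N \<and> card S = k}"
    unfolding perturbation_sets_def k(1)[symmetric] by simp
  have cPS: "card (perturbation_sets N p) = card (pairs N) choose k"
    unfolding PS by (simp add: n_subsets)
  have cpos: "0 < real (card (pairs N) choose k)" using k(2) by simp
  have ratio: "real k / real (card (pairs N)) = p" using k(1) N0 by (simp add: card_pairs)
  \<comment> \<open>chosen such that \<open>s0 powr (- m) \<le> N powr (1 / 4)\<close>\<close>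
  define m where "m = ln (real N) / (12 * (1 + \<beta>))"
  have m: "0 < m" using lnN b1 by (simp add: m_def)
  have "(\<Sum>S\<in>perturbation_sets N p. pair_mean (pairs N - S) (gibbs_mean q)) = (\<Sum>S\<in>{S. S \<subseteq> pairs N \<and> card S = k}. \<Sum>B\<in>Pow (pairs N - S). w B)"
    unfolding PS by (intro sum.cong refl w(2)) auto
  also have "\<dots> \<le> real (card (pairs N) choose k) * (s0 powr (- m) * (\<Sum>B\<in>Pow (pairs N). w B * s0 ^ card B)
      + exp (- (real k / real (card (pairs N))) * m) * (\<Sum>B\<in>Pow (pairs N). w B))"
    using k s0_bounds m N w(1) by (intro random_subset_average) (auto simp: card_pairs)
  also have "\<dots> \<le> real (card (pairs N) choose k) * (s0 powr (- m) * (C * (real N * sqrt (real N))) + exp (- p * m) * (real N)\<^sup>2)"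
    unfolding ratio by (intro mult_left_mono add_mono low total) auto
  finally have sum: "(\<Sum>S\<in>perturbation_sets N p. pair_mean (pairs N - S) (gibbs_mean q)) \<le> \<dots>" .
  have "prob_space.expectation (replica_law N \<beta> p) (\<lambda>(\<sigma>1, \<sigma>2). (overlap N \<sigma>1 \<sigma>2)\<^sup>2)
     = (\<Sum>S\<in>perturbation_sets N p. pair_mean (pairs N - S) (gibbs_mean q)) / (real (card (pairs N) choose k) * (real N)\<^sup>2)"
    using p by (subst expectation_overlap) (auto simp: cPS)
  also have "\<dots> \<le> real (card (pairs N) choose k) * (s0 powr (- m) * (C * (real N * sqrt (real N))) + exp (- p * m) * (real N)\<^sup>2)
      / (real (card (pairs N) choose k) * (real N)\<^sup>2)"
    using cpos by (intro divide_right_mono sum) auto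
  also have "\<dots> = s0 powr (- m) * (C / sqrt (real N)) + exp (- p * m)"
  proof -
    have aux: "c * (u * (C * (n * r)) + v * n\<^sup>2) / (c * n\<^sup>2) = u * (C / r) + v" if "0 < c" "0 < n" "0 < r" "n = r * r" for c u v n r :: real
      using that by (simp add: field_simps power2_eq_square)
    show ?thesis using cpos N0 by (intro aux) auto
  qed
  \<comment> \<open>Both terms are bounded through \<open>exp (- x) \<le> 1 / x\<close>: the low
    levels with \<open>x = ln N / 4\<close>, since \<open>N powr (1 / 4)\<close> against
    \<open>sqrt N\<close> leaves \<open>N powr (- 1 / 4)\<close>, and the high levels with
    \<open>x = p * m\<close>. The factors 4 * C and 12 add up to the final constant.\<close>
  also have "\<dots> \<le> 4 * C * (1 + \<beta>) / (p * ln (real N)) + 12 * (1 + \<beta>) / (p * ln (real N))"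
  proof (rule add_mono)
    have recip: "exp (- x) \<le> 1 / x" if "0 < x" for x :: real
    proof -
      have "x \<le> exp x" using exp_ge_add_one_self[of x] by linarith
      then show ?thesis using that by (simp add: exp_minus field_simps)
    qed
    have "exp (- (p * m)) \<le> 1 / (p * m)" using p m by (intro recip) auto
    then show "exp (- p * m) \<le> 12 * (1 + \<beta>) / (p * ln (real N))" by (simp add: m_def)
    have lns0: "- ln s0 \<le> 3 * (1 + \<beta>)"
    proof -
      have "- ln s0 = ln (2 ^ 3 * (1 + \<beta>) ^ 3)" using b1 by (simp add: s0_def ln_div)
      also have "\<dots> = 3 * ln 2 + 3 * ln (1 + \<beta>)" using b1 by (simp only: ln_mult ln_realpow zero_less_power zero_less_numeral) simp
      also have "\<dots> \<le> 3 * 1 + 3 * \<beta>"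
        using ln_le_minus_one[of 2] ln_add_one_self_le_self[OF \<beta>] by simp
      finally show ?thesis by simp
    qed
    have "s0 powr (- m) = exp (m * (- ln s0))" using s0_bounds by (simp add: powr_def)
    also have "\<dots> \<le> exp (m * (3 * (1 + \<beta>)))" unfolding exp_le_cancel_iff using lns0 m by (intro mult_left_mono) auto
    also have "m * (3 * (1 + \<beta>)) = ln (real N) / 4" using b1 by (simp add: m_def field_simps)
    finally have s0m: "s0 powr (- m) \<le> exp (ln (real N) / 4)" .
    have sqrtN: "1 / sqrt (real N) = exp (- (ln (real N) / 2))"
      using N0 by (simp add: ln_sqrt[symmetric] exp_minus inverse_eq_divide)
    have C: "0 \<le> C" by (simp add: C_def)
    have "s0 powr (- m) * (C / sqrt (real N)) = C * (s0 powr (- m) * (1 / sqrt (real N)))" by simp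
    also have "\<dots> \<le> C * (exp (ln (real N) / 4) * exp (- (ln (real N) / 2)))"
      unfolding sqrtN using C s0m by (intro mult_left_mono mult_right_mono) auto
    also have "\<dots> = C * exp (- (ln (real N) / 4))" by (simp flip: exp_add)
    also have "\<dots> \<le> C * (1 / (ln (real N) / 4))" using C lnN by (intro mult_left_mono recip) auto
    also have "\<dots> = 4 * C * 1 / (1 * ln (real N))" by simp
    also have "\<dots> \<le> 4 * C * (1 + \<beta>) / (p * ln (real N))"
      using C p lnN \<beta> by (intro frac_le mult_left_mono mult_right_mono) auto
    finally show "s0 powr (- m) * (C / sqrt (real N)) \<le> 4 * C * (1 + \<beta>) / (p * ln (real N))" .
  qed
  also have "\<dots> = (448 * exp_moment_const\<^sup>2 + 28) * (1 + \<beta>) / (p * ln (real N))"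
    unfolding C_def add_divide_distrib[symmetric] by (simp add: algebra_simps)
  finally show ?thesis .
qed

end

theorem theorem1p3:
  "\<exists>C::real. \<forall>(\<beta>::real) (N::nat) (p::real).
     \<beta> \<ge> 0 \<longrightarrow> N \<ge> 2 \<longrightarrow> 0 < p \<longrightarrow> p \<le> 1 \<longrightarrow> p * (real N)\<^sup>2 \<in> \<int> \<longrightarrow>
     prob_space.expectation (replica_law N \<beta> p) (\<lambda>(\<sigma>1, \<sigma>2). (overlap N \<sigma>1 \<sigma>2)\<^sup>2)
       \<le> C * (1 + \<beta>) / (p * ln (real N))"
proof (intro exI[of _ "448 * exp_moment_const\<^sup>2 + 28"] allI impI)
  fix \<beta> p :: real and N :: nat
  assume \<beta>: "\<beta> \<ge> 0" and N: "N \<ge> 2" and p: "0 < p" "p \<le> 1" "p * (real N)\<^sup>2 \<in> \<int>"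
  show "prob_space.expectation (replica_law N \<beta> p) (\<lambda>(\<sigma>1, \<sigma>2). (overlap N \<sigma>1 \<sigma>2)\<^sup>2)
     \<le> (448 * exp_moment_const\<^sup>2 + 28) * (1 + \<beta>) / (p * ln (real N))"
  proof (cases "\<beta> / sqrt (2 * real N) \<le> 1 / 8")
    case True
    then interpret sk N \<beta> using \<beta> N by unfold_locales
    show ?thesis by (rule overlap_bound[OF p])
  next
    \<comment> \<open>Here \<open>sqrt N < 8 * \<beta>\<close>, so
      \<open>ln N \<le> 16 * \<beta>\<close> and the right side is at least 1, which bounds any
      squared overlap.\<close>
    case False
    have lnN: "0 < ln (real N)" using N by simp
    have "sqrt (real N) \<le> sqrt (2 * real N)" by simp
    also have "\<dots> < 8 * \<beta>" using False N by (simp add: field_simps)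
    finally have "sqrt (real N) < 8 * \<beta>" .
    moreover have "ln (real N) / 2 \<le> sqrt (real N) - 1"
      using ln_le_minus_one[of "sqrt (real N)"] N by (simp add: ln_sqrt)
    ultimately have "ln (real N) \<le> 16 * \<beta>" by linarith
    also have "\<dots> \<le> 28 * (1 + \<beta>)" using \<beta> by (intro mult_mono) auto
    finally have ln: "ln (real N) \<le> 28 * (1 + \<beta>)" .
    have "prob_space.expectation (replica_law N \<beta> p) (\<lambda>(\<sigma>1, \<sigma>2). (overlap N \<sigma>1 \<sigma>2)\<^sup>2) \<le> 1"
      using p N by (intro expectation_le_1) auto
    also have "1 \<le> 28 * (1 + \<beta>) / ln (real N)" using ln lnN by simp
    also have "\<dots> \<le> (448 * exp_moment_const\<^sup>2 + 28) * (1 + \<beta>) / (1 * ln (real N))"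
      unfolding mult_1_left using \<beta> lnN by (intro divide_right_mono mult_right_mono) auto
    also have "\<dots> \<le> (448 * exp_moment_const\<^sup>2 + 28) * (1 + \<beta>) / (p * ln (real N))"
      using \<beta> lnN p by (intro divide_left_mono mult_right_mono) auto
    finally show ?thesis .
  qed
qed

end
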